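(* Let $G$ be a finite group acting linearly on a complex vector space $V$ with basis $v_1,\ldots,v_n$, and suppose $G$ acts diagonally on this basis: ${}^g v_i=\lambda_{g,i}v_i$ with $\lambda_{g,i}\in\mathbb{C}$ for all $g\in G$, $1\le i\le n$. Let $\mathbf{q}=(q_{ij})$ be nonzero complex scalars with $q_{ii}=1$ and $q_{ji}=q_{ij}^{-1}$ for all $i,j$. Let $\mathcal{R}$ be a complete set of representatives of the conjugacy classes of $G$, and for $a\in G$ let $C_G(a)$ be the centralizer of $a$ in $G$ and $[G/C_G(a)]$ a set of representatives of the (left) cosets of $C_G(a)$ in $G$. Then the maps $\kappa:V\times V\to\mathbb{C}G$ for which $\mathcal{H}_{\mathbf{q},\kappa}$ is a quantum Drinfeld Hecke algebra form a vector space with basis consisting of the (bilinear) maps $$f_{r,s,a}:V\times V\to\mathbb{C}G,\qquad (v_i,v_j)\mapsto(\delta_{i,r}\delta_{j,s}-q_{sr}\delta_{i,s}\delta_{j,r})\sum_{g\in[G/C_G(a)]}\lambda_{g,r}^{-1}\lambda_{g,s}^{-1}\,gag^{-1},$$ where $r<s$ and $a\in\mathcal{R}$ satisfy $q_{rr'}q_{sr'}=\lambda_{a,r'}$ for all $r'\neq r,s$ and $\lambda_{h,r}=\lambda_{h,s}^{-1}$ for all $h\in C_G(a)$.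
   Context: $\delta$ is the Kronecker delta. $S_{\mathbf{q}}(V)=\mathbb{C}\langle v_1,\ldots,v_n\mid v_iv_j=q_{ij}v_jv_i\ \forall i,j\rangle$, on which $G$ acts by algebra automorphisms since it acts diagonally; $T(V)$ is the tensor algebra. For an algebra $A$ with an action of $G$ by automorphisms $a\mapsto{}^g a$, the skew group algebra $A\rtimes G$ is the free left $A$-module with basis $G$ and multiplication $(ag)(bh)=a({}^g b)\,gh$. The maps $\kappa:V\times V\to\mathbb{C}G$ under consideration are bilinear and satisfy $\kappa(v_i,v_j)=-q_{ij}\kappa(v_j,v_i)$ for all $i,j$. For such $\kappa$, $$\mathcal{H}_{\mathbf{q},\kappa}=T(V)\rtimes G\,/\,(v_iv_j-q_{ij}v_jv_i-\kappa(v_i,v_j)\mid 1\le i,j\le n),$$ filtered with each $v_i$ in degree $1$ and each $g\in G$ in degree $0$; it is called a quantum Drinfeld Hecke algebra if its associated graded algebra is isomorphic (as a graded algebra) to $S_{\mathbf{q}}(V)\rtimes G$. Under the condition $\lambda_{h,r}=\lambda_{h,s}^{-1}$ for all $h\in C_G(a)$, the scalar $\lambda_{g,r}^{-1}\lambda_{g,s}^{-1}$ does not depend on the choice of coset representative $g$. *)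

theory Defs
  imports
    Complex_Main
    "HOL-Library.Function_Algebras"
    "HOL-Algebra.Module"
    "HOL-Algebra.QuotRing"
    "HOL-Algebra.Group_Action"
begin

text \<open>
  Complex algebras are records of type \<open>(complex, 'a) module\<close>: an HOL-Algebra ring record
  together with a scalar multiplication.
\<close>

text \<open>
  \<open>free_alg X\<close> is the free associative algebra on the alphabet \<open>X\<close>; an element is a
  finitely supported coefficient function on words. For a vector space with basis
  \<open>v\<^sub>1, \<dots>, v\<^sub>n\<close>, the word \<open>[i\<^sub>1, \<dots>, i\<^sub>k]\<close> stands for the tensor
  \<open>v\<^bsub>i\<^sub>1\<^esub> \<otimes> \<dots> \<otimes> v\<^bsub>i\<^sub>k\<^esub>\<close>, so \<open>free_alg {1..n}\<close> is
  the tensor algebra written in this basis.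
\<close>

definition free_alg :: "'x set \<Rightarrow> (complex, 'x list \<Rightarrow> complex) module" where
  "free_alg X =
    \<lparr>carrier = {p. finite {w. p w \<noteq> 0} \<and> (\<forall>w. p w \<noteq> 0 \<longrightarrow> set w \<subseteq> X)},
     mult = (\<lambda>p p' w. \<Sum>k\<le>length w. p (take k w) * p' (drop k w)),
     one = (\<lambda>w. if w = [] then 1 else 0),
     zero = (\<lambda>w. 0),
     add = (\<lambda>p p' w. p w + p' w),
     smult = (\<lambda>c p w. c * p w)\<rparr>"

definition free_gen :: "'x \<Rightarrow> 'x list \<Rightarrow> complex" where
  "free_gen i = (\<lambda>w. if w = [i] then 1 else 0)"

definition free_degree :: "'x set \<Rightarrow> nat \<Rightarrow> ('x list \<Rightarrow> complex) set" where
  "free_degree X d = {p \<in> carrier (free_alg X). \<forall>w. p w \<noteq> 0 \<longrightarrow> length w = d}"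

definition free_filtration :: "'x set \<Rightarrow> nat \<Rightarrow> ('x list \<Rightarrow> complex) set" where
  "free_filtration X d = {p \<in> carrier (free_alg X). \<forall>w. p w \<noteq> 0 \<longrightarrow> length w \<le> d}"

text \<open>The algebra automorphism of the free algebra extending \<open>v\<^sub>i \<mapsto> lam g i \<cdot> v\<^sub>i\<close>.\<close>

definition free_act :: "('g \<Rightarrow> 'x \<Rightarrow> complex) \<Rightarrow> 'g \<Rightarrow> ('x list \<Rightarrow> complex) \<Rightarrow> 'x list \<Rightarrow> complex" where
  "free_act lam g p = (\<lambda>w. (\<Prod>i\<leftarrow>w. lam g i) * p w)"

definition quot_alg :: "(complex, 'a) module \<Rightarrow> 'a set \<Rightarrow> (complex, 'a set) module" where
  "quot_alg A I =
    ring.extend (A Quot I) (module.fields (\<lambda>c C. \<Union>x\<in>C. I +>\<^bsub>A\<^esub> (c \<odot>\<^bsub>A\<^esub> x)))"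

text \<open>
  For a finite group \<open>G\<close>, an element \<open>\<Sum>\<^sub>g a\<^sub>g g\<close> of the skew group algebra of \<open>A\<close> by
  \<open>G\<close> is the function \<open>g \<mapsto> a\<^sub>g\<close>, set to zero outside \<open>carrier G\<close>.
\<close>

definition skew_part :: "('g, 'm) monoid_scheme \<Rightarrow> (complex, 'a) module \<Rightarrow> 'a set \<Rightarrow> ('g \<Rightarrow> 'a) set" where
  "skew_part G A S =
    {x. (\<forall>g\<in>carrier G. x g \<in> S) \<and> (\<forall>g. g \<notin> carrier G \<longrightarrow> x g = \<zero>\<^bsub>A\<^esub>)}"

definition skew_alg ::
  "('g, 'm) monoid_scheme \<Rightarrow> (complex, 'a) module \<Rightarrow> ('g \<Rightarrow> 'a \<Rightarrow> 'a) \<Rightarrow> (complex, 'g \<Rightarrow> 'a) module" where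
  "skew_alg G A act =
    \<lparr>carrier = skew_part G A (carrier A),
     mult = (\<lambda>x y k. if k \<in> carrier G
       then \<Oplus>\<^bsub>A\<^esub>g\<in>carrier G. x g \<otimes>\<^bsub>A\<^esub> act g (y (inv\<^bsub>G\<^esub> g \<otimes>\<^bsub>G\<^esub> k))
       else \<zero>\<^bsub>A\<^esub>),
     one = (\<lambda>k. if k = \<one>\<^bsub>G\<^esub> then \<one>\<^bsub>A\<^esub> else \<zero>\<^bsub>A\<^esub>),
     zero = (\<lambda>k. \<zero>\<^bsub>A\<^esub>),
     add = (\<lambda>x y k. x k \<oplus>\<^bsub>A\<^esub> y k),
     smult = (\<lambda>c x k. c \<odot>\<^bsub>A\<^esub> x k)\<rparr>"

definition skew_incl :: "('g, 'm) monoid_scheme \<Rightarrow> (complex, 'a) module \<Rightarrow> 'a \<Rightarrow> 'g \<Rightarrow> 'a" where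
  "skew_incl G A a = (\<lambda>k. if k = \<one>\<^bsub>G\<^esub> then a else \<zero>\<^bsub>A\<^esub>)"

text \<open>The underlying space of the group algebra, with the same convention outside \<open>carrier G\<close>.\<close>

definition group_alg :: "('g, 'm) monoid_scheme \<Rightarrow> ('g \<Rightarrow> complex) set" where
  "group_alg G = {x. \<forall>g. g \<notin> carrier G \<longrightarrow> x g = 0}"

definition group_alg_incl :: "(complex, 'a) module \<Rightarrow> ('g \<Rightarrow> complex) \<Rightarrow> 'g \<Rightarrow> 'a" where
  "group_alg_incl A x = (\<lambda>g. x g \<odot>\<^bsub>A\<^esub> \<one>\<^bsub>A\<^esub>)"

text \<open>
  For an algebra \<open>A\<close> with an increasing multiplicative filtration
  \<open>F 0 \<subseteq> F 1 \<subseteq> \<dots>\<close>, the associated graded algebra is the direct sum of the spaces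
  \<open>F d / F (d - 1)\<close>, where \<open>F (-1) = 0\<close>. An element is the finitely supported family of its
  components, each of which is a coset of \<open>F (d - 1)\<close>.
\<close>

definition filt_pred :: "(complex, 'a) module \<Rightarrow> (nat \<Rightarrow> 'a set) \<Rightarrow> nat \<Rightarrow> 'a set" where
  "filt_pred A F d = (case d of 0 \<Rightarrow> {\<zero>\<^bsub>A\<^esub>} | Suc k \<Rightarrow> F k)"

definition gr_alg :: "(complex, 'a) module \<Rightarrow> (nat \<Rightarrow> 'a set) \<Rightarrow> (complex, nat \<Rightarrow> 'a set) module" where
  "gr_alg A F =
    \<lparr>carrier = {x. (\<forall>d. x d \<in> (\<lambda>a. filt_pred A F d +>\<^bsub>A\<^esub> a) ` F d) \<and>
                   finite {d. x d \<noteq> filt_pred A F d}},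
     mult = (\<lambda>x y d. \<Union>a\<in>Pi {..d} x. \<Union>b\<in>Pi {..d} y.
       filt_pred A F d +>\<^bsub>A\<^esub> (\<Oplus>\<^bsub>A\<^esub>i\<in>{..d}. a i \<otimes>\<^bsub>A\<^esub> b (d - i))),
     one = (\<lambda>d. filt_pred A F d +>\<^bsub>A\<^esub> (if d = 0 then \<one>\<^bsub>A\<^esub> else \<zero>\<^bsub>A\<^esub>)),
     zero = (\<lambda>d. filt_pred A F d),
     add = (\<lambda>x y d. x d <+>\<^bsub>A\<^esub> y d),
     smult = (\<lambda>c x d. \<Union>a\<in>x d. filt_pred A F d +>\<^bsub>A\<^esub> (c \<odot>\<^bsub>A\<^esub> a))\<rparr>"

definition gr_degree :: "(complex, 'a) module \<Rightarrow> (nat \<Rightarrow> 'a set) \<Rightarrow> nat \<Rightarrow> (nat \<Rightarrow> 'a set) set" where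
  "gr_degree A F d = {x \<in> carrier (gr_alg A F). \<forall>e. e \<noteq> d \<longrightarrow> x e = filt_pred A F e}"

definition graded_alg_iso ::
  "(complex, 'a) module \<Rightarrow> (nat \<Rightarrow> 'a set) \<Rightarrow> (complex, 'b) module \<Rightarrow> (nat \<Rightarrow> 'b set) \<Rightarrow> bool" where
  "graded_alg_iso A AD B BD \<longleftrightarrow>
    (\<exists>\<phi>\<in>ring_iso A B.
      (\<forall>c. \<forall>x\<in>carrier A. \<phi> (c \<odot>\<^bsub>A\<^esub> x) = c \<odot>\<^bsub>B\<^esub> \<phi> x) \<and>
      (\<forall>d. \<phi> ` AD d = BD d))"

definition qsym_ideal :: "nat \<Rightarrow> (nat \<Rightarrow> nat \<Rightarrow> complex) \<Rightarrow> (nat list \<Rightarrow> complex) set" where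
  "qsym_ideal n q =
    (let T = free_alg {1..n} in
     Idl\<^bsub>T\<^esub> {(free_gen i \<otimes>\<^bsub>T\<^esub> free_gen j) \<ominus>\<^bsub>T\<^esub> (q i j \<odot>\<^bsub>T\<^esub> (free_gen j \<otimes>\<^bsub>T\<^esub> free_gen i))
       | i j. i \<in> {1..n} \<and> j \<in> {1..n}})"

definition qsym :: "nat \<Rightarrow> (nat \<Rightarrow> nat \<Rightarrow> complex) \<Rightarrow> (complex, (nat list \<Rightarrow> complex) set) module" where
  "qsym n q = quot_alg (free_alg {1..n}) (qsym_ideal n q)"

text \<open>The induced automorphism of the quotient sends a coset to its image.\<close>

definition qsym_act ::
  "('g \<Rightarrow> nat \<Rightarrow> complex) \<Rightarrow> 'g \<Rightarrow> (nat list \<Rightarrow> complex) set \<Rightarrow> (nat list \<Rightarrow> complex) set" where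
  "qsym_act lam g C = free_act lam g ` C"

definition qsym_skew ::
  "('g, 'm) monoid_scheme \<Rightarrow> nat \<Rightarrow> ('g \<Rightarrow> nat \<Rightarrow> complex) \<Rightarrow> (nat \<Rightarrow> nat \<Rightarrow> complex)
    \<Rightarrow> (complex, 'g \<Rightarrow> (nat list \<Rightarrow> complex) set) module" where
  "qsym_skew G n lam q = skew_alg G (qsym n q) (qsym_act lam)"

definition qsym_skew_degree ::
  "('g, 'm) monoid_scheme \<Rightarrow> nat \<Rightarrow> (nat \<Rightarrow> nat \<Rightarrow> complex) \<Rightarrow> nat
    \<Rightarrow> ('g \<Rightarrow> (nat list \<Rightarrow> complex) set) set" where
  "qsym_skew_degree G n q d =
    skew_part G (qsym n q)
      ((\<lambda>p. qsym_ideal n q +>\<^bsub>free_alg {1..n}\<^esub> p) ` free_degree {1..n} d)"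

definition tensor_skew ::
  "('g, 'm) monoid_scheme \<Rightarrow> nat \<Rightarrow> ('g \<Rightarrow> nat \<Rightarrow> complex)
    \<Rightarrow> (complex, 'g \<Rightarrow> nat list \<Rightarrow> complex) module" where
  "tensor_skew G n lam = skew_alg G (free_alg {1..n}) (free_act lam)"

text \<open>Here \<open>k i j\<close> is the element \<open>\<kappa>(v\<^sub>i, v\<^sub>j)\<close> of the group algebra.\<close>

definition hecke_ideal ::
  "('g, 'm) monoid_scheme \<Rightarrow> nat \<Rightarrow> ('g \<Rightarrow> nat \<Rightarrow> complex) \<Rightarrow> (nat \<Rightarrow> nat \<Rightarrow> complex)
    \<Rightarrow> (nat \<Rightarrow> nat \<Rightarrow> 'g \<Rightarrow> complex) \<Rightarrow> ('g \<Rightarrow> nat list \<Rightarrow> complex) set" where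
  "hecke_ideal G n lam q k =
    (let T = free_alg {1..n}; A = tensor_skew G n lam; x = (\<lambda>i. skew_incl G T (free_gen i)) in
     Idl\<^bsub>A\<^esub> {((x i \<otimes>\<^bsub>A\<^esub> x j) \<ominus>\<^bsub>A\<^esub> (q i j \<odot>\<^bsub>A\<^esub> (x j \<otimes>\<^bsub>A\<^esub> x i))) \<ominus>\<^bsub>A\<^esub> group_alg_incl T (k i j)
       | i j. i \<in> {1..n} \<and> j \<in> {1..n}})"

definition hecke_alg ::
  "('g, 'm) monoid_scheme \<Rightarrow> nat \<Rightarrow> ('g \<Rightarrow> nat \<Rightarrow> complex) \<Rightarrow> (nat \<Rightarrow> nat \<Rightarrow> complex)
    \<Rightarrow> (nat \<Rightarrow> nat \<Rightarrow> 'g \<Rightarrow> complex) \<Rightarrow> (complex, ('g \<Rightarrow> nat list \<Rightarrow> complex) set) module" where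
  "hecke_alg G n lam q k = quot_alg (tensor_skew G n lam) (hecke_ideal G n lam q k)"

definition hecke_filtration ::
  "('g, 'm) monoid_scheme \<Rightarrow> nat \<Rightarrow> ('g \<Rightarrow> nat \<Rightarrow> complex) \<Rightarrow> (nat \<Rightarrow> nat \<Rightarrow> complex)
    \<Rightarrow> (nat \<Rightarrow> nat \<Rightarrow> 'g \<Rightarrow> complex) \<Rightarrow> nat \<Rightarrow> ('g \<Rightarrow> nat list \<Rightarrow> complex) set set" where
  "hecke_filtration G n lam q k d =
    (\<lambda>x. hecke_ideal G n lam q k +>\<^bsub>tensor_skew G n lam\<^esub> x) `
      skew_part G (free_alg {1..n}) (free_filtration {1..n} d)"

definition quantum_drinfeld_hecke ::
  "('g, 'm) monoid_scheme \<Rightarrow> nat \<Rightarrow> ('g \<Rightarrow> nat \<Rightarrow> complex) \<Rightarrow> (nat \<Rightarrow> nat \<Rightarrow> complex)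
    \<Rightarrow> (nat \<Rightarrow> nat \<Rightarrow> 'g \<Rightarrow> complex) \<Rightarrow> bool" where
  "quantum_drinfeld_hecke G n lam q k \<longleftrightarrow>
    (let H = hecke_alg G n lam q k; F = hecke_filtration G n lam q k in
     graded_alg_iso (gr_alg H F) (gr_degree H F) (qsym_skew G n lam q) (qsym_skew_degree G n q))"

definition map_scale :: "complex \<Rightarrow> ('v \<Rightarrow> 'v \<Rightarrow> 'g \<Rightarrow> complex) \<Rightarrow> 'v \<Rightarrow> 'v \<Rightarrow> 'g \<Rightarrow> complex" where
  "map_scale c \<kappa> = (\<lambda>u w g. c * \<kappa> u w g)"

lemma vector_space_map_scale: "vector_space map_scale"
  by unfold_locales (auto simp: map_scale_def fun_eq_iff algebra_simps)

definition bilinear_map ::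
  "('g, 'm) monoid_scheme \<Rightarrow> (complex \<Rightarrow> 'v \<Rightarrow> 'v::ab_group_add) \<Rightarrow> ('v \<Rightarrow> 'v \<Rightarrow> 'g \<Rightarrow> complex) \<Rightarrow> bool" where
  "bilinear_map G scale \<kappa> \<longleftrightarrow>
    (\<forall>u w. \<kappa> u w \<in> group_alg G) \<and>
    (\<forall>u. Vector_Spaces.linear scale (\<lambda>c x g. c * x g) (\<lambda>w. \<kappa> u w)) \<and>
    (\<forall>w. Vector_Spaces.linear scale (\<lambda>c x g. c * x g) (\<lambda>u. \<kappa> u w))"

definition hecke_maps ::
  "('g, 'm) monoid_scheme \<Rightarrow> nat \<Rightarrow> (complex \<Rightarrow> 'v \<Rightarrow> 'v::ab_group_add) \<Rightarrow> (nat \<Rightarrow> 'v)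
    \<Rightarrow> ('g \<Rightarrow> nat \<Rightarrow> complex) \<Rightarrow> (nat \<Rightarrow> nat \<Rightarrow> complex) \<Rightarrow> ('v \<Rightarrow> 'v \<Rightarrow> 'g \<Rightarrow> complex) set" where
  "hecke_maps G n scale v lam q =
    {\<kappa>. bilinear_map G scale \<kappa> \<and>
        (\<forall>i\<in>{1..n}. \<forall>j\<in>{1..n}. \<forall>g. \<kappa> (v i) (v j) g = - q i j * \<kappa> (v j) (v i) g) \<and>
        quantum_drinfeld_hecke G n lam q (\<lambda>i j. \<kappa> (v i) (v j))}"

definition centralizer :: "('g, 'm) monoid_scheme \<Rightarrow> 'g \<Rightarrow> 'g set" where
  "centralizer G a = {h \<in> carrier G. h \<otimes>\<^bsub>G\<^esub> a = a \<otimes>\<^bsub>G\<^esub> h}"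

definition conjugacy_class :: "('g, 'm) monoid_scheme \<Rightarrow> 'g \<Rightarrow> 'g set" where
  "conjugacy_class G a = {g \<otimes>\<^bsub>G\<^esub> a \<otimes>\<^bsub>G\<^esub> inv\<^bsub>G\<^esub> g | g. g \<in> carrier G}"

definition conjugacy_class_reps :: "('g, 'm) monoid_scheme \<Rightarrow> 'g set \<Rightarrow> bool" where
  "conjugacy_class_reps G R \<longleftrightarrow>
    R \<subseteq> carrier G \<and> (\<forall>a\<in>carrier G. \<exists>!b. b \<in> R \<and> b \<in> conjugacy_class G a)"

definition left_coset_reps :: "('g, 'm) monoid_scheme \<Rightarrow> 'g set \<Rightarrow> 'g set \<Rightarrow> bool" where
  "left_coset_reps G H T \<longleftrightarrow>
    T \<subseteq> carrier G \<and> (\<forall>x\<in>carrier G. \<exists>!t. t \<in> T \<and> t \<in> x <#\<^bsub>G\<^esub> H)"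

text \<open>
  \<open>basis_map\<close> is the bilinear extension of its values on pairs \<open>(v i, v j)\<close> of basis vectors.
  The set \<open>T\<close> is a system of representatives for the left cosets of the centralizer of \<open>a\<close>.
\<close>

definition basis_map ::
  "('g, 'm) monoid_scheme \<Rightarrow> nat \<Rightarrow> (complex \<Rightarrow> 'v \<Rightarrow> 'v::ab_group_add) \<Rightarrow> (nat \<Rightarrow> 'v)
    \<Rightarrow> ('g \<Rightarrow> nat \<Rightarrow> complex) \<Rightarrow> (nat \<Rightarrow> nat \<Rightarrow> complex) \<Rightarrow> 'g set
    \<Rightarrow> nat \<Rightarrow> nat \<Rightarrow> 'g \<Rightarrow> 'v \<Rightarrow> 'v \<Rightarrow> 'g \<Rightarrow> complex" where
  "basis_map G n scale v lam q T r s a = (\<lambda>u w k.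
    \<Sum>i\<in>{1..n}. \<Sum>j\<in>{1..n}.
      module.representation scale (v ` {1..n}) u (v i) *
      module.representation scale (v ` {1..n}) w (v j) *
      ((of_bool (i = r) * of_bool (j = s) - q s r * of_bool (i = s) * of_bool (j = r)) *
       (\<Sum>g\<in>T. inverse (lam g r) * inverse (lam g s) * of_bool (k = g \<otimes>\<^bsub>G\<^esub> a \<otimes>\<^bsub>G\<^esub> inv\<^bsub>G\<^esub> g))))"

definition basis_index ::
  "('g, 'm) monoid_scheme \<Rightarrow> nat \<Rightarrow> ('g \<Rightarrow> nat \<Rightarrow> complex) \<Rightarrow> (nat \<Rightarrow> nat \<Rightarrow> complex)
    \<Rightarrow> 'g set \<Rightarrow> (nat \<times> nat \<times> 'g) set" where
  "basis_index G n lam q R =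
    {(r, s, a). 1 \<le> r \<and> r < s \<and> s \<le> n \<and> a \<in> R \<and>
      (\<forall>r'\<in>{1..n}. r' \<noteq> r \<and> r' \<noteq> s \<longrightarrow> q r r' * q s r' = lam a r') \<and>
      (\<forall>h\<in>centralizer G a. lam h r = inverse (lam h s))}"

end

theory Submission
  imports Defs
begin

text \<open>
  Write \<open>\<kappa>(v\<^sub>i, v\<^sub>j) = \<Sum>\<^sub>g \<kappa> i j g * g\<close>. The defining relations allow every word to be
  straightened: \<open>v\<^sub>i v\<^sub>j\<close> with \<open>j < i\<close> is replaced by \<open>q i j * v\<^sub>j v\<^sub>i + \<kappa>(v\<^sub>i, v\<^sub>j)\<close>, and group
  elements are moved to the right by \<open>g v\<^sub>i = lam g i * v\<^sub>i g\<close>. The algebra is a quantum Drinfeld Hecke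
  algebra if and only if this rewriting is consistent, in the spirit of Bergman's diamond lemma.
  There are two kinds of ambiguity. Moving \<open>g\<close> past a relation gives equivariance,
  \<open>\<kappa> i j (g\<^sup>-\<^sup>1 h g) = lam g i * lam g j * \<kappa> i j h\<close>. The two ways of straightening
  \<open>v\<^sub>k v\<^sub>j v\<^sub>i\<close> differ by an expression of degree one in the generators, and its coefficients at the
  elements \<open>v\<^sub>l g\<close> decouple because the action is diagonal: what is left is that
  \<open>\<kappa> i j g \<noteq> 0\<close> forces \<open>lam g l = q i l * q j l\<close> for \<open>l \<noteq> i, j\<close>.
  This is \<open>quantum_drinfeld_hecke_iff\<close>.

  Sufficiency. Both the associated graded algebra of the Hecke algebra and the skew group algebra of
  the quantum symmetric algebra are quotients of the graded algebra \<open>T(V) \<rtimes> G\<close>, by the maps \<open>leading\<close>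
  and \<open>qproj\<close>. They are isomorphic once these maps have the same kernel. One inclusion holds for
  every \<open>\<kappa>\<close> (\<open>ker_qproj_le\<close>). For the other one, the two conditions make the normal form \<open>nf\<close>
  independent of the choice of reductions (\<open>nf_eq_reduct\<close>), so its linear extension \<open>NF\<close> vanishes on
  the Hecke ideal (\<open>NF_ideal\<close>), while in top degree it is the normal form of the quantum symmetric
  algebra (\<open>nf_top\<close>); comparing top degrees gives \<open>ker_leading_le\<close>.

  Necessity. An arbitrary graded isomorphism is given, not the natural one, but in degrees 0 and 1
  a dimension count turns it into injectivity of \<open>leading\<close> (\<open>leading_injective_low\<close>). Hence the
  Hecke ideal contains no nonzero element of filtration degree at most 1 (\<open>ideal_low_trivial\<close>), and
  the discrepancies of the two ambiguities are such elements.

  The basis. Both conditions are linear in \<open>\<kappa>\<close> and involve one pair \<open>{i, j}\<close> and one conjugacy class at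
  a time. By equivariance \<open>\<kappa> i j\<close> is determined on a class by its value at the representative \<open>a\<close>, and
  this value can be nonzero only if \<open>lam h i * lam h j = 1\<close> on the centralizer of \<open>a\<close>. The values
  \<open>\<kappa> r s a\<close> are therefore coordinates, and the maps \<open>f\<^bsub>r,s,a\<^esub>\<close> are dual to them (\<open>bmap_dual\<close>).
\<close>

section \<open>Algebras of functions and their quotients\<close>

text \<open>
  The algebras in question are made of functions, so their addition is pointwise. Identifying it
  with the type class addition gives access to \<open>sum\<close> and to the simplifier's ring arithmetic.
  The last assumption ties the scalars to the multiplication; it makes every ideal a subspace.
\<close>

locale concrete_alg = ring A for A :: "(complex, 'a::ab_group_add) module" (structure) +
  assumes add_eq: "x \<oplus> y = x + y"
    and zero_eq: "\<zero> = 0"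
    and smult_closed [simp, intro]: "x \<in> carrier A \<Longrightarrow> c \<odot> x \<in> carrier A"
    and smult_eq: "x \<in> carrier A \<Longrightarrow> c \<odot> x = (c \<odot> \<one>) \<otimes> x"
begin

lemma zero_carr [simp, intro]: "0 \<in> carrier A"
  using zero_closed by (simp add: zero_eq)

lemma add_carr [simp, intro]: "x \<in> carrier A \<Longrightarrow> y \<in> carrier A \<Longrightarrow> x + y \<in> carrier A"
  using add.m_closed[of x y] by (simp add: add_eq)

lemma a_inv_eq: "x \<in> carrier A \<Longrightarrow> \<ominus> x = - x"
proof -
  assume x: "x \<in> carrier A"
  then have "x + (\<ominus> x) = 0" using r_neg[OF x] by (simp add: add_eq zero_eq)
  then show ?thesis by (simp add: add_eq_0_iff)
qed

lemma uminus_carr [simp, intro]: "x \<in> carrier A \<Longrightarrow> - x \<in> carrier A"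
  using a_inv_closed[of x] a_inv_eq[of x] by simp

lemma minus_carr [simp, intro]: "x \<in> carrier A \<Longrightarrow> y \<in> carrier A \<Longrightarrow> x - y \<in> carrier A"
  using add_carr[of x "- y"] by simp

lemma a_minus_eq: "y \<in> carrier A \<Longrightarrow> x \<ominus> y = x - y"
  by (simp add: a_minus_def a_inv_eq add_eq)

lemma sum_carr [intro]: "(\<And>i. i \<in> S \<Longrightarrow> f i \<in> carrier A) \<Longrightarrow> sum f S \<in> carrier A"
  by (induction S rule: infinite_finite_induct) auto

lemma mult_add_right:
  "x \<in> carrier A \<Longrightarrow> y \<in> carrier A \<Longrightarrow> z \<in> carrier A \<Longrightarrow> x \<otimes> (y + z) = x \<otimes> y + x \<otimes> z"
  using r_distr[of y z x] by (simp add: add_eq)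

lemma mult_add_left:
  "x \<in> carrier A \<Longrightarrow> y \<in> carrier A \<Longrightarrow> z \<in> carrier A \<Longrightarrow> (x + y) \<otimes> z = x \<otimes> z + y \<otimes> z"
  using l_distr[of x y z] by (simp add: add_eq)

lemma mult_zero_left [simp]: "x \<in> carrier A \<Longrightarrow> 0 \<otimes> x = 0"
  using l_null[of x] by (simp add: zero_eq)

lemma mult_zero_right [simp]: "x \<in> carrier A \<Longrightarrow> x \<otimes> 0 = 0"
  using r_null[of x] by (simp add: zero_eq)

lemma smult_add: "x \<in> carrier A \<Longrightarrow> y \<in> carrier A \<Longrightarrow> c \<odot> (x + y) = c \<odot> x + c \<odot> y"
  by (simp add: smult_eq[of "x + y"] smult_eq[of x] smult_eq[of y] mult_add_right)

lemma smult_zero [simp]: "c \<odot> 0 = 0"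
  by (simp add: smult_eq[of 0])

lemma smult_mult: "x \<in> carrier A \<Longrightarrow> y \<in> carrier A \<Longrightarrow> (c \<odot> x) \<otimes> y = c \<odot> (x \<otimes> y)"
  by (simp add: smult_eq[of x] smult_eq[of "x \<otimes> y"] m_assoc)

lemma finsum_eq_sum:
  assumes "finite S" "\<And>i. i \<in> S \<Longrightarrow> f i \<in> carrier A"
  shows "finsum A f S = sum f S"
  using assms
proof (induction S)
  case (insert i S)
  then have "finsum A f (insert i S) = f i \<oplus> finsum A f S"
    by (intro finsum_insert) auto
  with insert show ?case by (simp add: add_eq)
qed (simp add: zero_eq)

end

locale alg_ideal = concrete_alg A + ideal I A for A :: "(complex, 'a::ab_group_add) module" (structure) and I
begin

lemma I_zero [simp]: "0 \<in> I"
  using additive_subgroup.zero_closed[OF additive_subgroup_axioms] by (simp add: zero_eq)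

lemma I_add [intro]: "x \<in> I \<Longrightarrow> y \<in> I \<Longrightarrow> x + y \<in> I"
  using additive_subgroup.a_closed[OF additive_subgroup_axioms] by (simp add: add_eq)

lemma I_uminus [intro]: "x \<in> I \<Longrightarrow> - x \<in> I"
  using additive_subgroup.a_inv_closed[OF additive_subgroup_axioms] by (metis Icarr a_inv_eq)

lemma I_minus [intro]: "x \<in> I \<Longrightarrow> y \<in> I \<Longrightarrow> x - y \<in> I"
  using I_add[of x "- y"] I_uminus[of y] by simp

lemma I_sum [intro]: "(\<And>i. i \<in> S \<Longrightarrow> f i \<in> I) \<Longrightarrow> sum f S \<in> I"
  by (induction S rule: infinite_finite_induct) auto

lemma I_smult [intro]: "x \<in> I \<Longrightarrow> c \<odot> x \<in> I"
  using I_l_closed[of x "c \<odot> \<one>"] Icarr[of x] by (simp add: smult_eq[of x])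

lemma coset_eq: "I +> x = (\<lambda>i. i + x) ` I"
  by (auto simp: a_r_coset_def' add_eq)

lemma coset_eq_iff:
  "I +> x = I +> y \<longleftrightarrow> x - y \<in> I"
proof
  assume "I +> x = I +> y"
  then have "x \<in> (\<lambda>i. i + y) ` I" unfolding coset_eq by (metis I_zero add_0 image_eqI)
  then show "x - y \<in> I" by auto
next
  assume xy: "x - y \<in> I"
  have "\<exists>j\<in>I. i + x = j + y" if "i \<in> I" for i
    using I_add[OF that xy] by (intro bexI[of _ "i + (x - y)"]) auto
  moreover have "\<exists>j\<in>I. i + y = j + x" if "i \<in> I" for i
    using I_minus[OF that xy] by (intro bexI[of _ "i - (x - y)"]) auto
  ultimately show "I +> x = I +> y" unfolding coset_eq by (auto simp: image_iff)
qed

lemma coset_zero: "I +> 0 = I"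
  by (simp add: coset_eq)

abbreviation Q where "Q \<equiv> quot_alg A I"

lemma quot_carrier: "carrier Q = (\<lambda>x. I +> x) ` carrier A"
  by (auto simp: quot_alg_def ring.defs FactRing_def A_RCOSETS_def')

lemma quot_zero: "\<zero>\<^bsub>Q\<^esub> = I"
  by (simp add: quot_alg_def ring.defs FactRing_def)

lemma quot_one: "\<one>\<^bsub>Q\<^esub> = I +> \<one>"
  by (simp add: quot_alg_def ring.defs FactRing_def)

lemma quot_mult: "x \<in> carrier A \<Longrightarrow> y \<in> carrier A \<Longrightarrow> (I +> x) \<otimes>\<^bsub>Q\<^esub> (I +> y) = I +> (x \<otimes> y)"
  by (simp add: quot_alg_def ring.defs FactRing_def rcoset_mult_add)

lemma quot_add: "x \<in> carrier A \<Longrightarrow> y \<in> carrier A \<Longrightarrow> (I +> x) \<oplus>\<^bsub>Q\<^esub> (I +> y) = I +> (x + y)"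
  by (simp add: quot_alg_def ring.defs FactRing_def a_rcos_sum add_eq)

lemma quot_smult:
  assumes "x \<in> carrier A"
  shows "c \<odot>\<^bsub>Q\<^esub> (I +> x) = I +> (c \<odot> x)"
proof -
  have "I +> (c \<odot> (i + x)) = I +> (c \<odot> x)" if "i \<in> I" for i
    using I_smult[OF that] assms Icarr[OF that] by (simp add: coset_eq_iff smult_add)
  then have "I +> (c \<odot> y) = I +> (c \<odot> x)" if "y \<in> I +> x" for y
    using that by (auto simp: coset_eq[of x])
  moreover have "x \<in> I +> x"
    by (auto simp: coset_eq intro: image_eqI[of _ _ 0])
  ultimately have "(\<Union>y\<in>I +> x. I +> (c \<odot> y)) = I +> (c \<odot> x)"
    by blast
  then show ?thesis
    by (simp add: quot_alg_def ring.defs module.defs)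
qed

text \<open>
  Extending the record \<open>A Quot I\<close> by a scalar multiplication changes its type, so the ring axioms
  are recovered from \<open>Q\<close> being the homomorphic image of \<open>A\<close>.
\<close>
lemma quot_ring: "ring Q"
proof -
  have "(+>) I \<in> ring_hom A Q"
    by (rule ring_hom_memI) (auto simp: quot_carrier quot_mult quot_add quot_one add_eq)
  then have "ring (Q\<lparr>carrier := (+>) I ` carrier A, zero := I +> \<zero>\<rparr>)"
    by (rule ring_hom_imp_img_ring)
  moreover have "Q\<lparr>carrier := (+>) I ` carrier A, zero := I +> \<zero>\<rparr> = Q"
    using quot_carrier quot_zero coset_zero by (simp add: zero_eq)
  ultimately show ?thesis by simp
qed

lemma quot_finsum:
  assumes "finite S" "\<And>i. i \<in> S \<Longrightarrow> f i \<in> carrier A"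
  shows "finsum Q (\<lambda>i. I +> f i) S = I +> sum f S"
proof -
  interpret Q: ring Q by (rule quot_ring)
  show ?thesis using assms
  proof (induction S)
    case empty
    then show ?case by (simp add: quot_zero coset_zero)
  next
    case (insert i S)
    then have "finsum Q (\<lambda>i. I +> f i) (insert i S) = (I +> f i) \<oplus>\<^bsub>Q\<^esub> finsum Q (\<lambda>i. I +> f i) S"
      by (intro Q.finsum_insert) (auto simp: quot_carrier)
    with insert show ?case by (simp add: quot_add sum_carr)
  qed
qed

end

section \<open>The associated graded algebra of a quotient of a graded algebra\<close>

text \<open>
  A grading is given by its projections \<open>comp d\<close> onto the components of degree \<open>d\<close>.
\<close>
locale graded_alg = concrete_alg A for A :: "(complex, 'a::ab_group_add) module" (structure) +
  fixes comp :: "nat \<Rightarrow> 'a \<Rightarrow> 'a"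
  assumes comp_closed [simp, intro]: "x \<in> carrier A \<Longrightarrow> comp d x \<in> carrier A"
    and comp_add: "comp d (x + y) = comp d x + comp d y"
    and comp_comp: "comp d (comp e x) = (if d = e then comp e x else 0)"
    and comp_finite: "x \<in> carrier A \<Longrightarrow> finite {d. comp d x \<noteq> 0}"
    and comp_sum: "x \<in> carrier A \<Longrightarrow> x = (\<Sum>d | comp d x \<noteq> 0. comp d x)"
    and comp_mult: "x \<in> carrier A \<Longrightarrow> y \<in> carrier A \<Longrightarrow>
      comp d (x \<otimes> y) = (\<Sum>i\<le>d. comp i x \<otimes> comp (d - i) y)"
    and comp_smult: "x \<in> carrier A \<Longrightarrow> comp d (c \<odot> x) = c \<odot> comp d x"
    and comp_one: "comp d \<one> = (if d = 0 then \<one> else 0)"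
begin

lemma comp_zero [simp]: "comp d 0 = 0"
  using comp_add[of d 0 0] by simp

lemma comp_uminus: "comp d (- x) = - comp d x"
  using comp_add[of d x "- x"] by (simp add: eq_neg_iff_add_eq_0 add.commute)

lemma comp_diff: "comp d (x - y) = comp d x - comp d y"
  using comp_add[of d x "- y"] by (simp add: comp_uminus)

lemma comp_of_sum: "comp d (sum f S) = (\<Sum>i\<in>S. comp d (f i))"
  by (induction S rule: infinite_finite_induct) (auto simp: comp_add)

lemma comp_ext:
  assumes "x \<in> carrier A" "y \<in> carrier A" "\<And>d. comp d x = comp d y"
  shows "x = y"
  using comp_sum[OF assms(1)] comp_sum[OF assms(2)] assms(3) by simp

text \<open>
  With a strict bound, \<open>below 0\<close> is the zero space, which is the convention \<open>F (-1) = 0\<close>; this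
  avoids a case distinction in the associated graded algebra.
\<close>
definition below :: "nat \<Rightarrow> 'a set" where
  "below d = {x \<in> carrier A. \<forall>e\<ge>d. comp e x = 0}"

definition homog :: "nat \<Rightarrow> 'a set" where
  "homog d = {x \<in> carrier A. comp d x = x}"

lemma below_carr: "x \<in> below d \<Longrightarrow> x \<in> carrier A"
  by (simp add: below_def)

lemma below_0: "below 0 = {0}"
  using comp_ext[of _ 0] by (auto simp: below_def)

lemma below_zero [simp]: "0 \<in> below d"
  by (auto simp: below_def)

lemma below_add: "x \<in> below d \<Longrightarrow> y \<in> below d \<Longrightarrow> x + y \<in> below d"
  by (auto simp: below_def comp_add)

lemma below_diff: "x \<in> below d \<Longrightarrow> y \<in> below d \<Longrightarrow> x - y \<in> below d"
  by (auto simp: below_def comp_diff)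

lemma below_uminus: "x \<in> below d \<Longrightarrow> - x \<in> below d"
  using below_diff[of 0 d x] by simp

lemma below_smult: "x \<in> below d \<Longrightarrow> c \<odot> x \<in> below d"
  by (auto simp: below_def comp_smult)

lemma below_sum: "(\<And>i. i \<in> S \<Longrightarrow> f i \<in> below d) \<Longrightarrow> sum f S \<in> below d"
  by (induction S rule: infinite_finite_induct) (auto intro: below_add)

lemma below_mono: "d \<le> e \<Longrightarrow> below d \<subseteq> below e"
  by (auto simp: below_def)

lemma comp_below: "x \<in> carrier A \<Longrightarrow> comp d x \<in> below (Suc d)"
  by (auto simp: below_def comp_comp)

lemma below_mult_l:
  assumes "x \<in> below i" "y \<in> below (Suc j)" shows "x \<otimes> y \<in> below (i + j)"
proof -
  have x: "x \<in> carrier A" and y: "y \<in> carrier A"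
    using assms below_carr by auto
  have "comp m x \<otimes> comp (e - m) y = 0" if "e \<ge> i + j" "m \<le> e" for e m
  proof (cases "m \<ge> i")
    case True
    then show ?thesis using assms x y by (simp add: below_def)
  next
    case False
    then have "e - m \<ge> Suc j" using that by simp
    then show ?thesis using assms x y by (simp add: below_def)
  qed
  then show ?thesis using x y by (simp add: below_def comp_mult)
qed

lemma below_mult_r:
  assumes "x \<in> below (Suc i)" "y \<in> below j" shows "x \<otimes> y \<in> below (i + j)"
proof (cases j)
  case 0
  then show ?thesis using assms below_0 below_carr[OF assms(1)] by simp
next
  case (Suc k)
  then show ?thesis using below_mult_l[of x "Suc i" y k] assms by simp
qed

lemma sub_top_below:
  assumes "x \<in> below (Suc d)" shows "x - comp d x \<in> below d"
proof -
  have "comp e (x - comp d x) = 0" if "e \<ge> d" for e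
    using assms that by (cases "e = d") (auto simp: comp_diff comp_comp below_def)
  then show ?thesis using assms by (auto simp: below_def)
qed

end

text \<open>
  The quotient of a graded algebra by an arbitrary ideal \<open>I\<close> is only filtered. The map \<open>leading\<close>
  below sends an element to the symbols of its homogeneous components, and it presents the
  associated graded algebra of the quotient as a quotient of the graded algebra one started from.
\<close>
locale filtered_quotient = graded_alg A comp + alg_ideal A I
  for A :: "(complex, 'a::ab_group_add) module" (structure) and comp I
begin

definition F :: "nat \<Rightarrow> 'a set set" where
  "F d = (\<lambda>x. I +> x) ` below (Suc d)"

definition symbol :: "nat \<Rightarrow> 'a \<Rightarrow> 'a set set" where
  "symbol d x = (\<lambda>f. I +> (f + x)) ` below d"

lemma filt_pred_F: "filt_pred Q F d = (\<lambda>x. I +> x) ` below d"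
  by (cases d) (auto simp: filt_pred_def F_def below_0 quot_zero coset_zero)

lemma filt_pred_coset:
  assumes "x \<in> carrier A"
  shows "filt_pred Q F d +>\<^bsub>Q\<^esub> (I +> x) = symbol d x"
proof -
  have "filt_pred Q F d +>\<^bsub>Q\<^esub> (I +> x) = (\<lambda>f. (I +> f) \<oplus>\<^bsub>Q\<^esub> (I +> x)) ` below d"
    by (auto simp: filt_pred_F a_r_coset_def'[of Q])
  also have "\<dots> = symbol d x"
    unfolding symbol_def using assms below_carr by (intro image_cong) (auto simp: quot_add)
  finally show ?thesis .
qed

lemma symbol_zero: "symbol d 0 = filt_pred Q F d"
  by (simp add: symbol_def filt_pred_F)

lemma symbol_self: "I +> x \<in> symbol d x"
  unfolding symbol_def by (rule image_eqI[of _ _ 0]) auto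

lemma symbol_eq_iff:
  assumes "x \<in> carrier A" "y \<in> carrier A"
  shows "symbol d x = symbol d y \<longleftrightarrow> (\<exists>f\<in>below d. x - y - f \<in> I)"
proof
  assume "symbol d x = symbol d y"
  with symbol_self[of x d] obtain f where "f \<in> below d" "I +> x = I +> (f + y)"
    by (auto simp: symbol_def)
  then show "\<exists>f\<in>below d. x - y - f \<in> I"
    by (auto simp: coset_eq_iff algebra_simps)
next
  assume "\<exists>f\<in>below d. x - y - f \<in> I"
  then obtain f where f: "f \<in> below d" "x - y - f \<in> I" by auto
  have "\<exists>h\<in>below d. I +> (g + x) = I +> (h + y)" if "g \<in> below d" for g
    using f that by (intro bexI[of _ "g + f"]) (auto simp: coset_eq_iff below_add algebra_simps)
  moreover have "\<exists>h\<in>below d. I +> (g + y) = I +> (h + x)" if "g \<in> below d" for g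
    using f that I_uminus[OF f(2)]
    by (intro bexI[of _ "g - f"]) (auto simp: coset_eq_iff below_diff algebra_simps)
  ultimately show "symbol d x = symbol d y"
    unfolding symbol_def by (auto simp: image_iff)
qed

lemma symbol_add_below:
  assumes "x \<in> carrier A" "f \<in> below d" shows "symbol d (f + x) = symbol d x"
  using assms below_carr[of f d] by (subst symbol_eq_iff) (auto intro!: bexI[of _ f])

abbreviation gr where "gr \<equiv> gr_alg Q F"

definition leading :: "'a \<Rightarrow> nat \<Rightarrow> 'a set set" where
  "leading x d = symbol d (comp d x)"

lemma leading_carrier:
  assumes x: "x \<in> carrier A" shows "leading x \<in> carrier gr"
proof -
  have "leading x d \<in> (\<lambda>a. filt_pred Q F d +>\<^bsub>Q\<^esub> a) ` F d" for d
  proof (rule image_eqI)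
    show "leading x d = filt_pred Q F d +>\<^bsub>Q\<^esub> (I +> comp d x)"
      using x by (simp add: leading_def filt_pred_coset)
    show "I +> comp d x \<in> F d"
      using comp_below[OF x, of d] by (auto simp: F_def)
  qed
  moreover have "{d. leading x d \<noteq> filt_pred Q F d} \<subseteq> {d. comp d x \<noteq> 0}"
    by (auto simp: leading_def symbol_zero)
  then have "finite {d. leading x d \<noteq> filt_pred Q F d}"
    using comp_finite[OF x] finite_subset by blast
  ultimately show ?thesis by (simp add: gr_alg_def)
qed

lemma leading_add:
  assumes x: "x \<in> carrier A" and y: "y \<in> carrier A"
  shows "leading (x + y) = leading x \<oplus>\<^bsub>gr\<^esub> leading y"
proof
  fix d
  let ?x = "comp d x" and ?y = "comp d y"
  have "symbol d ?x <+>\<^bsub>Q\<^esub> symbol d ?y = symbol d (?x + ?y)"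
  proof -
    have "symbol d ?x <+>\<^bsub>Q\<^esub> symbol d ?y = {I +> (f + ?x + (g + ?y)) | f g. f \<in> below d \<and> g \<in> below d}"
      using x y below_carr by (auto simp: symbol_def set_add_def' quot_add)
    also have "\<dots> = symbol d (?x + ?y)"
    proof -
      have "\<exists>h\<in>below d. I +> (f + ?x + (g + ?y)) = I +> (h + (?x + ?y))"
        if "f \<in> below d" "g \<in> below d" for f g
        using that by (intro bexI[of _ "f + g"]) (auto simp: below_add algebra_simps)
      moreover have "\<exists>f g. I +> (h + (?x + ?y)) = I +> (f + ?x + (g + ?y)) \<and> f \<in> below d \<and> g \<in> below d"
        if "h \<in> below d" for h
        using that by (intro exI[of _ h] exI[of _ 0]) (auto simp: algebra_simps)
      ultimately show ?thesis unfolding symbol_def by (auto simp: image_iff)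
    qed
    finally show ?thesis .
  qed
  then show "leading (x + y) d = (leading x \<oplus>\<^bsub>gr\<^esub> leading y) d"
    by (simp add: gr_alg_def leading_def comp_add)
qed

lemma leading_smult:
  assumes x: "x \<in> carrier A"
  shows "leading (c \<odot> x) = c \<odot>\<^bsub>gr\<^esub> leading x"
proof
  fix d
  have *: "filt_pred Q F d +>\<^bsub>Q\<^esub> (c \<odot>\<^bsub>Q\<^esub> a) = symbol d (c \<odot> comp d x)"
    if a: "a \<in> symbol d (comp d x)" for a
  proof -
    obtain f where f: "f \<in> below d" "a = I +> (f + comp d x)" using a by (auto simp: symbol_def)
    then have "filt_pred Q F d +>\<^bsub>Q\<^esub> (c \<odot>\<^bsub>Q\<^esub> a) = symbol d (c \<odot> (f + comp d x))"
      using x below_carr[OF f(1)] by (simp add: quot_smult filt_pred_coset)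
    also have "\<dots> = symbol d (c \<odot> comp d x)"
      using x f below_carr[OF f(1)] by (simp add: smult_add symbol_add_below below_smult)
    finally show ?thesis .
  qed
  have "(\<Union>a\<in>symbol d (comp d x). filt_pred Q F d +>\<^bsub>Q\<^esub> (c \<odot>\<^bsub>Q\<^esub> a)) = symbol d (c \<odot> comp d x)"
    using * symbol_self[of "comp d x" d] by blast
  then show "leading (c \<odot> x) d = (c \<odot>\<^bsub>gr\<^esub> leading x) d"
    using x by (simp add: gr_alg_def leading_def comp_smult)
qed

lemma leading_one: "leading \<one> = \<one>\<^bsub>gr\<^esub>"
proof
  fix d show "leading \<one> d = \<one>\<^bsub>gr\<^esub> d"
    using filt_pred_coset[of \<one> d] filt_pred_coset[of 0 d]
    by (cases "d = 0") (auto simp: gr_alg_def leading_def comp_one quot_one quot_zero coset_zero)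
qed

lemma leading_mult:
  assumes x: "x \<in> carrier A" and y: "y \<in> carrier A"
  shows "leading (x \<otimes> y) = leading x \<otimes>\<^bsub>gr\<^esub> leading y"
proof
  fix d
  \<comment> \<open>The product in the associated graded algebra is a union over all choices of representatives.
    Any choice differs from the homogeneous components by lower terms \<open>f i\<close> and \<open>g i\<close>, which
    change the product only in degrees below \<open>d\<close>.\<close>
  have *: "filt_pred Q F d +>\<^bsub>Q\<^esub> (finsum Q (\<lambda>i. a i \<otimes>\<^bsub>Q\<^esub> b (d - i)) {..d}) = symbol d (comp d (x \<otimes> y))"
    if a: "a \<in> Pi {..d} (leading x)" and b: "b \<in> Pi {..d} (leading y)" for a b
  proof -
    have "\<forall>i\<in>{..d}. \<exists>f\<in>below i. a i = I +> (f + comp i x)"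
      using a by (auto simp: leading_def symbol_def Pi_def image_iff Bex_def)
    then obtain f where f: "\<And>i. i \<le> d \<Longrightarrow> f i \<in> below i \<and> a i = I +> (f i + comp i x)"
      by (metis atMost_iff)
    have "\<forall>i\<in>{..d}. \<exists>f\<in>below i. b i = I +> (f + comp i y)"
      using b by (auto simp: leading_def symbol_def Pi_def image_iff Bex_def)
    then obtain g where g: "\<And>i. i \<le> d \<Longrightarrow> g i \<in> below i \<and> b i = I +> (g i + comp i y)"
      by (metis atMost_iff)
    have fc: "f i \<in> carrier A" "g i \<in> carrier A" if "i \<le> d" for i
      using below_carr[of "f i" i] below_carr[of "g i" i] f[OF that] g[OF that] by blast+
    let ?z = "\<lambda>i. (f i + comp i x) \<otimes> (g (d - i) + comp (d - i) y)"
    let ?e = "\<lambda>i. f i \<otimes> (g (d - i) + comp (d - i) y) + comp i x \<otimes> g (d - i)"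
    have "finsum Q (\<lambda>i. a i \<otimes>\<^bsub>Q\<^esub> b (d - i)) {..d} = finsum Q (\<lambda>i. I +> ?z i) {..d}"
    proof -
      interpret Q: ring Q by (rule quot_ring)
      have "a i \<otimes>\<^bsub>Q\<^esub> b (d - i) = I +> ?z i" if "i \<le> d" for i
        using f[OF that] g[of "d - i"] fc[OF that] fc[of "d - i"] x y by (simp add: quot_mult)
      then show ?thesis
        using fc x y by (intro Q.finsum_cong') (auto simp: quot_carrier)
    qed
    also have "\<dots> = I +> sum ?z {..d}"
      using fc x y by (intro quot_finsum) auto
    finally have 1: "finsum Q (\<lambda>i. a i \<otimes>\<^bsub>Q\<^esub> b (d - i)) {..d} = I +> sum ?z {..d}" .
    have "?z i = ?e i + comp i x \<otimes> comp (d - i) y" if "i \<le> d" for i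
      using fc[of i] fc[of "d - i"] that x y by (simp add: mult_add_left mult_add_right algebra_simps)
    then have 2: "sum ?z {..d} = sum ?e {..d} + comp d (x \<otimes> y)"
      using x y by (simp add: comp_mult sum.distrib)
    have "?e i \<in> below d" if i: "i \<le> d" for i
    proof (intro below_add)
      have "g (d - i) + comp (d - i) y \<in> below (Suc (d - i))"
        using g[of "d - i"] below_mono[of "d - i" "Suc (d - i)"] comp_below[OF y, of "d - i"]
        by (intro below_add) auto
      with f[OF i] show "f i \<otimes> (g (d - i) + comp (d - i) y) \<in> below d"
        using below_mult_l[of "f i" i _ "d - i"] i by simp
      show "comp i x \<otimes> g (d - i) \<in> below d"
        using below_mult_r[OF comp_below[OF x, of i], of "g (d - i)" "d - i"] g[of "d - i"] i by simp
    qed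
    then have "sum ?e {..d} \<in> below d" by (intro below_sum) auto
    with 2 have "symbol d (sum ?z {..d}) = symbol d (comp d (x \<otimes> y))"
      using x y by (simp add: symbol_add_below)
    moreover have "sum ?z {..d} \<in> carrier A" using fc x y by (intro sum_carr) auto
    ultimately show ?thesis by (simp add: 1 filt_pred_coset)
  qed
  have "(\<lambda>i. I +> comp i x) \<in> Pi {..d} (leading x)" "(\<lambda>i. I +> comp i y) \<in> Pi {..d} (leading y)"
    by (auto simp: leading_def symbol_self)
  then have "(\<Union>a\<in>Pi {..d} (leading x). \<Union>b\<in>Pi {..d} (leading y).
      filt_pred Q F d +>\<^bsub>Q\<^esub> (finsum Q (\<lambda>i. a i \<otimes>\<^bsub>Q\<^esub> b (d - i)) {..d})) = symbol d (comp d (x \<otimes> y))"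
    using * by blast
  then show "leading (x \<otimes> y) d = (leading x \<otimes>\<^bsub>gr\<^esub> leading y) d"
    by (simp add: gr_alg_def leading_def)
qed

lemma leading_hom: "leading \<in> ring_hom A gr"
  by (rule ring_hom_memI) (auto simp: leading_carrier leading_mult leading_add leading_one add_eq)

lemma leading_eq_iff:
  assumes "x \<in> carrier A" "y \<in> carrier A"
  shows "leading x = leading y \<longleftrightarrow> (\<forall>d. \<exists>f\<in>below d. comp d (x - y) - f \<in> I)"
  using assms by (simp add: fun_eq_iff leading_def symbol_eq_iff comp_diff)

text \<open>
  Given a finitely supported family of symbols, each symbol has a homogeneous representative, and
  the sum of these representatives is a preimage.
\<close>
lemma leading_surj: "leading ` carrier A = carrier gr"
proof
  show "leading ` carrier A \<subseteq> carrier gr" using leading_carrier by auto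
  show "carrier gr \<subseteq> leading ` carrier A"
  proof
    fix y assume y: "y \<in> carrier gr"
    have "\<exists>z\<in>carrier A. comp d z = z \<and> y d = symbol d z" for d
    proof -
      have "y d \<in> (\<lambda>a. filt_pred Q F d +>\<^bsub>Q\<^esub> a) ` F d" using y by (simp add: gr_alg_def)
      then obtain z where z: "z \<in> below (Suc d)" "y d = symbol d z"
        using below_carr by (auto simp: F_def filt_pred_coset)
      have "symbol d z = symbol d (comp d z)"
        using symbol_add_below[of "comp d z" "z - comp d z" d] sub_top_below[OF z(1)] z(1)
        by (simp add: below_carr)
      with z show ?thesis
        by (intro bexI[of _ "comp d z"]) (auto simp: comp_comp below_carr)
    qed
    then obtain z where z: "\<And>d. z d \<in> carrier A" "\<And>d. comp d (z d) = z d" "\<And>d. y d = symbol d (z d)"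
      by metis
    let ?D = "{d. y d \<noteq> filt_pred Q F d}"
    have fin: "finite ?D" using y by (simp add: gr_alg_def)
    have "comp d (sum z ?D) = (if d \<in> ?D then z d else 0)" for d
    proof -
      have "comp d (sum z ?D) = (\<Sum>e\<in>?D. if d = e then z e else 0)"
        unfolding comp_of_sum by (rule sum.cong) (use z(2) comp_comp in metis)+
      then show ?thesis using fin by (simp only: sum.delta')
    qed
    then have "leading (sum z ?D) d = y d" for d
      using z(3)[of d] symbol_zero[of d] by (auto simp: leading_def)
    then show "y \<in> leading ` carrier A"
      using z(1) by (intro image_eqI[of _ _ "sum z ?D"]) (auto simp: fun_eq_iff intro!: sum_carr)
  qed
qed

lemma leading_homog: "leading ` homog d = gr_degree Q F d"
proof
  have "leading x e = filt_pred Q F e" if "x \<in> homog d" "e \<noteq> d" for x e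
  proof -
    have "comp e x = comp e (comp d x)" using that by (simp add: homog_def)
    also have "\<dots> = 0" using that by (simp add: comp_comp)
    finally show ?thesis by (simp add: leading_def symbol_zero)
  qed
  then show "leading ` homog d \<subseteq> gr_degree Q F d"
    by (auto simp: gr_degree_def leading_carrier homog_def)
  show "gr_degree Q F d \<subseteq> leading ` homog d"
  proof
    fix y assume y: "y \<in> gr_degree Q F d"
    then have "y \<in> leading ` carrier A" by (simp add: gr_degree_def leading_surj)
    then obtain x where x: "x \<in> carrier A" "y = leading x" by blast
    have "leading (comp d x) e = y e" for e
    proof (cases "e = d")
      case True then show ?thesis using x by (simp add: leading_def comp_comp)
    next
      case False
      then have "y e = filt_pred Q F e" using y by (simp add: gr_degree_def)
      with False show ?thesis by (simp add: leading_def comp_comp symbol_zero)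
    qed
    then show "y \<in> leading ` homog d"
      using x by (intro image_eqI[of _ _ "comp d x"]) (auto simp: homog_def comp_comp fun_eq_iff)
  qed
qed

text \<open>
  The closure properties are read off from the values of \<open>leading\<close>, which respects the operations;
  that the associated graded algebra is a ring is not known at this point.
\<close>
lemma leading_zero_ideal: "ideal {x \<in> carrier A. leading x = leading 0} A"
proof -
  have 1: "leading (z \<otimes> x) = leading 0" "leading (x \<otimes> z) = leading 0"
    if "z \<in> carrier A" "x \<in> carrier A" "leading x = leading 0" for x z
    using leading_mult[OF that(1,2)] leading_mult[OF that(2,1)]
      leading_mult[OF that(1) zero_carr] leading_mult[OF zero_carr that(1)] that by auto
  have 2: "leading (x + y) = leading 0"
    if "y \<in> carrier A" "x \<in> carrier A" "leading x = leading 0" "leading y = leading 0" for x y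
    using leading_add[OF that(2,1)] leading_add[OF zero_carr zero_carr] that by simp
  have 3: "leading (- x) = leading 0" if "x \<in> carrier A" "leading x = leading 0" for x
    using 1[of "- \<one>" x] that a_inv_eq[of \<one>] l_minus[of \<one> x] by (simp add: a_inv_eq)
  show ?thesis
  proof (rule idealI)
    show "ring A" by (rule ring_axioms)
    show "subgroup {x \<in> carrier A. leading x = leading 0} (add_monoid A)"
      by (rule subgroup.intro)
         (auto simp: 2 3 add_eq zero_eq a_inv_eq[unfolded a_inv_def zero_eq])
  qed (auto simp: 1)
qed

end

text \<open>
  Every element of \<open>R\<close> has a preimage in \<open>A\<close>, and there both homomorphisms can be compared.
\<close>
lemma common_quotient_iso:
  fixes A :: "('a, 'x) ring_scheme"
  assumes f: "f \<in> ring_hom A R" "f ` carrier A = carrier R"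
    and g: "g \<in> ring_hom A S" "g ` carrier A = carrier S"
    and ker: "\<And>x y. x \<in> carrier A \<Longrightarrow> y \<in> carrier A \<Longrightarrow> f x = f y \<longleftrightarrow> g x = g y"
    and A: "ring A"
  obtains \<phi> where "\<phi> \<in> ring_iso R S" "\<And>x. x \<in> carrier A \<Longrightarrow> \<phi> (f x) = g x"
proof -
  interpret ring A by (rule A)
  define \<phi> where "\<phi> y = g (inv_into (carrier A) f y)" for y
  have \<phi>: "\<phi> (f x) = g x" if "x \<in> carrier A" for x
    using ker[of "inv_into (carrier A) f (f x)" x] that
    by (simp add: \<phi>_def f_inv_into_f inv_into_into)
  have rep: "\<exists>a\<in>carrier A. x = f a" if "x \<in> carrier R" for x using f(2) that by auto
  have "\<phi> \<in> ring_hom R S"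
  proof (rule ring_hom_memI)
    fix x assume "x \<in> carrier R"
    then show "\<phi> x \<in> carrier S" using rep[of x] g(2) \<phi> by auto
  next
    fix x y assume xy: "x \<in> carrier R" "y \<in> carrier R"
    obtain a b where ab: "a \<in> carrier A" "b \<in> carrier A" "x = f a" "y = f b"
      using rep[OF xy(1)] rep[OF xy(2)] by metis
    show "\<phi> (x \<otimes>\<^bsub>R\<^esub> y) = \<phi> x \<otimes>\<^bsub>S\<^esub> \<phi> y"
      using ab(1,2) unfolding ab(3,4)
      by (simp add: \<phi> ring_hom_mult[OF g(1)] flip: ring_hom_mult[OF f(1)])
    show "\<phi> (x \<oplus>\<^bsub>R\<^esub> y) = \<phi> x \<oplus>\<^bsub>S\<^esub> \<phi> y"
      using ab(1,2) unfolding ab(3,4)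
      by (simp add: \<phi> ring_hom_add[OF g(1)] flip: ring_hom_add[OF f(1)])
  next
    show "\<phi> \<one>\<^bsub>R\<^esub> = \<one>\<^bsub>S\<^esub>"
      using \<phi>[of "\<one>\<^bsub>A\<^esub>"] ring_hom_one[OF f(1)] ring_hom_one[OF g(1)] by simp
  qed
  moreover have "bij_betw \<phi> (carrier R) (carrier S)"
  proof (rule bij_betw_imageI)
    show "inj_on \<phi> (carrier R)"
    proof (rule inj_onI)
      fix x y assume xy: "x \<in> carrier R" "y \<in> carrier R" and eq: "\<phi> x = \<phi> y"
      obtain a b where ab: "a \<in> carrier A" "b \<in> carrier A" "x = f a" "y = f b"
        using rep[OF xy(1)] rep[OF xy(2)] by metis
      then show "x = y" using eq ker[of a b] by (simp add: \<phi>)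
    qed
    show "\<phi> ` carrier R = carrier S"
      using \<phi> f(2) g(2) by (metis (no_types, lifting) image_cong image_image)
  qed
  ultimately show ?thesis using \<phi> that by (auto simp: ring_iso_def)
qed

section \<open>The free algebra as a convolution algebra\<close>

definition word :: "'x list \<Rightarrow> 'x list \<Rightarrow> complex" where
  "word u = (\<lambda>w. if w = u then 1 else 0)"

text \<open>
  The multiplication of the free algebra without reference to the alphabet; associativity and
  bilinearity then hold for arbitrary coefficient functions.
\<close>
definition conv :: "('x list \<Rightarrow> complex) \<Rightarrow> ('x list \<Rightarrow> complex) \<Rightarrow> 'x list \<Rightarrow> complex" where
  "conv p r = (\<lambda>w. \<Sum>k\<le>length w. p (take k w) * r (drop k w))"

lemma sum_fun_apply: "(\<Sum>i\<in>S. f i) w = (\<Sum>i\<in>S. f i w)"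
  by (induction S rule: infinite_finite_induct) auto

lemma conv_assoc: "conv (conv p r) s = conv p (conv r s)"
proof
  fix w :: "'a list"
  let ?n = "length w"
  let ?g = "\<lambda>j i. p (take j w) * r (take i (drop j w)) * s (drop (j + i) w)"
  have "conv (conv p r) s w = (\<Sum>k\<le>?n. \<Sum>j\<le>k. ?g j (k - j))"
    by (auto simp: conv_def sum_distrib_right drop_take min_def intro!: sum.cong)
  also have "\<dots> = (\<Sum>(j, i)\<in>{(j, i). j + i \<le> ?n}. ?g j i)"
    by (rule sum.triangle_reindex_eq[symmetric])
  also have "{(j, i). j + i \<le> ?n} = Sigma {..?n} (\<lambda>j. {..?n - j})"
    by auto
  also have "(\<Sum>(j, i)\<in>Sigma {..?n} (\<lambda>j. {..?n - j}). ?g j i) = conv p (conv r s) w"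
    by (subst sum.Sigma[symmetric])
       (simp_all add: conv_def sum_distrib_left mult.assoc add.commute)
  finally show "conv (conv p r) s w = conv p (conv r s) w" .
qed

lemma conv_add_left: "conv (p + p') r = conv p r + conv p' r"
  by (auto simp: conv_def fun_eq_iff algebra_simps sum.distrib)

lemma conv_add_right: "conv p (r + r') = conv p r + conv p r'"
  by (auto simp: conv_def fun_eq_iff algebra_simps sum.distrib)

lemma conv_zero_left [simp]: "conv 0 r = 0" and conv_zero_right [simp]: "conv p 0 = 0"
  by (auto simp: conv_def fun_eq_iff)

lemma conv_sum_left: "conv (sum f S) r = (\<Sum>i\<in>S. conv (f i) r)"
  by (induction S rule: infinite_finite_induct)
     (simp_all only: conv_add_left conv_zero_left sum.infinite sum.empty sum.insert not_False_eq_True)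

lemma conv_sum_right: "conv p (sum f S) = (\<Sum>i\<in>S. conv p (f i))"
  by (induction S rule: infinite_finite_induct)
     (simp_all only: conv_add_right conv_zero_right sum.infinite sum.empty sum.insert not_False_eq_True)

lemma conv_word: "conv (word u) (word v) = word (u @ v)"
proof
  fix w :: "'a list"
  have "(\<Sum>k\<le>length w. word u (take k w) * word v (drop k w)) =
    (\<Sum>k\<le>length w. if k = length u then (if w = u @ v then 1 else 0) else 0)"
  proof (rule sum.cong[OF refl])
    fix k assume "k \<in> {..length w}"
    then have "length (take k w) = k" by simp
    then have "take k w \<noteq> u" if "k \<noteq> length u" using that by metis
    moreover have "w = u @ v \<longleftrightarrow> take k w = u \<and> drop k w = v" if "k = length u"
      using that append_eq_conv_conj[of u v w] by auto
    ultimately show "word u (take k w) * word v (drop k w) =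
        (if k = length u then (if w = u @ v then 1 else 0) else 0)"
      by (simp add: word_def)
  qed
  then show "conv (word u) (word v) w = word (u @ v) w"
    by (auto simp: conv_def word_def)
qed

lemma conv_Nil_left [simp]: "conv (word []) p = p"
proof
  fix w :: "'a list"
  have "(\<Sum>k\<le>length w. word [] (take k w) * p (drop k w)) = (\<Sum>k\<le>length w. if k = 0 then p w else 0)"
    by (rule sum.cong) (auto simp: word_def)
  then show "conv (word []) p w = p w" by (simp add: conv_def)
qed

lemma conv_Nil_right [simp]: "conv p (word []) = p"
proof
  fix w :: "'a list"
  have "(\<Sum>k\<le>length w. p (take k w) * word [] (drop k w)) = (\<Sum>k\<le>length w. if k = length w then p w else 0)"
    by (rule sum.cong) (auto simp: word_def)
  then show "conv p (word []) w = p w" by (simp add: conv_def)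
qed

lemma conv_nonzero: "conv p r w \<noteq> 0 \<Longrightarrow> \<exists>u v. w = u @ v \<and> p u \<noteq> 0 \<and> r v \<noteq> 0"
proof -
  assume "conv p r w \<noteq> 0"
  then obtain k where "p (take k w) * r (drop k w) \<noteq> 0"
    unfolding conv_def by (meson sum.neutral)
  then show ?thesis
    by (intro exI[of _ "take k w"] exI[of _ "drop k w"]) auto
qed

lemma free_alg_sel:
  "mult (free_alg X) = conv" "add (free_alg X) = (+)" "zero (free_alg X) = 0"
  "one (free_alg X) = word []" "smult (free_alg X) = (\<lambda>c p w. c * p w)"
  by (auto simp: free_alg_def conv_def word_def fun_eq_iff)

lemma free_carrier: "p \<in> carrier (free_alg X) \<longleftrightarrow> finite {w. p w \<noteq> 0} \<and> (\<forall>w. p w \<noteq> 0 \<longrightarrow> set w \<subseteq> X)"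
  by (simp add: free_alg_def)

lemma word_carrier [simp, intro]: "set u \<subseteq> X \<Longrightarrow> word u \<in> carrier (free_alg X)"
  by (auto simp: free_carrier word_def)

lemma conv_carrier:
  assumes "p \<in> carrier (free_alg X)" "r \<in> carrier (free_alg X)"
  shows "conv p r \<in> carrier (free_alg X)"
proof -
  have "{w. conv p r w \<noteq> 0} \<subseteq> (\<lambda>(u, v). u @ v) ` ({w. p w \<noteq> 0} \<times> {w. r w \<noteq> 0})"
    by (fastforce dest: conv_nonzero)
  moreover have "finite \<dots>" using assms by (auto simp: free_carrier)
  ultimately have "finite {w. conv p r w \<noteq> 0}" using finite_subset by blast
  moreover have "set w \<subseteq> X" if "conv p r w \<noteq> 0" for w
    using conv_nonzero[OF that] assms by (fastforce simp: free_carrier)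
  ultimately show ?thesis by (auto simp: free_carrier)
qed

lemma free_add_carrier:
  assumes "p \<in> carrier (free_alg X)" "r \<in> carrier (free_alg X)"
  shows "p + r \<in> carrier (free_alg X)"
proof -
  have "{w. (p + r) w \<noteq> 0} \<subseteq> {w. p w \<noteq> 0} \<union> {w. r w \<noteq> 0}" by auto
  moreover have "finite ({w. p w \<noteq> 0} \<union> {w. r w \<noteq> 0})"
    using assms by (simp add: free_carrier)
  ultimately have "finite {w. (p + r) w \<noteq> 0}" by (rule finite_subset)
  moreover have "set w \<subseteq> X" if "(p + r) w \<noteq> 0" for w
    using that assms by (cases "p w = 0") (auto simp: free_carrier)
  ultimately show ?thesis by (auto simp: free_carrier)
qed

lemma free_scale_carrier:
  assumes "p \<in> carrier (free_alg X)"
  shows "(\<lambda>w. f w * p w) \<in> carrier (free_alg X)"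
proof -
  have "{w. f w * p w \<noteq> 0} \<subseteq> {w. p w \<noteq> 0}" by auto
  then show ?thesis using assms finite_subset by (auto simp: free_carrier)
qed

lemma free_concrete: "concrete_alg (free_alg X)"
proof -
  have "abelian_group (free_alg X)"
  proof (rule abelian_groupI)
    fix p assume p: "p \<in> carrier (free_alg X)"
    show "\<exists>y\<in>carrier (free_alg X). y \<oplus>\<^bsub>free_alg X\<^esub> p = \<zero>\<^bsub>free_alg X\<^esub>"
      using free_scale_carrier[OF p, of "\<lambda>_. - 1"]
      by (intro bexI[of _ "\<lambda>w. -1 * p w"]) (auto simp: free_alg_sel fun_eq_iff)
  qed (auto simp: free_alg_sel free_add_carrier add.assoc add.commute, auto simp: free_carrier)
  moreover have "Group.monoid (free_alg X)"
    by (rule monoidI) (auto simp: free_alg_sel conv_carrier conv_assoc)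
  ultimately have "ring (free_alg X)"
    by (rule ringI) (auto simp: free_alg_sel conv_add_left conv_add_right)
  moreover have "concrete_alg_axioms (free_alg X)"
  proof
    fix c and x assume x: "x \<in> carrier (free_alg X)"
    have "conv (\<lambda>w. c * word [] w) x = (\<lambda>w. c * conv (word []) x w)"
      by (simp add: conv_def sum_distrib_left mult.assoc)
    then show "c \<odot>\<^bsub>free_alg X\<^esub> x = (c \<odot>\<^bsub>free_alg X\<^esub> \<one>\<^bsub>free_alg X\<^esub>) \<otimes>\<^bsub>free_alg X\<^esub> x"
      by (simp add: free_alg_sel)
  qed (auto simp: free_alg_sel free_scale_carrier)
  ultimately show ?thesis by (simp add: concrete_alg_def)
qed

section \<open>The skew group algebra of the tensor algebra\<close>

text \<open>
  The diagonal action enters the algebra through its characters \<open>g \<mapsto> lam g i\<close>.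
\<close>
locale diagonal_action = group G for G :: "('g, 'm) monoid_scheme" (structure) +
  fixes n :: nat and lam :: "'g \<Rightarrow> nat \<Rightarrow> complex"
  assumes fin: "finite (carrier G)"
    and lam_mult: "g \<in> carrier G \<Longrightarrow> h \<in> carrier G \<Longrightarrow> i \<in> {1..n} \<Longrightarrow> lam (g \<otimes> h) i = lam g i * lam h i"
    and lam_one: "i \<in> {1..n} \<Longrightarrow> lam \<one> i = 1"
begin

text \<open>
  Keeps the alphabet \<open>{1..n}\<close> from being rewritten to \<open>{Suc 0..n}\<close>.
\<close>
declare One_nat_def [simp del]

abbreviation X where "X \<equiv> {1..n}"
abbreviation T where "T \<equiv> free_alg X"
abbreviation B where "B \<equiv> tensor_skew G n lam"
abbreviation skew_prod (infixl "\<star>" 70) where "x \<star> y \<equiv> mult B x y"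
abbreviation skew_scale (infixl "\<bullet>" 70) where "c \<bullet> x \<equiv> smult B c x"

definition lamw :: "'g \<Rightarrow> nat list \<Rightarrow> complex" where
  "lamw g w = (\<Prod>i\<leftarrow>w. lam g i)"

lemma lamw_simps [simp]: "lamw g [] = 1" "lamw g (i # w) = lam g i * lamw g w"
  "lamw g (u @ v) = lamw g u * lamw g v"
  by (auto simp: lamw_def)

lemma lamw_mult: "g \<in> carrier G \<Longrightarrow> h \<in> carrier G \<Longrightarrow> set w \<subseteq> X \<Longrightarrow> lamw (g \<otimes> h) w = lamw g w * lamw h w"
  by (induction w) (auto simp: lam_mult)

lemma lamw_one: "set w \<subseteq> X \<Longrightarrow> lamw \<one> w = 1"
  by (induction w) (auto simp: lam_one)

lemma lam_inv: "g \<in> carrier G \<Longrightarrow> i \<in> X \<Longrightarrow> lam g i * lam (inv g) i = 1"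
  using lam_mult[of g "inv g" i] lam_one[of i] by simp

lemma lam_nonzero: "g \<in> carrier G \<Longrightarrow> i \<in> X \<Longrightarrow> lam g i \<noteq> 0"
  using lam_inv[of g i] by auto

lemma lam_conj:
  assumes "g \<in> carrier G" "h \<in> carrier G" "i \<in> X" shows "lam (g \<otimes> h \<otimes> inv g) i = lam h i"
  using assms lam_inv[of g i] by (simp add: lam_mult)

lemma act_eq: "free_act lam g p = (\<lambda>w. lamw g w * p w)"
  by (simp add: free_act_def lamw_def)

lemma act_carrier: "p \<in> carrier T \<Longrightarrow> free_act lam g p \<in> carrier T"
  by (simp add: act_eq free_scale_carrier)

lemma act_conv: "free_act lam g (conv p r) = conv (free_act lam g p) (free_act lam g r)"
proof
  fix w
  have "lamw g w = lamw g (take k w) * lamw g (drop k w)" for k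
    using lamw_simps(3)[of g "take k w" "drop k w"] by simp
  then show "free_act lam g (conv p r) w = conv (free_act lam g p) (free_act lam g r) w"
    by (simp add: act_eq conv_def sum_distrib_left mult_ac)
qed

lemma act_sum: "free_act lam g (sum f S) = (\<Sum>i\<in>S. free_act lam g (f i))"
  by (auto simp: act_eq sum_fun_apply sum_distrib_left fun_eq_iff)

lemma act_add: "free_act lam g (p + r) = free_act lam g p + free_act lam g r"
  by (auto simp: act_eq algebra_simps)

lemma act_zero [simp]: "free_act lam g 0 = 0"
  by (auto simp: act_eq)

lemma act_act:
  assumes "g \<in> carrier G" "h \<in> carrier G" "p \<in> carrier T"
  shows "free_act lam g (free_act lam h p) = free_act lam (g \<otimes> h) p"
proof
  fix w show "free_act lam g (free_act lam h p) w = free_act lam (g \<otimes> h) p w"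
    using assms by (cases "p w = 0") (auto simp: act_eq lamw_mult free_carrier)
qed

lemma act_one:
  assumes "p \<in> carrier T"
  shows "free_act lam \<one> p = p"
proof
  fix w show "free_act lam \<one> p w = p w"
    using assms by (cases "p w = 0") (auto simp: act_eq lamw_one free_carrier)
qed

text \<open>
  The multiplication of the skew group algebra with the sum over \<open>G\<close> taken in the function type.
  Reasoning about associativity is easier with this sum than with the one in the record.
\<close>
definition skew_mult :: "('g \<Rightarrow> nat list \<Rightarrow> complex) \<Rightarrow> ('g \<Rightarrow> nat list \<Rightarrow> complex) \<Rightarrow> 'g \<Rightarrow> nat list \<Rightarrow> complex" where
  "skew_mult x y k = (if k \<in> carrier G then \<Sum>g\<in>carrier G. conv (x g) (free_act lam g (y (inv g \<otimes> k))) else 0)"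

lemma skew_carrier: "x \<in> carrier B \<longleftrightarrow> (\<forall>g\<in>carrier G. x g \<in> carrier T) \<and> (\<forall>g. g \<notin> carrier G \<longrightarrow> x g = 0)"
  by (simp add: tensor_skew_def skew_alg_def skew_part_def free_alg_sel)

lemma skew_sel:
  "add B = (+)" "zero B = 0" "smult B = (\<lambda>c x k w. c * x k w)"
  "one B = (\<lambda>k. if k = \<one> then word [] else 0)"
  by (auto simp: tensor_skew_def skew_alg_def free_alg_sel fun_eq_iff)

lemma skew_mult_eq:
  assumes "x \<in> carrier B" "y \<in> carrier B"
  shows "x \<star> y = skew_mult x y"
proof
  interpret T: concrete_alg T by (rule free_concrete)
  fix k
  have "conv (x g) (free_act lam g (y (inv g \<otimes> k))) \<in> carrier T" if "g \<in> carrier G" "k \<in> carrier G" for g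
    using assms that by (auto simp: skew_carrier intro!: conv_carrier act_carrier)
  then show "(x \<star> y) k = skew_mult x y k"
    using fin T.finsum_eq_sum[of "carrier G" "\<lambda>g. conv (x g) (free_act lam g (y (inv g \<otimes> k)))"]
    by (auto simp: skew_mult_def tensor_skew_def skew_alg_def free_alg_sel(1,3))
qed

lemma skew_mult_closed:
  assumes "x \<in> carrier B" "y \<in> carrier B"
  shows "skew_mult x y \<in> carrier B"
proof -
  interpret T: concrete_alg T by (rule free_concrete)
  show ?thesis
    using assms by (auto simp: skew_carrier skew_mult_def intro!: T.sum_carr conv_carrier act_carrier)
qed

lemma skew_mult_assoc:
  assumes x: "x \<in> carrier B" and y: "y \<in> carrier B" and z: "z \<in> carrier B"
  shows "skew_mult (skew_mult x y) z = skew_mult x (skew_mult y z)"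
proof
  fix k
  let ?a = "free_act lam" and ?C = "carrier G"
  show "skew_mult (skew_mult x y) z k = skew_mult x (skew_mult y z) k"
  proof (cases "k \<in> ?C")
    case k: True
    have inner: "?a g (\<Sum>h\<in>?C. conv (y h) (?a h (z (inv h \<otimes> (inv g \<otimes> k))))) =
       (\<Sum>m\<in>?C. conv (?a g (y (inv g \<otimes> m))) (?a m (z (inv m \<otimes> k))))" if g: "g \<in> ?C" for g
    proof -
      have "?a g (\<Sum>h\<in>?C. conv (y h) (?a h (z (inv h \<otimes> (inv g \<otimes> k))))) =
        (\<Sum>h\<in>?C. conv (?a g (y h)) (?a (g \<otimes> h) (z (inv (g \<otimes> h) \<otimes> k))))"
        using g k z by (auto simp: act_sum act_conv act_act skew_carrier inv_mult_group m_assoc intro!: sum.cong)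
      also have "\<dots> = (\<Sum>m\<in>?C. conv (?a g (y (inv g \<otimes> m))) (?a m (z (inv m \<otimes> k))))"
        by (rule sum.reindex_bij_witness[of _ "\<lambda>m. inv g \<otimes> m" "\<lambda>h. g \<otimes> h"])
           (use g in \<open>auto simp: m_assoc[symmetric]\<close>)
      finally show ?thesis .
    qed
    have "skew_mult x (skew_mult y z) k =
      (\<Sum>g\<in>?C. conv (x g) (?a g (\<Sum>h\<in>?C. conv (y h) (?a h (z (inv h \<otimes> (inv g \<otimes> k)))))))"
      using k by (simp add: skew_mult_def)
    also have "\<dots> = (\<Sum>g\<in>?C. conv (x g) (\<Sum>m\<in>?C. conv (?a g (y (inv g \<otimes> m))) (?a m (z (inv m \<otimes> k)))))"
      by (rule sum.cong) (auto simp: inner)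
    also have "\<dots> = (\<Sum>m\<in>?C. \<Sum>g\<in>?C. conv (x g) (conv (?a g (y (inv g \<otimes> m))) (?a m (z (inv m \<otimes> k)))))"
      unfolding conv_sum_right by (rule sum.swap)
    also have "\<dots> = skew_mult (skew_mult x y) z k"
      using k by (simp add: skew_mult_def conv_sum_left conv_assoc)
    finally show ?thesis by simp
  qed (simp add: skew_mult_def)
qed

lemma skew_mult_add_left: "skew_mult (x + x') y = skew_mult x y + skew_mult x' y"
  by (auto simp: skew_mult_def fun_eq_iff conv_add_left sum.distrib)

lemma skew_mult_add_right: "skew_mult x (y + y') = skew_mult x y + skew_mult x y'"
  by (auto simp: skew_mult_def fun_eq_iff conv_add_right act_add sum.distrib)

text \<open>
  The monomial basis: \<open>bas u g\<close> is the element \<open>u g\<close> of \<open>T(V) \<rtimes> G\<close>.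
\<close>
definition bas :: "nat list \<Rightarrow> 'g \<Rightarrow> 'g \<Rightarrow> nat list \<Rightarrow> complex" where
  "bas u g = (\<lambda>k. if k = g then word u else 0)"

lemma bas_carrier [simp, intro]: "set u \<subseteq> X \<Longrightarrow> g \<in> carrier G \<Longrightarrow> bas u g \<in> carrier B"
  using free_concrete concrete_alg.zero_carr by (auto simp: skew_carrier bas_def)

lemma skew_zero_carrier [simp]: "0 \<in> carrier B"
  using concrete_alg.zero_carr[OF free_concrete] by (auto simp: skew_carrier)

lemma act_word: "free_act lam g (word v) = (\<lambda>w. lamw g v * word v w)"
  by (auto simp: act_eq word_def)

lemma conv_scale: "conv (\<lambda>w. c * p w) r = (\<lambda>w. c * conv p r w)"
  "conv p (\<lambda>w. c * r w) = (\<lambda>w. c * conv p r w)"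
  by (simp_all add: conv_def sum_distrib_left mult_ac)

lemma mult_bas:
  assumes g: "g \<in> carrier G" and h: "h \<in> carrier G" and u: "set u \<subseteq> X" and v: "set v \<subseteq> X"
  shows "bas u g \<star> bas v h = lamw g v \<bullet> bas (u @ v) (g \<otimes> h)"
proof -
  have "skew_mult (bas u g) (bas v h) k = (\<lambda>w. lamw g v * bas (u @ v) (g \<otimes> h) k w)" for k
  proof (cases "k \<in> carrier G")
    case k: True
    have "skew_mult (bas u g) (bas v h) k =
      (\<Sum>g'\<in>carrier G. if g' = g then conv (word u) (free_act lam g (bas v h (inv g \<otimes> k))) else 0)"
      using k by (auto simp: skew_mult_def bas_def intro!: sum.cong)
    also have "\<dots> = conv (word u) (free_act lam g (bas v h (inv g \<otimes> k)))"
      using fin g by simp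
    also have "inv g \<otimes> k = h \<longleftrightarrow> k = g \<otimes> h"
      using g h k by (metis inv_solve_left)
    then have "conv (word u) (free_act lam g (bas v h (inv g \<otimes> k))) = (\<lambda>w. lamw g v * bas (u @ v) (g \<otimes> h) k w)"
      by (auto simp: bas_def act_word conv_scale conv_word)
    finally show ?thesis .
  next
    case False
    then show ?thesis using g h by (auto simp: skew_mult_def bas_def)
  qed
  then show ?thesis using assms by (simp add: skew_mult_eq skew_sel fun_eq_iff)
qed

lemma one_eq: "\<one>\<^bsub>B\<^esub> = bas [] \<one>"
  by (simp add: skew_sel bas_def)

definition comp :: "nat \<Rightarrow> ('g \<Rightarrow> nat list \<Rightarrow> complex) \<Rightarrow> 'g \<Rightarrow> nat list \<Rightarrow> complex" where
  "comp d x = (\<lambda>g w. if length w = d then x g w else 0)"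

lemma skew_concrete: "concrete_alg B"
proof -
  interpret T: concrete_alg T by (rule free_concrete)
  have scale: "(\<lambda>k w. c * x k w) \<in> carrier B" if "x \<in> carrier B" for x c
    using that by (auto simp: skew_carrier free_scale_carrier fun_eq_iff)
  have one: "skew_mult (bas [] \<one>) x = x" if x: "x \<in> carrier B" for x
  proof
    fix k show "skew_mult (bas [] \<one>) x k = x k"
    proof (cases "k \<in> carrier G")
      case k: True
      have "skew_mult (bas [] \<one>) x k =
        (\<Sum>g\<in>carrier G. if g = \<one> then conv (word []) (free_act lam \<one> (x (inv \<one> \<otimes> k))) else 0)"
        using k by (auto simp: skew_mult_def bas_def intro!: sum.cong)
      also have "\<dots> = x k" using x k fin by (auto simp: act_one skew_carrier)
      finally show ?thesis .
    qed (use x in \<open>auto simp: skew_mult_def skew_carrier\<close>)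
  qed
  have one': "skew_mult x (bas [] \<one>) = x" if x: "x \<in> carrier B" for x
  proof
    fix k show "skew_mult x (bas [] \<one>) k = x k"
    proof (cases "k \<in> carrier G")
      case k: True
      have "inv g \<otimes> k = \<one> \<longleftrightarrow> g = k" if "g \<in> carrier G" for g
        using that k by (metis inv_solve_left one_closed r_one)
      then have "skew_mult x (bas [] \<one>) k =
        (\<Sum>g\<in>carrier G. if g = k then conv (x g) (free_act lam g (word [])) else 0)"
        using k by (auto simp: skew_mult_def bas_def intro!: sum.cong)
      also have "\<dots> = x k" using x k fin by (auto simp: act_word)
      finally show ?thesis .
    qed (use x in \<open>auto simp: skew_mult_def skew_carrier\<close>)
  qed
  have "abelian_group B"
  proof (rule abelian_groupI)
    fix p assume p: "p \<in> carrier B"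
    show "\<exists>y\<in>carrier B. y \<oplus>\<^bsub>B\<^esub> p = \<zero>\<^bsub>B\<^esub>"
      using scale[OF p, of "- 1"] by (intro bexI[of _ "\<lambda>k w. -1 * p k w"]) (auto simp: skew_sel fun_eq_iff)
  qed (auto simp: skew_sel add.assoc add.commute, auto simp: skew_carrier)
  moreover have "Group.monoid B"
    by (rule monoidI)
       (auto simp: skew_mult_eq skew_mult_closed skew_mult_assoc one one' one_eq)
  ultimately have "ring B"
    by (rule ringI) (auto simp: skew_sel skew_mult_eq skew_mult_add_left skew_mult_add_right skew_carrier)
  moreover have "concrete_alg_axioms B"
  proof
    fix c and x assume x: "x \<in> carrier B"
    have "skew_mult (\<lambda>k w. c * bas [] \<one> k w) x = (\<lambda>k w. c * skew_mult (bas [] \<one>) x k w)"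
      by (auto simp: skew_mult_def conv_scale fun_eq_iff sum_fun_apply sum_distrib_left)
    then show "c \<bullet> x = (c \<bullet> \<one>\<^bsub>B\<^esub>) \<star> x"
      using x scale[of "bas [] \<one>" c] by (simp add: skew_sel(3) one_eq skew_mult_eq one)
  qed (auto simp: skew_sel(1-3) scale)
  ultimately show ?thesis by (simp add: concrete_alg_def)
qed

sublocale B: concrete_alg B by (rule skew_concrete)

lemma comp_skew_mult:
  "comp d (skew_mult x y) = (\<Sum>i\<le>d. skew_mult (comp i x) (comp (d - i) y))"
proof (intro ext)
  fix k w
  show "comp d (skew_mult x y) k w = (\<Sum>i\<le>d. skew_mult (comp i x) (comp (d - i) y)) k w"
  proof (cases "k \<in> carrier G")
    case k: True
    let ?f = "\<lambda>g m. x g (take m w) * (lamw g (drop m w) * y (inv g \<otimes> k) (drop m w))"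
    have "(\<Sum>i\<le>d. skew_mult (comp i x) (comp (d - i) y)) k w =
      (\<Sum>i\<le>d. \<Sum>g\<in>carrier G. \<Sum>m\<le>length w. if m = i \<and> length w - m = d - i then ?f g m else 0)"
      using k by (auto simp: sum_fun_apply skew_mult_def conv_def comp_def act_eq intro!: sum.cong)
    also have "\<dots> = (\<Sum>i\<le>d. \<Sum>g\<in>carrier G. \<Sum>m\<le>length w. if m = i then (if length w = d then ?f g m else 0) else 0)"
      by (intro sum.cong) auto
    also have "\<dots> = (\<Sum>g\<in>carrier G. \<Sum>m\<le>length w. \<Sum>i\<le>d. if m = i then (if length w = d then ?f g m else 0) else 0)"
      by (subst sum.swap, rule sum.cong[OF refl], rule sum.swap)
    also have "\<dots> = (\<Sum>g\<in>carrier G. \<Sum>m\<le>length w. if length w = d then ?f g m else 0)"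
      by (intro sum.cong) auto
    also have "\<dots> = comp d (skew_mult x y) k w"
      using k by (auto simp: sum_fun_apply skew_mult_def conv_def comp_def act_eq intro!: sum.cong)
    finally show ?thesis by simp
  qed (simp add: sum_fun_apply skew_mult_def comp_def)
qed

lemma comp_carrier: "x \<in> carrier B \<Longrightarrow> comp d x \<in> carrier B"
  using free_scale_carrier[of "x g" X "\<lambda>w. if length w = d then 1 else 0" for g]
  by (auto simp: skew_carrier comp_def fun_eq_iff if_distrib[of "\<lambda>z. z * _"] cong: if_cong)

sublocale B: graded_alg B comp
proof
  fix x y d c assume x: "x \<in> carrier B"
  have "comp d x = 0" if "\<And>g w. g \<in> carrier G \<Longrightarrow> x g w \<noteq> 0 \<Longrightarrow> length w \<noteq> d" for d
    using that x by (auto simp: comp_def fun_eq_iff skew_carrier) metis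
  then have "{d. comp d x \<noteq> 0} \<subseteq> (\<Union>g\<in>carrier G. length ` {w. x g w \<noteq> 0})"
    by (auto simp: image_iff) metis
  moreover have "finite \<dots>" using x fin by (auto simp: skew_carrier free_carrier)
  ultimately show fd: "finite {d. comp d x \<noteq> 0}" using finite_subset by blast
  show "x = (\<Sum>d | comp d x \<noteq> 0. comp d x)"
  proof (intro ext)
    fix g w
    have "(\<Sum>d | comp d x \<noteq> 0. comp d x) g w = (\<Sum>d | comp d x \<noteq> 0. if d = length w then x g w else 0)"
      by (auto simp: sum_fun_apply comp_def intro!: sum.cong)
    also have "\<dots> = (if comp (length w) x \<noteq> 0 then x g w else 0)" using fd by simp
    also have "\<dots> = x g w" by (auto simp: comp_def fun_eq_iff)
    finally show "x g w = (\<Sum>d | comp d x \<noteq> 0. comp d x) g w" by simp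
  qed
  show "comp d x \<in> carrier B" by (rule comp_carrier[OF x])
  show "comp d (c \<bullet> x) = c \<bullet> comp d x"
    by (auto simp: comp_def skew_sel fun_eq_iff)
  fix y assume y: "y \<in> carrier B"
  show "comp d (x \<star> y) = (\<Sum>i\<le>d. comp i x \<star> comp (d - i) y)"
    using x y by (simp add: skew_mult_eq comp_carrier comp_skew_mult)
qed (auto simp: comp_def fun_eq_iff skew_sel word_def)

lemma expansion:
  assumes x: "x \<in> carrier B"
  shows "finite (SIGMA g:carrier G. {u. x g u \<noteq> 0})"
    and "x = sum (\<lambda>(g, u). x g u \<bullet> bas u g) (SIGMA g:carrier G. {u. x g u \<noteq> 0})"
proof -
  let ?S = "SIGMA g:carrier G. {u. x g u \<noteq> 0}"
  show f: "finite ?S" using x fin by (auto simp: skew_carrier free_carrier)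
  show "x = sum (\<lambda>(g, u). x g u \<bullet> bas u g) ?S"
  proof (intro ext)
    fix k w
    have "(\<Sum>(g, u)\<in>?S. x g u \<bullet> bas u g) k w = (\<Sum>p\<in>?S. if p = (k, w) then x k w else 0)"
      by (auto simp: sum_fun_apply skew_sel bas_def word_def intro!: sum.cong)
    also have "\<dots> = x k w" using f x by (auto simp: skew_carrier)
    finally show "x k w = sum (\<lambda>(g, u). x g u \<bullet> bas u g) ?S k w" by simp
  qed
qed

text \<open>
  The form in which the basis is used below: a statement that is closed under sums only has to be
  checked on scalar multiples of monomials.
\<close>
lemma skew_induct [consumes 1, case_names zero bas add]:
  assumes x: "x \<in> carrier B" and "P 0"
    and bas: "\<And>c u g. set u \<subseteq> X \<Longrightarrow> g \<in> carrier G \<Longrightarrow> P (c \<bullet> bas u g)"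
    and add: "\<And>x y. x \<in> carrier B \<Longrightarrow> y \<in> carrier B \<Longrightarrow> P x \<Longrightarrow> P y \<Longrightarrow> P (x + y)"
  shows "P x"
proof -
  let ?S = "SIGMA g:carrier G. {u. x g u \<noteq> 0}"
  have S: "g \<in> carrier G \<and> set u \<subseteq> X" if "(g, u) \<in> ?S" for g u
    using that x by (auto simp: skew_carrier free_carrier)
  have "P (sum (\<lambda>(g, u). x g u \<bullet> bas u g) S') \<and> sum (\<lambda>(g, u). x g u \<bullet> bas u g) S' \<in> carrier B"
    if "finite S'" "S' \<subseteq> ?S" for S'
    using that
  proof (induction S')
    case (insert p S')
    obtain g u where p: "p = (g, u)" by (cases p)
    with insert S[of g u] have "g \<in> carrier G" "set u \<subseteq> X" by auto
    with insert p show ?case by (auto intro!: bas add B.add_carr B.smult_closed simp del: plus_fun_apply)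
  qed (auto simp: assms(2))
  from this[OF expansion(1)[OF x]] expansion(2)[OF x] show ?thesis by auto
qed

end

section \<open>Normal forms and the diamond lemma\<close>

locale quantum_relations = diagonal_action G n lam
  for G :: "('g, 'm) monoid_scheme" (structure) and n lam +
  fixes q :: "nat \<Rightarrow> nat \<Rightarrow> complex" and \<kappa> :: "nat \<Rightarrow> nat \<Rightarrow> 'g \<Rightarrow> complex"
  assumes q_inv: "i \<in> {1..n} \<Longrightarrow> j \<in> {1..n} \<Longrightarrow> q i j * q j i = 1"
    and q_diag: "i \<in> {1..n} \<Longrightarrow> q i i = 1"
    and kappa_supp: "i \<in> {1..n} \<Longrightarrow> j \<in> {1..n} \<Longrightarrow> g \<notin> carrier G \<Longrightarrow> \<kappa> i j g = 0"
    and kappa_skew: "i \<in> {1..n} \<Longrightarrow> j \<in> {1..n} \<Longrightarrow> \<kappa> i j g = - q i j * \<kappa> j i g"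
begin

lemma kappa_diag: "i \<in> X \<Longrightarrow> \<kappa> i i g = 0"
  using kappa_skew[of i i g] by (simp add: q_diag)

text \<open>
  A place where \<open>w\<close> can be straightened, given as the decomposition \<open>w = a i j b\<close>.
\<close>
definition descent :: "nat list \<Rightarrow> nat list \<times> nat \<times> nat \<times> nat list \<Rightarrow> bool" where
  "descent w = (\<lambda>(a, i, j, b). w = a @ i # j # b \<and> j < i)"

text \<open>
  The normal form of a word, as a coefficient function on pairs of a group element and a sorted
  word: the coefficient of \<open>v g\<close> is \<open>nf w g v\<close>. An unsorted word is reduced at some descent
  \<open>a i j b\<close>, picked by \<open>SOME\<close>. In the lower term \<open>a h b\<close> the group element \<open>h\<close> is moved past \<open>b\<close>, which
  costs \<open>lamw h b\<close>, and then multiplies the normal form of \<open>a b\<close> from the right. Both words on the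
  right-hand side are smaller in the length-lexicographic order, which is well-founded.
\<close>
function nf :: "nat list \<Rightarrow> 'g \<Rightarrow> nat list \<Rightarrow> complex" where
  "nf w = (if \<exists>p. descent w p then
     (case SOME p. descent w p of (a, i, j, b) \<Rightarrow>
       (\<lambda>g v. q i j * nf (a @ j # i # b) g v +
         (\<Sum>h\<in>carrier G. \<kappa> i j h * lamw h b * nf (a @ b) (g \<otimes> inv h) v)))
     else (\<lambda>g v. if g = \<one> \<and> v = w then 1 else 0))"
  by auto

lemma swap_less: "j < i \<Longrightarrow> (a @ j # i # b, a @ i # j # b) \<in> lenlex less_than" for i j :: nat
  by (simp add: Cons_lenlex_iff irrefl_def)

lemma delete_less: "(a @ b, a @ i # j # b) \<in> lenlex less_than" for i j :: nat
  by (simp add: lenlex_conv)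

termination
proof (relation "lenlex less_than", goal_cases)
  case 1 show ?case by (simp add: wf_lenlex)
next
  case (2 w a x i y j b)
  then have "descent w (a, x)" by (metis someI_ex)
  then have "w = a @ i # j # b" "j < i" by (auto simp: descent_def simp flip: 2)
  then show ?case by (simp add: swap_less)
next
  case (3 w a x i y j b)
  then have "descent w (a, x)" by (metis someI_ex)
  then have "w = a @ i # j # b" by (auto simp: descent_def simp flip: 3)
  then show ?case by (simp add: delete_less)
qed

declare nf.simps [simp del]

definition reduct :: "nat list \<Rightarrow> nat \<Rightarrow> nat \<Rightarrow> nat list \<Rightarrow> 'g \<Rightarrow> nat list \<Rightarrow> complex" where
  "reduct a i j b = (\<lambda>g v. q i j * nf (a @ j # i # b) g v +
     (\<Sum>h\<in>carrier G. \<kappa> i j h * lamw h b * nf (a @ b) (g \<otimes> inv h) v))"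

lemma nf_descent:
  assumes "descent w p"
  obtains a i j b where "w = a @ i # j # b" "j < i" "nf w = reduct a i j b"
proof -
  obtain a i j b where p: "(SOME p. descent w p) = (a, i, j, b)" by (metis prod_cases4)
  then have "descent w (a, i, j, b)" using assms by (metis someI)
  moreover have "nf w = reduct a i j b"
    by (simp only: nf.simps[of w] if_P[OF exI[of "descent w", OF assms]] p prod.case reduct_def)
  ultimately show ?thesis using that by (auto simp: descent_def)
qed

lemma nf_irreducible:
  "\<nexists>p. descent w p \<Longrightarrow> nf w g v = (if g = \<one> \<and> v = w then 1 else 0)"
  by (subst nf.simps) simp

lemma no_descent_sorted: "\<nexists>p. descent w p \<Longrightarrow> sorted w"
proof (induction w rule: induct_list012)
  case (3 x y zs)
  have "\<not> descent (y # zs) p" for p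
  proof
    assume "descent (y # zs) p"
    then obtain a i j b where "y # zs = a @ i # j # b" "j < i" by (cases p) (auto simp: descent_def)
    then have "descent (x # y # zs) (x # a, i, j, b)" by (auto simp: descent_def)
    with 3 show False by blast
  qed
  moreover have "x \<le> y"
  proof (rule ccontr)
    assume "\<not> x \<le> y"
    then have "descent (x # y # zs) ([], x, y, zs)" by (auto simp: descent_def)
    with 3 show False by blast
  qed
  ultimately show ?case using 3 by auto
qed auto

end

text \<open>
  Two descents at different places either share a letter or are disjoint; these are the
  ambiguities to be resolved.
\<close>
lemma two_descents:
  assumes eq: "a @ i # j # b = a' @ i' # j' # b'" and len: "length a < length a'"
  obtains (overlap) "a' = a @ [i]" "i' = j" "b = j' # b'"
    | (disjoint) c where "a' = a @ i # j # c" "b = c @ i' # j' # b'"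
proof -
  obtain us where us: "a' = a @ us" "i # j # b = us @ i' # j' # b'"
    using eq len by (auto simp: append_eq_append_conv2)
  show ?thesis
  proof (cases us)
    case Nil then show ?thesis using us len by simp
  next
    case (Cons x us')
    show ?thesis
    proof (cases us')
      case Nil then show ?thesis using us Cons overlap by simp
    next
      case (Cons y c)
      then show ?thesis using us \<open>us = x # us'\<close> disjoint[of c] by simp
    qed
  qed
qed

text \<open>
  Equivariance lets group elements pass the relations; the other condition resolves the overlaps
  \<open>v\<^sub>k v\<^sub>j v\<^sub>i\<close>, and is what remains of the Jacobi identity for a diagonal action.
\<close>
locale pbw_relations = quantum_relations +
  assumes equivariant: "i \<in> {1..n} \<Longrightarrow> j \<in> {1..n} \<Longrightarrow> g \<in> carrier G \<Longrightarrow> h \<in> carrier G \<Longrightarrow>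
      \<kappa> i j (inv g \<otimes> h \<otimes> g) = lam g i * lam g j * \<kappa> i j h"
    and jacobi: "i \<in> {1..n} \<Longrightarrow> j \<in> {1..n} \<Longrightarrow> l \<in> {1..n} \<Longrightarrow> i \<noteq> j \<Longrightarrow> l \<noteq> i \<Longrightarrow> l \<noteq> j \<Longrightarrow>
      g \<in> carrier G \<Longrightarrow> \<kappa> i j g \<noteq> 0 \<Longrightarrow> lam g l = q i l * q j l"
begin

lemma lamw_conj:
  "g \<in> carrier G \<Longrightarrow> h \<in> carrier G \<Longrightarrow> set w \<subseteq> X \<Longrightarrow> lamw (g \<otimes> h \<otimes> inv g) w = lamw h w"
  by (induction w) (auto simp: lam_conj)

text \<open>
  Reducing at one pair leaves the other one in place, so both orders lead to the same words. They
  differ only in the terms where both pairs are replaced by group elements \<open>g\<close> and \<open>h\<close>: there one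
  order sees \<open>g h\<close> and the other one \<open>h g\<close>, after \<open>g\<close> has passed the second pair. Equivariance makes
  the two sums agree, via \<open>g h = (g h g\<^sup>-\<^sup>1) g\<close> (step \<open>commute\<close>).
\<close>
lemma disjoint_confluence:
  assumes IH: "\<And>a i j b g. (a @ i # j # b, w) \<in> lenlex less_than \<Longrightarrow> set (a @ i # j # b) \<subseteq> X \<Longrightarrow> j < i \<Longrightarrow>
      g \<in> carrier G \<Longrightarrow> nf (a @ i # j # b) g v = reduct a i j b g v"
    and w: "w = a @ i # j # b @ k # l # c" and X: "set w \<subseteq> X" and ij: "j < i" and kl: "l < k"
    and x: "x \<in> carrier G"
  shows "reduct a i j (b @ k # l # c) x v = reduct (a @ i # j # b) k l c x v"
proof -
  let ?C = "carrier G"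
  let ?N = "\<lambda>u g. nf u g v"
  let ?u = "a @ b @ c"
  have sX: "set a \<subseteq> X" "set b \<subseteq> X" "set c \<subseteq> X" "i \<in> X" "j \<in> X" "k \<in> X" "l \<in> X"
    using X by (auto simp: w)
  have less1: "(a @ j # i # b @ k # l # c, w) \<in> lenlex less_than"
    unfolding w by (rule swap_less[OF ij])
  have less2: "(a @ i # j # b @ l # k # c, w) \<in> lenlex less_than"
    using swap_less[OF kl, of "a @ i # j # b" c] by (simp add: w)
  have less3: "(a @ b @ k # l # c, w) \<in> lenlex less_than"
    unfolding w by (rule delete_less)
  have less4: "(a @ i # j # b @ c, w) \<in> lenlex less_than"
    using delete_less[of "a @ i # j # b" c k l] by (simp add: w)
  have r1: "?N (a @ j # i # b @ k # l # c) x = q k l * ?N (a @ j # i # b @ l # k # c) x +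
      (\<Sum>h\<in>?C. \<kappa> k l h * lamw h c * ?N (a @ j # i # b @ c) (x \<otimes> inv h))"
    using IH[of "a @ j # i # b" k l c x] less1 sX kl x by (simp add: reduct_def)
  have r2: "?N (a @ i # j # b @ l # k # c) x = q i j * ?N (a @ j # i # b @ l # k # c) x +
      (\<Sum>g\<in>?C. \<kappa> i j g * lamw g (b @ l # k # c) * ?N (a @ b @ l # k # c) (x \<otimes> inv g))"
    using IH[of a i j "b @ l # k # c" x] less2 sX ij x by (simp add: reduct_def)
  have r3: "?N (a @ b @ k # l # c) (x \<otimes> inv g) = q k l * ?N (a @ b @ l # k # c) (x \<otimes> inv g) +
      (\<Sum>h\<in>?C. \<kappa> k l h * lamw h c * ?N ?u (x \<otimes> inv g \<otimes> inv h))" if "g \<in> ?C" for g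
    using IH[of "a @ b" k l c "x \<otimes> inv g"] less3 sX kl x that by (simp add: reduct_def)
  have r4: "?N (a @ i # j # b @ c) (x \<otimes> inv h) = q i j * ?N (a @ j # i # b @ c) (x \<otimes> inv h) +
      (\<Sum>g\<in>?C. \<kappa> i j g * lamw g (b @ c) * ?N ?u (x \<otimes> inv h \<otimes> inv g))" if "h \<in> ?C" for h
    using IH[of a i j "b @ c" "x \<otimes> inv h"] less4 sX ij x that by (simp add: reduct_def)
  have commute: "(\<Sum>h\<in>?C. lam g k * lam g l * \<kappa> k l h * lamw h c * ?N ?u (x \<otimes> inv g \<otimes> inv h)) =
      (\<Sum>h\<in>?C. \<kappa> k l h * lamw h c * ?N ?u (x \<otimes> inv h \<otimes> inv g))" if g: "g \<in> ?C" for g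
  proof (rule sum.reindex_bij_witness[of _ "\<lambda>h. g \<otimes> h \<otimes> inv g" "\<lambda>h. inv g \<otimes> h \<otimes> g"])
    fix h assume h: "h \<in> ?C"
    have "lamw (inv g \<otimes> h \<otimes> g) c = lamw h c"
      using lamw_conj[of "inv g" h c] g h sX by simp
    moreover have "x \<otimes> inv (inv g \<otimes> h \<otimes> g) \<otimes> inv g = x \<otimes> inv g \<otimes> inv h"
      using g h x by (simp add: inv_mult_group m_assoc)
    ultimately show "\<kappa> k l (inv g \<otimes> h \<otimes> g) * lamw (inv g \<otimes> h \<otimes> g) c *
        ?N ?u (x \<otimes> inv (inv g \<otimes> h \<otimes> g) \<otimes> inv g) =
      lam g k * lam g l * \<kappa> k l h * lamw h c * ?N ?u (x \<otimes> inv g \<otimes> inv h)"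
      using equivariant[of k l g h] sX g h by simp
  qed (use g in \<open>auto simp: m_assoc simp flip: m_assoc[of "inv g" g] m_assoc[of g "inv g"]\<close>)
  have double: "(\<Sum>g\<in>?C. \<Sum>h\<in>?C. \<kappa> i j g * lamw g (b @ k # l # c) * (\<kappa> k l h * lamw h c * ?N ?u (x \<otimes> inv g \<otimes> inv h))) =
     (\<Sum>h\<in>?C. \<Sum>g\<in>?C. \<kappa> k l h * lamw h c * (\<kappa> i j g * lamw g (b @ c) * ?N ?u (x \<otimes> inv h \<otimes> inv g)))"
  proof -
    have "(\<Sum>h\<in>?C. \<kappa> i j g * lamw g (b @ k # l # c) * (\<kappa> k l h * lamw h c * ?N ?u (x \<otimes> inv g \<otimes> inv h))) =
      \<kappa> i j g * lamw g (b @ c) * (\<Sum>h\<in>?C. lam g k * lam g l * \<kappa> k l h * lamw h c * ?N ?u (x \<otimes> inv g \<otimes> inv h))" for g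
      by (simp add: sum_distrib_left mult_ac)
    also have "\<dots> g = (\<Sum>h\<in>?C. \<kappa> k l h * lamw h c * (\<kappa> i j g * lamw g (b @ c) * ?N ?u (x \<otimes> inv h \<otimes> inv g)))"
      if "g \<in> ?C" for g
      unfolding commute[OF that] by (simp add: sum_distrib_left mult_ac)
    finally show ?thesis by (subst sum.swap) (auto intro!: sum.cong)
  qed
  have "reduct a i j (b @ k # l # c) x v = q i j * ?N (a @ j # i # b @ k # l # c) x +
      (\<Sum>g\<in>?C. \<kappa> i j g * lamw g (b @ k # l # c) * ?N (a @ b @ k # l # c) (x \<otimes> inv g))"
    by (simp add: reduct_def)
  also have "\<dots> = q i j * q k l * ?N (a @ j # i # b @ l # k # c) x +
      q i j * (\<Sum>h\<in>?C. \<kappa> k l h * lamw h c * ?N (a @ j # i # b @ c) (x \<otimes> inv h)) +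
      q k l * (\<Sum>g\<in>?C. \<kappa> i j g * lamw g (b @ l # k # c) * ?N (a @ b @ l # k # c) (x \<otimes> inv g)) +
      (\<Sum>g\<in>?C. \<Sum>h\<in>?C. \<kappa> i j g * lamw g (b @ k # l # c) * (\<kappa> k l h * lamw h c * ?N ?u (x \<otimes> inv g \<otimes> inv h)))"
    by (simp add: r1 r3 algebra_simps sum.distrib sum_distrib_left cong: sum.cong)
  also have "\<dots> = q k l * ?N (a @ i # j # b @ l # k # c) x +
      (\<Sum>h\<in>?C. \<kappa> k l h * lamw h c * ?N (a @ i # j # b @ c) (x \<otimes> inv h))"
    unfolding double r2 by (simp add: r4 algebra_simps sum.distrib sum_distrib_left cong: sum.cong)
  also have "\<dots> = reduct (a @ i # j # b) k l c x v"
    by (simp add: reduct_def)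
  finally show ?thesis .
qed

text \<open>
  Straightening \<open>k j i\<close> completely in both ways produces the same multiple of \<open>i j k\<close>, and terms in
  which one pair has been replaced by \<open>\<kappa>\<close> while the third letter is left over. These are compared
  letter by letter; the facts \<open>c1\<close>, \<open>c2\<close>, \<open>c3\<close> are the Jacobi condition for the three possible left-over
  letters \<open>k\<close>, \<open>j\<close>, \<open>i\<close>.
\<close>
lemma overlap_confluence:
  assumes IH: "\<And>a i j b g. (a @ i # j # b, w) \<in> lenlex less_than \<Longrightarrow> set (a @ i # j # b) \<subseteq> X \<Longrightarrow> j < i \<Longrightarrow>
      g \<in> carrier G \<Longrightarrow> nf (a @ i # j # b) g v = reduct a i j b g v"
    and w: "w = a @ k # j # i # b" and X: "set w \<subseteq> X" and ij: "i < j" and jk: "j < k"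
    and x: "x \<in> carrier G"
  shows "reduct a k j (i # b) x v = reduct (a @ [k]) j i b x v"
proof -
  let ?C = "carrier G"
  let ?N = "\<lambda>u g. nf u g v"
  have sX: "set a \<subseteq> X" "set b \<subseteq> X" "i \<in> X" "j \<in> X" "k \<in> X"
    using X by (auto simp: w)
  have ik: "i < k" using ij jk by simp
  have tr: "trans (lenlex (less_than :: (nat \<times> nat) set))" by (rule lenlex_transI[OF trans_less_than])
  have less1: "(a @ j # k # i # b, w) \<in> lenlex less_than"
    unfolding w by (rule swap_less[OF jk])
  have less2: "(a @ k # i # j # b, w) \<in> lenlex less_than"
    using swap_less[OF ij, of "a @ [k]" b] by (simp add: w)
  have less3: "(a @ j # i # k # b, w) \<in> lenlex less_than"
    using transD[OF tr swap_less[OF ik, of "a @ [j]" b]] less1 by simp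
  have less4: "(a @ i # k # j # b, w) \<in> lenlex less_than"
    using transD[OF tr swap_less[OF ik, of a "j # b"] less2] .
  have r1: "?N (a @ j # k # i # b) x = q k i * ?N (a @ j # i # k # b) x +
      (\<Sum>g\<in>?C. \<kappa> k i g * lamw g b * ?N (a @ j # b) (x \<otimes> inv g))"
    using IH[of "a @ [j]" k i b x] less1 sX ik x by (simp add: reduct_def)
  have r2: "?N (a @ j # i # k # b) x = q j i * ?N (a @ i # j # k # b) x +
      (\<Sum>g\<in>?C. \<kappa> j i g * lamw g (k # b) * ?N (a @ k # b) (x \<otimes> inv g))"
    using IH[of a j i "k # b" x] less3 sX ij x by (simp add: reduct_def)
  have r3: "?N (a @ k # i # j # b) x = q k i * ?N (a @ i # k # j # b) x +
      (\<Sum>g\<in>?C. \<kappa> k i g * lamw g (j # b) * ?N (a @ j # b) (x \<otimes> inv g))"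
    using IH[of a k i "j # b" x] less2 sX ik x by (simp add: reduct_def)
  have r4: "?N (a @ i # k # j # b) x = q k j * ?N (a @ i # j # k # b) x +
      (\<Sum>g\<in>?C. \<kappa> k j g * lamw g b * ?N (a @ i # b) (x \<otimes> inv g))"
    using IH[of "a @ [i]" k j b x] less4 sX jk x by (simp add: reduct_def)
  have c1: "q k j * q k i * (\<kappa> j i g * lam g k) = \<kappa> j i g" if "g \<in> ?C" for g
  proof (cases "\<kappa> j i g = 0")
    case False
    then have "lam g k = q j k * q i k" using jacobi[of j i k g] that sX ij jk by simp
    then have "q k j * q k i * (\<kappa> j i g * lam g k) = \<kappa> j i g * (q k j * q j k) * (q k i * q i k)"
      by simp
    also have "\<dots> = \<kappa> j i g" by (simp only: q_inv sX mult_1_right)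
    finally show ?thesis .
  qed simp
  have c2: "q k j * \<kappa> k i g = q j i * (\<kappa> k i g * lam g j)" if "g \<in> ?C" for g
  proof (cases "\<kappa> k i g = 0")
    case False
    then have "lam g j = q k j * q i j" using jacobi[of k i j g] that sX ij jk by simp
    then have "q j i * (\<kappa> k i g * lam g j) = \<kappa> k i g * q k j * (q j i * q i j)"
      by simp
    also have "\<dots> = q k j * \<kappa> k i g" by (simp add: q_inv[OF sX(4,3)])
    finally show ?thesis by (rule sym)
  qed simp
  have c3: "\<kappa> k j g * lam g i = q j i * q k i * \<kappa> k j g" if "g \<in> ?C" for g
    using jacobi[of k j i g] that sX ij jk by (cases "\<kappa> k j g = 0") simp_all
  have s1: "q k j * q k i * (\<Sum>g\<in>?C. \<kappa> j i g * lamw g (k # b) * ?N (a @ k # b) (x \<otimes> inv g)) =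
      (\<Sum>g\<in>?C. \<kappa> j i g * lamw g b * ?N (a @ k # b) (x \<otimes> inv g))"
  proof -
    have *: "q k j * q k i * (\<kappa> j i g * lamw g (k # b) * z) = \<kappa> j i g * lamw g b * z" if "g \<in> ?C" for g z
    proof -
      have *: "q k j * q k i * (\<kappa> j i g * lamw g (k # b) * z) = q k j * q k i * (\<kappa> j i g * lam g k) * lamw g b * z"
        by simp
      then show ?thesis by (simp only: c1[OF that])
    qed
    show ?thesis unfolding sum_distrib_left by (rule sum.cong[OF refl], rule *)
  qed
  have s2: "q k j * (\<Sum>g\<in>?C. \<kappa> k i g * lamw g b * ?N (a @ j # b) (x \<otimes> inv g)) =
      q j i * (\<Sum>g\<in>?C. \<kappa> k i g * lamw g (j # b) * ?N (a @ j # b) (x \<otimes> inv g))"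
  proof -
    have *: "q k j * (\<kappa> k i g * lamw g b * z) = q j i * (\<kappa> k i g * lamw g (j # b) * z)" if "g \<in> ?C" for g z
    proof -
      have "q k j * (\<kappa> k i g * lamw g b * z) = q k j * \<kappa> k i g * lamw g b * z" by simp
      then show ?thesis by (simp only: c2[OF that]) simp
    qed
    show ?thesis unfolding sum_distrib_left by (rule sum.cong[OF refl], rule *)
  qed
  have s3: "(\<Sum>g\<in>?C. \<kappa> k j g * lamw g (i # b) * ?N (a @ i # b) (x \<otimes> inv g)) =
      q j i * q k i * (\<Sum>g\<in>?C. \<kappa> k j g * lamw g b * ?N (a @ i # b) (x \<otimes> inv g))"
  proof -
    have *: "\<kappa> k j g * lamw g (i # b) * z = q j i * q k i * (\<kappa> k j g * lamw g b * z)" if "g \<in> ?C" for g z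
    proof -
      have "\<kappa> k j g * lamw g (i # b) * z = \<kappa> k j g * lam g i * lamw g b * z" by simp
      then show ?thesis by (simp only: c3[OF that]) simp
    qed
    show ?thesis unfolding sum_distrib_left by (rule sum.cong[OF refl], rule *)
  qed
  have "reduct a k j (i # b) x v =
      q k j * q k i * q j i * ?N (a @ i # j # k # b) x +
      q k j * q k i * (\<Sum>g\<in>?C. \<kappa> j i g * lamw g (k # b) * ?N (a @ k # b) (x \<otimes> inv g)) +
      q k j * (\<Sum>g\<in>?C. \<kappa> k i g * lamw g b * ?N (a @ j # b) (x \<otimes> inv g)) +
      (\<Sum>g\<in>?C. \<kappa> k j g * lamw g (i # b) * ?N (a @ i # b) (x \<otimes> inv g))"
    unfolding reduct_def r1 r2 by (simp add: distrib_left mult.assoc del: lamw_simps)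
  also have "\<dots> = q j i * q k i * q k j * ?N (a @ i # j # k # b) x +
      q j i * q k i * (\<Sum>g\<in>?C. \<kappa> k j g * lamw g b * ?N (a @ i # b) (x \<otimes> inv g)) +
      q j i * (\<Sum>g\<in>?C. \<kappa> k i g * lamw g (j # b) * ?N (a @ j # b) (x \<otimes> inv g)) +
      (\<Sum>g\<in>?C. \<kappa> j i g * lamw g b * ?N (a @ k # b) (x \<otimes> inv g))"
    unfolding s1 s2 s3 by (simp only: ac_simps)
  also have "\<dots> = reduct (a @ [k]) j i b x v"
    unfolding reduct_def append_assoc append_Cons append_Nil r3 r4
    by (simp add: distrib_left mult.assoc del: lamw_simps)
  finally show ?thesis .
qed

text \<open>
  Well-founded induction: if all smaller words satisfy the claim, the two confluence lemmas show
  that any two reductions of \<open>w\<close> give the same result, in particular any reduction and the one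
  chosen in the definition of \<open>nf\<close>.
\<close>
theorem nf_eq_reduct:
  assumes "set (a @ i # j # b) \<subseteq> X" "j < i" "x \<in> carrier G"
  shows "nf (a @ i # j # b) x v = reduct a i j b x v"
proof -
  have "\<forall>a i j b x. w = a @ i # j # b \<longrightarrow> set w \<subseteq> X \<longrightarrow> j < i \<longrightarrow> x \<in> carrier G \<longrightarrow>
      nf w x v = reduct a i j b x v" for w
  proof (induction w rule: wf_induct[OF wf_lenlex[OF wf_less_than]])
    case (1 w)
    have IH: "nf (a @ i # j # b) g v = reduct a i j b g v"
      if "(a @ i # j # b, w) \<in> lenlex less_than" "set (a @ i # j # b) \<subseteq> X" "j < i" "g \<in> carrier G" for a i j b g
      using 1[rule_format, OF that(1) refl] that by blast
    have confluent: "reduct a i j b x v = reduct a' i' j' b' x v"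
      if eq: "w = a @ i # j # b" "w = a' @ i' # j' # b'" and X: "set w \<subseteq> X" and lt: "j < i" "j' < i'"
        and x: "x \<in> carrier G" and len: "length a < length a'" for a i j b a' i' j' b' x
    proof -
      have "a @ i # j # b = a' @ i' # j' # b'" using eq by simp
      then show ?thesis using len
      proof (cases rule: two_descents)
        case overlap
        then show ?thesis
          using overlap_confluence[where w = w and v = v and a = a and k = i and j = j and i = j' and b = b' and x = x]
            IH eq X lt x by simp
      next
        case (disjoint c)
        then show ?thesis
          using disjoint_confluence[where w = w and v = v and a = a and i = i and j = j and b = c and k = i' and l = j' and c = b' and x = x]
            IH eq X lt x by simp
      qed
    qed
    show ?case
    proof (intro allI impI)
      fix a i j b x
      assume w: "w = a @ i # j # b" and X: "set w \<subseteq> X" and ij: "j < i" and x: "x \<in> carrier G"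
      then have "descent w (a, i, j, b)" by (simp add: descent_def)
      then obtain a' i' j' b' where p: "w = a' @ i' # j' # b'" "j' < i'" "nf w = reduct a' i' j' b'"
        by (rule nf_descent)
      consider "length a < length a'" | "length a' < length a" | "length a = length a'" by linarith
      then have "reduct a i j b x v = reduct a' i' j' b' x v"
      proof cases
        case 3 then show ?thesis using w p(1) by simp
      qed (use confluent[OF w p(1) X ij p(2) x] confluent[OF p(1) w X p(2) ij x] in simp_all)
      then show "nf w x v = reduct a i j b x v" by (simp add: p(3))
    qed
  qed
  then show ?thesis using assms by blast
qed

text \<open>
  The restriction to descents disappears because the relations for \<open>(i, j)\<close> and \<open>(j, i)\<close> are
  multiples of each other.
\<close>
lemma nf_relation:
  assumes X: "set (a @ i # j # b) \<subseteq> X" and x: "x \<in> carrier G"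
  shows "nf (a @ i # j # b) x v = reduct a i j b x v"
proof -
  have ij: "i \<in> X" "j \<in> X" using X by auto
  consider "j < i" | "i < j" | "i = j" by linarith
  then show ?thesis
  proof cases
    case 1 then show ?thesis by (intro nf_eq_reduct X x)
  next
    case 2
    have "nf (a @ j # i # b) x v = reduct a j i b x v"
      using X by (intro nf_eq_reduct 2 x) auto
    then have "q i j * nf (a @ j # i # b) x v = q i j * q j i * nf (a @ i # j # b) x v +
        (\<Sum>h\<in>carrier G. q i j * \<kappa> j i h * lamw h b * nf (a @ b) (x \<otimes> inv h) v)"
      by (simp add: reduct_def distrib_left sum_distrib_left mult.assoc)
    also have "(\<Sum>h\<in>carrier G. q i j * \<kappa> j i h * lamw h b * nf (a @ b) (x \<otimes> inv h) v) =
        - (\<Sum>h\<in>carrier G. \<kappa> i j h * lamw h b * nf (a @ b) (x \<otimes> inv h) v)"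
      using kappa_skew[OF ij] by (simp add: sum_negf)
    finally show ?thesis using q_inv[OF ij] by (simp add: reduct_def)
  next
    case 3
    then show ?thesis using ij by (simp add: reduct_def q_diag kappa_diag)
  qed
qed

end

section \<open>Two quotients of the skew group algebra\<close>

context diagonal_action
begin

lemma mult_smult_right:
  assumes "x \<in> carrier B" "y \<in> carrier B"
  shows "x \<star> (c \<bullet> y) = c \<bullet> (x \<star> y)"
proof -
  have act: "free_act lam g (\<lambda>w. c * p w) = (\<lambda>w. c * free_act lam g p w)" for g p
    by (simp add: act_eq mult_ac)
  have "skew_mult x (c \<bullet> y) = c \<bullet> skew_mult x y"
    by (auto simp: skew_mult_def skew_sel act conv_scale fun_eq_iff sum_fun_apply sum_distrib_left)
  then show ?thesis using assms by (simp add: skew_mult_eq)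
qed

lemma mult_sum_left:
  "(\<And>i. i \<in> S \<Longrightarrow> f i \<in> carrier B) \<Longrightarrow> x \<in> carrier B \<Longrightarrow> sum f S \<star> x = (\<Sum>i\<in>S. f i \<star> x)"
  by (induction S rule: infinite_finite_induct) (simp_all add: B.mult_add_left B.sum_carr)

lemma mult_sum_right:
  "(\<And>i. i \<in> S \<Longrightarrow> f i \<in> carrier B) \<Longrightarrow> x \<in> carrier B \<Longrightarrow> x \<star> sum f S = (\<Sum>i\<in>S. x \<star> f i)"
  by (induction S rule: infinite_finite_induct) (simp_all add: B.mult_add_right B.sum_carr)

definition incl :: "(nat list \<Rightarrow> complex) \<Rightarrow> 'g \<Rightarrow> nat list \<Rightarrow> complex" where
  "incl p = (\<lambda>k. if k = \<one> then p else 0)"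

lemma skew_incl_eq: "skew_incl G T p = incl p"
  by (simp add: skew_incl_def incl_def free_alg_sel cong: if_cong)

lemma incl_word: "incl (word u) = bas u \<one>"
  by (simp add: incl_def bas_def)

lemma incl_carrier: "p \<in> carrier T \<Longrightarrow> incl p \<in> carrier B"
  using concrete_alg.zero_carr[OF free_concrete] by (auto simp: skew_carrier incl_def)

lemma incl_mult_left:
  assumes p: "p \<in> carrier T" and x: "x \<in> carrier B" and k: "k \<in> carrier G"
  shows "(incl p \<star> x) k = conv p (x k)"
proof -
  have "skew_mult (incl p) x k =
    (\<Sum>g\<in>carrier G. if g = \<one> then conv p (free_act lam \<one> (x (inv \<one> \<otimes> k))) else 0)"
    using k by (auto simp: skew_mult_def incl_def intro!: sum.cong)
  also have "\<dots> = conv p (x k)" using fin k x by (simp add: act_one skew_carrier)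
  finally show ?thesis using p x by (simp add: skew_mult_eq incl_carrier)
qed

lemma incl_hom: "incl \<in> ring_hom T B"
proof (rule ring_hom_memI)
  fix p r assume p: "p \<in> carrier T" and r: "r \<in> carrier T"
  show "incl p \<in> carrier B" by (rule incl_carrier[OF p])
  show "incl (p \<otimes>\<^bsub>T\<^esub> r) = incl p \<star> incl r"
  proof
    fix k show "incl (p \<otimes>\<^bsub>T\<^esub> r) k = (incl p \<star> incl r) k"
    proof (cases "k \<in> carrier G")
      case True
      then show ?thesis using p r by (simp add: incl_mult_left incl_carrier) (simp add: incl_def free_alg_sel)
    next
      case False
      then have "k \<noteq> \<one>" by auto
      then show ?thesis
        using False p r by (simp add: skew_mult_eq incl_carrier skew_mult_def) (simp add: incl_def)
    qed
  qed
  show "incl (p \<oplus>\<^bsub>T\<^esub> r) = incl p \<oplus>\<^bsub>B\<^esub> incl r"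
    by (auto simp: incl_def free_alg_sel skew_sel)
qed (simp add: incl_word free_alg_sel one_eq)

text \<open>
  Elements of the subalgebra \<open>T(V)\<close> generate everything together with the group; this carries
  statements about ideals of \<open>T(V)\<close> over to the skew group algebra.
\<close>
lemma group_decomposition:
  assumes x: "x \<in> carrier B"
  shows "x = (\<Sum>g\<in>carrier G. incl (x g) \<star> bas [] g)"
proof
  fix k
  have "(incl (x g) \<star> bas [] g) k = (if k = g then x g else 0)" if g: "g \<in> carrier G" for g
  proof (cases "k \<in> carrier G")
    case True
    have "x g \<in> carrier T" using x g by (simp add: skew_carrier)
    then show ?thesis using True g by (simp add: incl_mult_left) (simp add: bas_def)
  next
    case False
    have "x g \<in> carrier T" using x g by (simp add: skew_carrier)
    then show ?thesis using False g by (auto simp: skew_mult_eq incl_carrier skew_mult_def)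
  qed
  then have "(\<Sum>g\<in>carrier G. incl (x g) \<star> bas [] g) k = (\<Sum>g\<in>carrier G. if k = g then x g else 0)"
    by (simp add: sum_fun_apply)
  also have "\<dots> = x k" using fin x by (simp add: skew_carrier)
  finally show "x k = (\<Sum>g\<in>carrier G. incl (x g) \<star> bas [] g) k" by simp
qed

end

context quantum_relations
begin

text \<open>
  The generators of the ideals that define the quantum symmetric algebra and the Hecke algebra.
\<close>
definition sgen :: "nat \<Rightarrow> nat \<Rightarrow> nat list \<Rightarrow> complex" where
  "sgen i j = word [i, j] - (\<lambda>w. q i j * word [j, i] w)"

definition hgen :: "nat \<Rightarrow> nat \<Rightarrow> 'g \<Rightarrow> nat list \<Rightarrow> complex" where
  "hgen i j = bas [i, j] \<one> - q i j \<bullet> bas [j, i] \<one> - (\<Sum>h\<in>carrier G. \<kappa> i j h \<bullet> bas [] h)"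

lemma sgen_carrier: "i \<in> X \<Longrightarrow> j \<in> X \<Longrightarrow> sgen i j \<in> carrier T"
proof -
  interpret T: concrete_alg T by (rule free_concrete)
  show "i \<in> X \<Longrightarrow> j \<in> X \<Longrightarrow> sgen i j \<in> carrier T"
    unfolding sgen_def by (intro T.minus_carr word_carrier free_scale_carrier) auto
qed

lemma hgen_carrier: "i \<in> X \<Longrightarrow> j \<in> X \<Longrightarrow> hgen i j \<in> carrier B"
  unfolding hgen_def by (intro B.minus_carr B.sum_carr B.smult_closed bas_carrier) auto

abbreviation S where "S \<equiv> qsym_ideal n q"
abbreviation H where "H \<equiv> hecke_ideal G n lam q \<kappa>"

lemma qsym_ideal_eq: "S = genideal T {sgen i j | i j. i \<in> X \<and> j \<in> X}"
proof -
  interpret T: concrete_alg T by (rule free_concrete)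
  have w: "free_gen i = word [i]" for i :: nat by (simp add: free_gen_def word_def)
  have "(free_gen i \<otimes>\<^bsub>T\<^esub> free_gen j) \<ominus>\<^bsub>T\<^esub> (q i j \<odot>\<^bsub>T\<^esub> (free_gen j \<otimes>\<^bsub>T\<^esub> free_gen i)) = sgen i j"
    if "i \<in> X" "j \<in> X" for i j
    using that free_scale_carrier[of "word [j, i]" X "\<lambda>_. q i j"]
    by (simp add: T.a_minus_eq w free_alg_sel conv_word sgen_def)
  then have "{(free_gen i \<otimes>\<^bsub>T\<^esub> free_gen j) \<ominus>\<^bsub>T\<^esub> (q i j \<odot>\<^bsub>T\<^esub> (free_gen j \<otimes>\<^bsub>T\<^esub> free_gen i)) | i j. i \<in> X \<and> j \<in> X}
    = {sgen i j | i j. i \<in> X \<and> j \<in> X}"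
    by (intro Collect_cong) metis
  then show ?thesis unfolding qsym_ideal_def Let_def by simp
qed

lemma group_alg_incl_eq:
  assumes "i \<in> X" "j \<in> X"
  shows "group_alg_incl T (\<kappa> i j) = (\<Sum>h\<in>carrier G. \<kappa> i j h \<bullet> bas [] h)"
proof (intro ext)
  fix g w
  have "(\<Sum>h\<in>carrier G. \<kappa> i j h \<bullet> bas [] h) g w = (\<Sum>h\<in>carrier G. if h = g then \<kappa> i j g * word [] w else 0)"
    by (auto simp: sum_fun_apply skew_sel bas_def intro!: sum.cong)
  also have "\<dots> = \<kappa> i j g * word [] w"
    using fin kappa_supp[OF assms, of g] by simp
  finally show "group_alg_incl T (\<kappa> i j) g w = (\<Sum>h\<in>carrier G. \<kappa> i j h \<bullet> bas [] h) g w"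
    by (simp add: group_alg_incl_def free_alg_sel)
qed

lemma one_smult: "1 \<bullet> x = x"
  by (simp add: skew_sel)

lemma hecke_ideal_eq: "H = genideal B {hgen i j | i j. i \<in> X \<and> j \<in> X}"
proof -
  have w: "skew_incl G T (free_gen i) = bas [i] \<one>" for i
    unfolding skew_incl_eq by (simp add: free_gen_def incl_word[symmetric] word_def[symmetric] cong: if_cong)
  have m: "bas [i] \<one> \<star> bas [j] \<one> = bas [i, j] \<one>" if "i \<in> X" "j \<in> X" for i j
    using that mult_bas[of \<one> \<one> "[i]" "[j]"] by (simp add: lam_one one_smult)
  have "((bas [i] \<one> \<star> bas [j] \<one>) \<ominus>\<^bsub>B\<^esub> (q i j \<bullet> (bas [j] \<one> \<star> bas [i] \<one>))) \<ominus>\<^bsub>B\<^esub> group_alg_incl T (\<kappa> i j) = hgen i j"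
    if ij: "i \<in> X" "j \<in> X" for i j
  proof -
    have "(\<Sum>h\<in>carrier G. \<kappa> i j h \<bullet> bas [] h) \<in> carrier B"
      by (intro B.sum_carr B.smult_closed bas_carrier) auto
    then show ?thesis
      using ij by (simp add: B.a_minus_eq m group_alg_incl_eq hgen_def)
  qed
  then have "{((bas [i] \<one> \<star> bas [j] \<one>) \<ominus>\<^bsub>B\<^esub> (q i j \<bullet> (bas [j] \<one> \<star> bas [i] \<one>))) \<ominus>\<^bsub>B\<^esub> group_alg_incl T (\<kappa> i j)
      | i j. i \<in> X \<and> j \<in> X} = {hgen i j | i j. i \<in> X \<and> j \<in> X}"
    by (intro Collect_cong) metis
  then show ?thesis unfolding hecke_ideal_def Let_def w by simp
qed

lemma hgens_carrier: "{hgen i j | i j. i \<in> X \<and> j \<in> X} \<subseteq> carrier B"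
  using hgen_carrier by auto

lemma sgens_carrier: "{sgen i j | i j. i \<in> X \<and> j \<in> X} \<subseteq> carrier T"
  using sgen_carrier by auto

sublocale T: alg_ideal T S
proof -
  interpret T: concrete_alg T by (rule free_concrete)
  show "alg_ideal T S"
    by (intro alg_ideal.intro free_concrete) (unfold qsym_ideal_eq, intro T.genideal_ideal sgens_carrier)
qed

sublocale H: filtered_quotient B comp H
  by (intro filtered_quotient.intro alg_ideal.intro B.graded_alg_axioms skew_concrete)
     (unfold hecke_ideal_eq, intro B.genideal_ideal hgens_carrier)

lemma hgen_in_ideal: "i \<in> X \<Longrightarrow> j \<in> X \<Longrightarrow> hgen i j \<in> H"
  unfolding hecke_ideal_eq using B.genideal_self[OF hgens_carrier] by blast

lemma sgen_in_ideal: "i \<in> X \<Longrightarrow> j \<in> X \<Longrightarrow> sgen i j \<in> S"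
  unfolding qsym_ideal_eq using T.genideal_self[OF sgens_carrier] by blast

lemma hecke_alg_eq: "hecke_alg G n lam q \<kappa> = H.Q"
  by (simp add: hecke_alg_def)

lemma qsym_eq: "qsym n q = T.Q"
  by (simp add: qsym_def)

lemma comp_zero_iff: "comp e x = 0 \<longleftrightarrow> (\<forall>g w. length w = e \<longrightarrow> x g w = 0)"
  by (auto simp: comp_def fun_eq_iff)

lemma comp_self_iff: "comp d x = x \<longleftrightarrow> (\<forall>g w. x g w \<noteq> 0 \<longrightarrow> length w = d)"
  unfolding comp_def fun_eq_iff by (rule all_cong1, rule all_cong1) auto

lemma below_eq: "B.below (Suc d) = skew_part G T (free_filtration X d)"
proof -
  have "x \<in> B.below (Suc d) \<longleftrightarrow> x \<in> carrier B \<and> (\<forall>g w. x g w \<noteq> 0 \<longrightarrow> length w \<le> d)" for x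
    unfolding B.below_def mem_Collect_eq comp_zero_iff by (metis not_less_eq_eq)
  then show ?thesis
    by (fastforce simp: skew_carrier skew_part_def free_filtration_def free_alg_sel)
qed

lemma filtration_eq: "hecke_filtration G n lam q \<kappa> = H.F"
  by (rule ext) (simp add: hecke_filtration_def H.F_def below_eq)

lemma homog_iff: "x \<in> B.homog d \<longleftrightarrow> x \<in> carrier B \<and> (\<forall>g w. x g w \<noteq> 0 \<longrightarrow> length w = d)"
  by (simp add: B.homog_def comp_self_iff)

lemma homog_eq: "B.homog d = skew_part G T (free_degree X d)"
proof -
  show ?thesis
    by (fastforce simp: homog_iff skew_carrier skew_part_def free_degree_def free_alg_sel)
qed

text \<open>
  The projection of \<open>T(V) \<rtimes> G\<close> onto the skew group algebra of the quantum symmetric algebra.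
  Outside \<open>carrier G\<close> it gives the coset of zero, as the conventions require.
\<close>
definition qproj :: "('g \<Rightarrow> nat list \<Rightarrow> complex) \<Rightarrow> 'g \<Rightarrow> (nat list \<Rightarrow> complex) set" where
  "qproj x = (\<lambda>g. S +>\<^bsub>T\<^esub> x g)"

abbreviation QS where "QS \<equiv> qsym_skew G n lam q"

lemma qsym_carrier_sel: "carrier QS = skew_part G T.Q (carrier T.Q)" "\<zero>\<^bsub>T.Q\<^esub> = S"
  by (simp_all add: qsym_skew_def skew_alg_def qsym_eq T.quot_zero)

lemma act_preserves_qsym_ideal: assumes g: "g \<in> carrier G" shows "p \<in> S \<Longrightarrow> free_act lam g p \<in> S"
proof -
  have hom: "ring_hom_ring T T (free_act lam g)"
    by (rule ring_hom_ringI)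
       (auto simp: T.ring_axioms act_carrier act_conv act_add free_alg_sel act_word)
  have "ideal {r \<in> carrier T. free_act lam g r \<in> S} T"
    using ring_hom_ring.ideal_vimage[OF hom T.ideal_axioms] .
  moreover have "free_act lam g (sgen i j) \<in> S" if "i \<in> X" "j \<in> X" for i j
  proof -
    have "free_act lam g (sgen i j) = lam g i * lam g j \<odot>\<^bsub>T\<^esub> sgen i j"
      by (auto simp: act_eq sgen_def free_alg_sel fun_eq_iff word_def algebra_simps)
    then show ?thesis using sgen_in_ideal[OF that] T.I_smult by simp
  qed
  then have "{sgen i j | i j. i \<in> X \<and> j \<in> X} \<subseteq> {r \<in> carrier T. free_act lam g r \<in> S}"
    using sgen_carrier by auto
  ultimately have "S \<subseteq> {r \<in> carrier T. free_act lam g r \<in> S}"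
    unfolding qsym_ideal_eq by (rule T.genideal_minimal)
  then show "p \<in> S \<Longrightarrow> free_act lam g p \<in> S" by auto
qed

text \<open>
  Needs the ideal to be mapped onto itself and not only into itself, hence the use of the inverse.
\<close>
lemma act_coset:
  assumes g: "g \<in> carrier G" and p: "p \<in> carrier T"
  shows "qsym_act lam g (S +>\<^bsub>T\<^esub> p) = S +>\<^bsub>T\<^esub> free_act lam g p"
proof
  show "qsym_act lam g (S +>\<^bsub>T\<^esub> p) \<subseteq> S +>\<^bsub>T\<^esub> free_act lam g p"
    using act_preserves_qsym_ideal[OF g] by (auto simp: qsym_act_def T.coset_eq act_add)
  show "S +>\<^bsub>T\<^esub> free_act lam g p \<subseteq> qsym_act lam g (S +>\<^bsub>T\<^esub> p)"
  proof
    fix y assume "y \<in> S +>\<^bsub>T\<^esub> free_act lam g p"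
    then obtain s where s: "s \<in> S" "y = s + free_act lam g p" by (auto simp: T.coset_eq)
    have "free_act lam g (free_act lam (inv g) s + p) = y"
      using s g T.Icarr[OF s(1)] by (simp add: act_add act_act act_one)
    then show "y \<in> qsym_act lam g (S +>\<^bsub>T\<^esub> p)"
      using act_preserves_qsym_ideal[of "inv g"] s g by (force simp: qsym_act_def T.coset_eq)
  qed
qed

lemma qproj_carrier: "x \<in> carrier B \<Longrightarrow> qproj x \<in> carrier QS"
  by (auto simp: qsym_carrier_sel skew_part_def qproj_def skew_carrier T.quot_carrier T.coset_zero)

lemma qproj_hom: "qproj \<in> ring_hom B QS"
proof (rule ring_hom_memI)
  fix x y assume x: "x \<in> carrier B" and y: "y \<in> carrier B"
  show "qproj x \<in> carrier QS" by (rule qproj_carrier[OF x])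
  show "qproj (x \<oplus>\<^bsub>B\<^esub> y) = qproj x \<oplus>\<^bsub>QS\<^esub> qproj y"
  proof
    fix g
    have "x g \<in> carrier T" "y g \<in> carrier T" using x y by (cases "g \<in> carrier G"; simp add: skew_carrier)+
    then show "qproj (x \<oplus>\<^bsub>B\<^esub> y) g = (qproj x \<oplus>\<^bsub>QS\<^esub> qproj y) g"
      by (simp add: qsym_skew_def skew_alg_def qsym_eq qproj_def skew_sel T.quot_add)
  qed
  show "qproj (x \<star> y) = qproj x \<otimes>\<^bsub>QS\<^esub> qproj y"
  proof
    fix k
    show "qproj (x \<star> y) k = (qproj x \<otimes>\<^bsub>QS\<^esub> qproj y) k"
    proof (cases "k \<in> carrier G")
      case k: True
      interpret Q: ring T.Q by (rule T.quot_ring)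
      let ?z = "\<lambda>g. conv (x g) (free_act lam g (y (inv g \<otimes> k)))"
      have xc: "x g \<in> carrier T" and yc: "free_act lam g (y (inv g \<otimes> k)) \<in> carrier T"
        if "g \<in> carrier G" for g using x y that k by (auto simp: skew_carrier act_carrier)
      have zc: "?z g \<in> carrier T" if "g \<in> carrier G" for g
        using xc[OF that] yc[OF that] by (rule conv_carrier)
      have "qproj x g \<otimes>\<^bsub>T.Q\<^esub> qsym_act lam g (qproj y (inv g \<otimes> k)) = S +>\<^bsub>T\<^esub> ?z g" if g: "g \<in> carrier G" for g
        using xc[OF g] yc[OF g] y g k T.quot_mult[OF xc[OF g] yc[OF g]]
        by (simp add: qproj_def act_coset skew_carrier free_alg_sel)
      then have "finsum T.Q (\<lambda>g. qproj x g \<otimes>\<^bsub>T.Q\<^esub> qsym_act lam g (qproj y (inv g \<otimes> k))) (carrier G) =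
          finsum T.Q (\<lambda>g. S +>\<^bsub>T\<^esub> ?z g) (carrier G)"
        using zc by (intro Q.finsum_cong') (auto simp: T.quot_carrier)
      then have "(qproj x \<otimes>\<^bsub>QS\<^esub> qproj y) k = finsum T.Q (\<lambda>g. S +>\<^bsub>T\<^esub> ?z g) (carrier G)"
        using k by (simp add: qsym_skew_def skew_alg_def qsym_eq)
      also have "\<dots> = S +>\<^bsub>T\<^esub> sum ?z (carrier G)"
        by (rule T.quot_finsum[OF fin zc])
      also have "\<dots> = qproj (x \<star> y) k"
        using k x y by (simp add: skew_mult_eq skew_mult_def qproj_def)
      finally show ?thesis by simp
    next
      case False
      then show ?thesis using x y
        by (simp add: skew_mult_eq skew_mult_def qproj_def qsym_skew_def skew_alg_def qsym_eq T.quot_zero T.coset_zero)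
    qed
  qed
qed (auto simp: qsym_skew_def skew_alg_def qsym_eq qproj_def skew_sel T.quot_one T.quot_zero T.coset_zero free_alg_sel fun_eq_iff)

lemma qproj_smult:
  assumes x: "x \<in> carrier B" shows "qproj (c \<bullet> x) = c \<odot>\<^bsub>QS\<^esub> qproj x"
proof
  fix g
  have "x g \<in> carrier T" using x by (cases "g \<in> carrier G") (auto simp: skew_carrier)
  then show "qproj (c \<bullet> x) g = (c \<odot>\<^bsub>QS\<^esub> qproj x) g"
    using T.quot_smult[of "x g" c]
    by (simp add: qsym_skew_def skew_alg_def qsym_eq qproj_def skew_sel free_alg_sel)
qed

lemma qproj_image:
  assumes D: "D \<subseteq> carrier T"
  shows "qproj ` skew_part G T D = skew_part G T.Q ((\<lambda>p. S +>\<^bsub>T\<^esub> p) ` D)"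
proof
  show "qproj ` skew_part G T D \<subseteq> skew_part G T.Q ((\<lambda>p. S +>\<^bsub>T\<^esub> p) ` D)"
    by (auto simp: skew_part_def qproj_def T.quot_zero T.zero_eq T.coset_zero)
  show "skew_part G T.Q ((\<lambda>p. S +>\<^bsub>T\<^esub> p) ` D) \<subseteq> qproj ` skew_part G T D"
  proof
    fix y assume y: "y \<in> skew_part G T.Q ((\<lambda>p. S +>\<^bsub>T\<^esub> p) ` D)"
    then have "\<forall>g\<in>carrier G. \<exists>p\<in>D. y g = S +>\<^bsub>T\<^esub> p" by (force simp: skew_part_def)
    then obtain p where p: "\<And>g. g \<in> carrier G \<Longrightarrow> p g \<in> D \<and> y g = S +>\<^bsub>T\<^esub> p g" by metis
    let ?x = "\<lambda>g. if g \<in> carrier G then p g else 0"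
    have "y = qproj ?x"
      using y p by (auto simp: qproj_def fun_eq_iff skew_part_def T.coset_zero T.quot_zero)
    moreover have "?x \<in> skew_part G T D" using p by (auto simp: skew_part_def T.zero_eq)
    ultimately show "y \<in> qproj ` skew_part G T D" by blast
  qed
qed

lemma qproj_surj: "qproj ` carrier B = carrier QS"
proof -
  have "carrier B = skew_part G T (carrier T)" by (simp add: tensor_skew_def skew_alg_def)
  moreover have "carrier QS = skew_part G T.Q ((\<lambda>p. S +>\<^bsub>T\<^esub> p) ` carrier T)"
    by (simp add: qsym_carrier_sel T.quot_carrier)
  ultimately show ?thesis using qproj_image[of "carrier T"] by simp
qed

lemma qproj_homog: "qproj ` B.homog d = qsym_skew_degree G n q d"
  unfolding homog_eq qsym_skew_degree_def qsym_eq by (rule qproj_image) (auto simp: free_degree_def)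

lemma qproj_eq_iff: "qproj x = qproj y \<longleftrightarrow> (\<forall>g. x g - y g \<in> S)"
  by (simp add: qproj_def fun_eq_iff T.coset_eq_iff)

lemma leading_zero_iff:
  assumes "x \<in> carrier B"
  shows "H.leading x = H.leading 0 \<longleftrightarrow> (\<forall>d. \<exists>f\<in>B.below d. comp d x - f \<in> H)"
  using H.leading_eq_iff[OF assms B.zero_carr] by simp

text \<open>
  The relation \<open>v\<^sub>i v\<^sub>j - q i j * v\<^sub>j v\<^sub>i\<close> agrees in the Hecke algebra with \<open>\<kappa>(v\<^sub>i, v\<^sub>j)\<close>, which has degree 0,
  whereas it is homogeneous of degree 2. So its symbol vanishes whatever \<open>\<kappa>\<close> is.
\<close>
lemma incl_sgen_leading:
  assumes "i \<in> X" "j \<in> X" shows "H.leading (incl (sgen i j)) = H.leading 0"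
proof -
  have c: "incl (sgen i j) \<in> carrier B" using sgen_carrier[OF assms] by (rule incl_carrier)
  let ?k = "\<Sum>h\<in>carrier G. \<kappa> i j h \<bullet> bas [] h"
  have 1: "hgen i j = incl (sgen i j) - ?k"
  proof -
    have "incl (sgen i j) = bas [i, j] \<one> - q i j \<bullet> bas [j, i] \<one>"
      by (auto simp: incl_def sgen_def bas_def skew_sel fun_eq_iff)
    then show ?thesis by (simp add: hgen_def)
  qed
  have 2: "comp d (incl (sgen i j)) = (if d = 2 then incl (sgen i j) else 0)" for d
    by (auto simp: comp_def incl_def sgen_def word_def fun_eq_iff)
  have "?k \<in> B.below 2"
  proof (intro B.below_sum B.below_smult)
    fix h assume "h \<in> carrier G"
    moreover have "comp e (bas [] h) = 0" if "e \<ge> 2" for e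
      using that by (simp add: comp_def bas_def word_def fun_eq_iff)
    ultimately show "bas [] h \<in> B.below 2" by (simp add: B.below_def)
  qed
  moreover have "incl (sgen i j) - ?k \<in> H" using hgen_in_ideal[OF assms] 1 by simp
  ultimately have "\<exists>f\<in>B.below d. comp d (incl (sgen i j)) - f \<in> H" for d
    unfolding 2 by (cases "d = 2") (auto intro: bexI[of _ 0])
  then show ?thesis by (simp add: leading_zero_iff[OF c])
qed

text \<open>
  The elements of \<open>T(V)\<close> with vanishing leading symbols form an ideal. It contains the generators
  of the quantum symmetric ideal, hence all of it, and right multiplication by group elements does
  the rest.
\<close>
theorem ker_qproj_le:
  assumes x: "x \<in> carrier B" and S: "\<And>g. x g \<in> S"
  shows "H.leading x = H.leading 0"
proof -
  let ?L = "{x \<in> carrier B. H.leading x = H.leading 0}"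
  interpret L: alg_ideal B ?L
    by (intro alg_ideal.intro skew_concrete H.leading_zero_ideal)
  have hom: "ring_hom_ring T B incl"
    by (rule ring_hom_ringI2[OF T.ring_axioms B.ring_axioms incl_hom])
  have "sgen i j \<in> {r \<in> carrier T. incl r \<in> ?L}" if "i \<in> X" "j \<in> X" for i j
    by (intro CollectI conjI sgen_carrier incl_sgen_leading incl_carrier that)
  then have "{sgen i j | i j. i \<in> X \<and> j \<in> X} \<subseteq> {r \<in> carrier T. incl r \<in> ?L}"
    by blast
  then have "S \<subseteq> {r \<in> carrier T. incl r \<in> ?L}"
    unfolding qsym_ideal_eq
    by (rule T.genideal_minimal[OF ring_hom_ring.ideal_vimage[OF hom H.leading_zero_ideal]])
  then have "incl (x g) \<star> bas [] g \<in> ?L" if "g \<in> carrier G" for g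
  proof (intro L.I_r_closed)
    show "incl (x g) \<in> ?L" using \<open>S \<subseteq> _\<close> S[of g] by blast
    show "bas [] g \<in> carrier B" using that by (intro bas_carrier) simp_all
  qed
  then have "(\<Sum>g\<in>carrier G. incl (x g) \<star> bas [] g) \<in> ?L" by (rule L.I_sum)
  then have "x \<in> ?L" unfolding group_decomposition[OF x, symmetric] .
  then show ?thesis by blast
qed

end

section \<open>Sufficiency of the two conditions\<close>

context quantum_relations
begin

text \<open>
  The linear extension of the normal form to \<open>T(V) \<rtimes> G\<close>, compatible with right multiplication by \<open>G\<close>.
\<close>

definition NF :: "('g \<Rightarrow> nat list \<Rightarrow> complex) \<Rightarrow> 'g \<Rightarrow> nat list \<Rightarrow> complex" where
  "NF x k v = (\<Sum>g\<in>carrier G. \<Sum>u | x g u \<noteq> 0. x g u * nf u (k \<otimes> inv g) v)"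

definition words_of :: "('g \<Rightarrow> nat list \<Rightarrow> complex) \<Rightarrow> nat list set" where
  "words_of x = (\<Union>g\<in>carrier G. {u. x g u \<noteq> 0})"

lemma words_of_finite: "x \<in> carrier B \<Longrightarrow> finite (words_of x)"
  using fin by (auto simp: words_of_def skew_carrier free_carrier)

lemma words_of_X: "x \<in> carrier B \<Longrightarrow> u \<in> words_of x \<Longrightarrow> set u \<subseteq> X"
  by (auto simp: words_of_def skew_carrier free_carrier)

lemma NF_superset:
  assumes "finite U" "words_of x \<subseteq> U"
  shows "NF x k v = (\<Sum>g\<in>carrier G. \<Sum>u\<in>U. x g u * nf u (k \<otimes> inv g) v)"
  unfolding NF_def using assms
  by (intro sum.cong refl sum.mono_neutral_left) (auto simp: words_of_def)

lemma NF_add: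
  assumes "x \<in> carrier B" "y \<in> carrier B"
  shows "NF (x + y) k v = NF x k v + NF y k v"
proof -
  let ?U = "words_of x \<union> words_of y"
  have U: "finite ?U" using assms words_of_finite by simp
  have "words_of (x + y) \<subseteq> ?U" by (auto simp: words_of_def)
  then show ?thesis
    by (simp add: NF_superset[OF U, of x] NF_superset[OF U, of y] NF_superset[OF U, of "x + y"]
        distrib_right sum.distrib)
qed

lemma NF_smult:
  assumes "x \<in> carrier B"
  shows "NF (c \<bullet> x) k v = c * NF x k v"
proof -
  have U: "finite (words_of x)" using assms words_of_finite by simp
  have "words_of (c \<bullet> x) \<subseteq> words_of x" by (auto simp: words_of_def skew_sel)
  then have "NF (c \<bullet> x) k v =
      (\<Sum>g\<in>carrier G. \<Sum>u\<in>words_of x. (c \<bullet> x) g u * nf u (k \<otimes> inv g) v)"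
    by (rule NF_superset[OF U])
  also have "\<dots> = c * NF x k v"
    unfolding NF_superset[OF U order_refl] by (simp add: skew_sel mult.assoc sum_distrib_left)
  finally show ?thesis .
qed

lemma NF_zero: "NF 0 k v = 0"
  by (simp add: NF_def)

lemma NF_diff:
  assumes "x \<in> carrier B" "y \<in> carrier B"
  shows "NF (x - y) k v = NF x k v - NF y k v"
  using NF_add[of "x - y" y k v] assms by (simp del: fun_diff_def minus_apply)

lemma NF_sum:
  assumes "\<And>i. i \<in> I \<Longrightarrow> f i \<in> carrier B"
  shows "NF (sum f I) k v = (\<Sum>i\<in>I. NF (f i) k v)"
  using assms
proof (induction I rule: infinite_finite_induct)
  case (insert i I)
  then show ?case by (simp only: sum.insert not_False_eq_True NF_add B.sum_carr insertI1 insertI2)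
qed (simp_all only: sum.infinite sum.empty NF_zero not_False_eq_True)

lemma NF_bas:
  assumes g: "g \<in> carrier G"
  shows "NF (bas u g) k v = nf u (k \<otimes> inv g) v"
proof -
  have "words_of (bas u g) \<subseteq> {u}" by (auto simp: words_of_def bas_def word_def split: if_splits)
  then have "NF (bas u g) k v = (\<Sum>h\<in>carrier G. if h = g then nf u (k \<otimes> inv g) v else 0)"
    by (auto simp: NF_superset[of "{u}"] bas_def word_def intro!: sum.cong)
  then show ?thesis using fin g by simp
qed

lemma nf_long: "length u < length v \<Longrightarrow> nf u k v = 0"
proof (induction u arbitrary: k rule: wf_induct[OF wf_lenlex[OF wf_less_than]])
  case (1 u)
  show ?case
  proof (cases "\<exists>p. descent u p")
    case True
    then obtain a i j b where u: "u = a @ i # j # b" "j < i" "nf u = reduct a i j b"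
      by (metis nf_descent)
    have "nf (a @ j # i # b) k v = 0" for k
      using 1 swap_less[OF u(2)] u(1) by fastforce
    moreover have "nf (a @ b) k v = 0" for k
      using 1 delete_less u(1) by fastforce
    ultimately show ?thesis by (simp add: u(3) reduct_def)
  next
    case False
    then show ?thesis using 1 by (auto simp: nf_irreducible)
  qed
qed

lemma word_swap_in_ideal:
  assumes "set (a @ i # j # b) \<subseteq> X"
  shows "word (a @ i # j # b) - q i j \<odot>\<^bsub>T\<^esub> word (a @ j # i # b) \<in> S"
proof -
  have ij: "i \<in> X" "j \<in> X" "set a \<subseteq> X" "set b \<subseteq> X" using assms by auto
  have "conv (conv (word a) (sgen i j)) (word b) \<in> S"
    using T.I_r_closed[OF T.I_l_closed[OF sgen_in_ideal]] ij by (simp add: free_alg_sel(1) word_carrier)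
  moreover have diff: "conv (p - r) s = conv p s - conv r s" "conv p (r - s) = conv p r - conv p s" for p r s :: "nat list \<Rightarrow> complex"
    by (auto simp: conv_def fun_eq_iff sum_subtractf algebra_simps)
  ultimately show ?thesis
    by (simp add: sgen_def diff conv_word conv_scale free_alg_sel)
qed

text \<open>
  In top degree the group elements never appear, and straightening only collects a factor \<open>c\<close> from
  the scalars \<open>q i j\<close>. The same factor relates the word to its sorted version modulo the quantum
  symmetric ideal. Both facts come from the same induction, which is why they are proved
  together: it guarantees that the factor is the same.
\<close>
lemma nf_top:
  assumes "set u \<subseteq> X"
  shows "\<exists>c. word u - c \<odot>\<^bsub>T\<^esub> word (sort u) \<in> S \<and>
    (\<forall>k\<in>carrier G. \<forall>v. length v = length u \<longrightarrow> nf u k v = (if k = \<one> \<and> v = sort u then c else 0))"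
  using assms
proof (induction u rule: wf_induct[OF wf_lenlex[OF wf_less_than]])
  case (1 u)
  show ?case
  proof (cases "\<exists>p. descent u p")
    case True
    then obtain a i j b where u: "u = a @ i # j # b" "j < i" "nf u = reduct a i j b"
      by (metis nf_descent)
    let ?u = "a @ j # i # b"
    have X: "set ?u \<subseteq> X" using 1 u by auto
    have "(?u, u) \<in> lenlex less_than" using swap_less[OF u(2)] u(1) by simp
    then obtain c where c: "word ?u - c \<odot>\<^bsub>T\<^esub> word (sort ?u) \<in> S"
      "\<And>k v. k \<in> carrier G \<Longrightarrow> length v = length ?u \<Longrightarrow> nf ?u k v = (if k = \<one> \<and> v = sort ?u then c else 0)"
      using 1(1)[rule_format, of ?u] X by blast
    have sort: "sort ?u = sort u" unfolding u(1) by (induction a) (simp_all add: insort_left_comm)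
    have "word u - (q i j * c) \<odot>\<^bsub>T\<^esub> word (sort u) \<in> S"
    proof -
      have "(word u - q i j \<odot>\<^bsub>T\<^esub> word ?u) + q i j \<odot>\<^bsub>T\<^esub> (word ?u - c \<odot>\<^bsub>T\<^esub> word (sort u)) \<in> S"
        using word_swap_in_ideal[of a i j b] 1(2) u(1) c(1) sort by (intro T.I_add T.I_smult) auto
      also have "(word u - q i j \<odot>\<^bsub>T\<^esub> word ?u) + q i j \<odot>\<^bsub>T\<^esub> (word ?u - c \<odot>\<^bsub>T\<^esub> word (sort u)) =
          word u - (q i j * c) \<odot>\<^bsub>T\<^esub> word (sort u)"
        by (auto simp: free_alg_sel fun_eq_iff algebra_simps)
      finally show ?thesis .
    qed
    moreover have "nf u k v = (if k = \<one> \<and> v = sort u then q i j * c else 0)"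
      if "k \<in> carrier G" "length v = length u" for k v
    proof -
      have len: "length v = Suc (Suc (length a + length b))" using that(2) u(1) by simp
      then have "nf u k v = q i j * nf ?u k v" by (simp add: u(3) reduct_def nf_long)
      then show ?thesis using c(2)[of k v] that(1) len sort by simp
    qed
    ultimately show ?thesis by blast
  next
    case False
    then have s: "sort u = u" using no_descent_sorted by (auto intro: sorted_sort_id)
    have "word u - 1 \<odot>\<^bsub>T\<^esub> word u = 0" by (simp add: free_alg_sel)
    then have "word u - 1 \<odot>\<^bsub>T\<^esub> word (sort u) \<in> S" by (simp only: s T.I_zero)
    moreover have "nf u k v = (if k = \<one> \<and> v = sort u then 1 else 0)" for k v
      using nf_irreducible[OF False] s by simp
    ultimately show ?thesis by blast
  qed
qed

end

context pbw_relations
begin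

text \<open>
  Multiplying a relation by monomials on both sides and moving the group elements to the right
  gives, by equivariance, a multiple of the relation between two neighbouring words. Reindexing by
  conjugation with \<open>g\<close> turns \<open>\<kappa> i j t * g t h\<close> into \<open>lam g i * lam g j * \<kappa> i j s * s g h\<close>.
\<close>
lemma NF_hgen:
  assumes u: "set u \<subseteq> X" and w: "set w \<subseteq> X" and g: "g \<in> carrier G" and h: "h \<in> carrier G"
    and i: "i \<in> X" and j: "j \<in> X" and k: "k \<in> carrier G"
  shows "NF (bas u g \<star> hgen i j \<star> bas w h) k v = 0"
proof -
  let ?C = "carrier G"
  let ?x = "k \<otimes> inv (g \<otimes> h)"
  have triple: "NF (bas u g \<star> bas z t \<star> bas w h) k v =
      lamw g z * lamw (g \<otimes> t) w * nf (u @ z @ w) (k \<otimes> inv (g \<otimes> t \<otimes> h)) v"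
    if "set z \<subseteq> X" "t \<in> ?C" for z t
    using that u w g h by (simp add: mult_bas B.smult_mult NF_smult NF_bas)
  have c: "bas [i, j] \<one> \<in> carrier B" "bas [j, i] \<one> \<in> carrier B" "\<And>t. t \<in> ?C \<Longrightarrow> bas [] t \<in> carrier B"
    "bas u g \<in> carrier B" "bas w h \<in> carrier B"
    using i j u w g h by (auto intro!: bas_carrier)
  have split: "NF (bas u g \<star> (x + y) \<star> bas w h) k v =
      NF (bas u g \<star> x \<star> bas w h) k v + NF (bas u g \<star> y \<star> bas w h) k v"
    if "x \<in> carrier B" "y \<in> carrier B" for x y
    using that c by (simp add: B.mult_add_left B.mult_add_right NF_add)
  have scale: "NF (bas u g \<star> (a \<bullet> x) \<star> bas w h) k v = a * NF (bas u g \<star> x \<star> bas w h) k v"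
    if "x \<in> carrier B" for x a
    using that c by (simp add: mult_smult_right B.smult_mult NF_smult)
  have h_eq: "hgen i j = bas [i, j] \<one> + (- q i j) \<bullet> bas [j, i] \<one> +
      (-1) \<bullet> (\<Sum>t\<in>?C. \<kappa> i j t \<bullet> bas [] t)"
    by (auto simp: hgen_def skew_sel fun_eq_iff)
  have sc: "(\<Sum>t\<in>?C. \<kappa> i j t \<bullet> bas [] t) \<in> carrier B" using c by (intro B.sum_carr B.smult_closed)
  have "NF (bas u g \<star> (\<Sum>t\<in>?C. \<kappa> i j t \<bullet> bas [] t) \<star> bas w h) k v =
      (\<Sum>t\<in>?C. \<kappa> i j t * NF (bas u g \<star> bas [] t \<star> bas w h) k v)"
    using c by (simp add: mult_sum_right mult_sum_left NF_sum scale)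
  also have "\<dots> = (\<Sum>t\<in>?C. \<kappa> i j t * lamw (g \<otimes> t) w * nf (u @ w) (k \<otimes> inv (g \<otimes> t \<otimes> h)) v)"
    by (simp add: triple mult.assoc cong: sum.cong)
  also have "\<dots> = (\<Sum>s\<in>?C. lamw g (i # j # w) * (\<kappa> i j s * lamw s w * nf (u @ w) (?x \<otimes> inv s) v))"
  proof (rule sum.reindex_bij_witness[of _ "\<lambda>s. inv g \<otimes> s \<otimes> g" "\<lambda>t. g \<otimes> t \<otimes> inv g"])
    fix t assume t: "t \<in> ?C"
    let ?s = "g \<otimes> t \<otimes> inv g"
    have s: "?s \<in> ?C" using g t by simp
    have ts: "inv g \<otimes> ?s \<otimes> g = t"
      using g t by (simp add: m_assoc) (simp flip: m_assoc)
    then show "inv g \<otimes> ?s \<otimes> g = t" .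
    have "lamw ?s w = lamw t w" using g t w by (rule lamw_conj)
    moreover have "\<kappa> i j t = lam g i * lam g j * \<kappa> i j ?s"
      using equivariant[OF i j g s] ts by simp
    moreover have "?x \<otimes> inv ?s = k \<otimes> inv (g \<otimes> t \<otimes> h)"
    proof -
      have "?s \<otimes> (g \<otimes> h) = g \<otimes> t \<otimes> h"
        using g t h by (simp add: m_assoc) (simp flip: m_assoc)
      then have "inv (g \<otimes> t \<otimes> h) = inv (g \<otimes> h) \<otimes> inv ?s"
        using g h s by (simp add: inv_mult_group[symmetric])
      then show ?thesis using k g h t s by (simp add: m_assoc)
    qed
    ultimately show "lamw g (i # j # w) * (\<kappa> i j ?s * lamw ?s w * nf (u @ w) (?x \<otimes> inv ?s) v) =
      \<kappa> i j t * lamw (g \<otimes> t) w * nf (u @ w) (k \<otimes> inv (g \<otimes> t \<otimes> h)) v"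
      using lamw_mult[OF g t w] by simp
  next
    fix s assume s: "s \<in> ?C"
    show "g \<otimes> (inv g \<otimes> s \<otimes> g) \<otimes> inv g = s"
      using g s by (simp add: m_assoc) (simp flip: m_assoc)
  qed (use g in simp_all)
  finally have s: "NF (bas u g \<star> (\<Sum>t\<in>?C. \<kappa> i j t \<bullet> bas [] t) \<star> bas w h) k v =
    lamw g (i # j # w) * (\<Sum>s\<in>?C. \<kappa> i j s * lamw s w * nf (u @ w) (?x \<otimes> inv s) v)"
    by (simp add: sum_distrib_left)
  have "NF (bas u g \<star> hgen i j \<star> bas w h) k v =
    lamw g (i # j # w) * nf (u @ i # j # w) ?x v - q i j * (lamw g (i # j # w) * nf (u @ j # i # w) ?x v)
    - lamw g (i # j # w) * (\<Sum>s\<in>?C. \<kappa> i j s * lamw s w * nf (u @ w) (?x \<otimes> inv s) v)"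
    unfolding h_eq using c sc i j g by (simp add: split scale triple s mult_ac)
  also have "\<dots> = lamw g (i # j # w) * (nf (u @ i # j # w) ?x v - reduct u i j w ?x v)"
    by (simp add: reduct_def algebra_simps)
  also have "nf (u @ i # j # w) ?x v = reduct u i j w ?x v"
    using u w i j k g h by (intro nf_relation) auto
  finally show ?thesis by simp
qed

theorem NF_ideal:
  assumes "x \<in> H" "k \<in> carrier G"
  shows "NF x k v = 0"
proof -
  \<comment> \<open>The kernel of \<open>NF\<close> is not evidently an ideal, but the largest ideal inside it is this set.\<close>
  let ?J = "{x \<in> carrier B. \<forall>y\<in>carrier B. \<forall>z\<in>carrier B. \<forall>k\<in>carrier G. \<forall>v. NF (y \<star> x \<star> z) k v = 0}"
  have gen: "NF (y \<star> hgen i j \<star> z) k v = 0"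
    if y: "y \<in> carrier B" and z: "z \<in> carrier B" and ij: "i \<in> X" "j \<in> X" and k: "k \<in> carrier G" for y z i j k v
    using z
  proof (induction z rule: skew_induct)
    case zero
    show ?case using y hgen_carrier[OF ij] by (simp only: B.mult_zero_right B.m_closed NF_zero)
  next
    case (bas c w h)
    have "NF (y \<star> hgen i j \<star> bas w h) k v = 0"
      using y
    proof (induction y rule: skew_induct)
      case zero
      show ?case using bas hgen_carrier[OF ij]
        by (simp only: B.mult_zero_left bas_carrier NF_zero)
    next
      case (bas c u g)
      then show ?case using \<open>set w \<subseteq> X\<close> \<open>h \<in> carrier G\<close> hgen_carrier[OF ij] NF_hgen[of u w g h i j k v] ij k
        by (simp add: B.smult_mult NF_smult)
    next
      case (add x y)
      then show ?case using bas hgen_carrier[OF ij]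
        by (simp only: B.mult_add_left B.m_closed bas_carrier NF_add add_0_right)
    qed
    then show ?case using bas y hgen_carrier[OF ij] by (simp add: mult_smult_right NF_smult)
  next
    case (add x z)
    then show ?case using y hgen_carrier[OF ij]
      by (simp only: B.mult_add_right B.m_closed NF_add add_0_right)
  qed
  have "ideal ?J B"
  proof (rule idealI)
    show "ring B" by (rule B.ring_axioms)
    show "subgroup ?J (add_monoid B)"
    proof (rule subgroup.intro)
      fix x assume x: "x \<in> ?J"
      have "inv\<^bsub>add_monoid B\<^esub> x = (-1) \<bullet> x"
        using B.a_inv_eq[of x] x by (simp add: a_inv_def skew_sel fun_eq_iff)
      moreover have "(-1) \<bullet> x \<in> ?J"
        using x by (simp add: mult_smult_right B.smult_mult NF_smult)
      ultimately show "inv\<^bsub>add_monoid B\<^esub> x \<in> ?J" by simp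
    qed (auto simp: skew_sel(1,2) B.mult_add_left B.mult_add_right NF_add NF_zero simp del: plus_fun_apply)
    fix a x assume "a \<in> ?J" "x \<in> carrier B"
    then show "x \<star> a \<in> ?J" by (simp add: B.m_assoc[symmetric])
    have "y \<star> (a \<star> x) \<star> z = y \<star> a \<star> (x \<star> z)"
      if "y \<in> carrier B" "z \<in> carrier B" for y z
      using that \<open>a \<in> ?J\<close> \<open>x \<in> carrier B\<close> by (simp add: B.m_assoc)
    then show "a \<star> x \<in> ?J" using \<open>a \<in> ?J\<close> \<open>x \<in> carrier B\<close> by simp
  qed
  then have "H \<subseteq> ?J"
    unfolding hecke_ideal_eq using gen hgen_carrier by (intro B.genideal_minimal) auto
  then have x: "x \<in> ?J" using assms(1) by blast
  then have "NF (\<one>\<^bsub>B\<^esub> \<star> x \<star> \<one>\<^bsub>B\<^esub>) k v = 0" using assms(2) by blast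
  then show ?thesis using x by simp
qed

text \<open>
  Suppose that the component \<open>z\<close> of degree \<open>d\<close> equals an element \<open>f\<close> of lower degree modulo the Hecke
  ideal. Then \<open>NF z = NF f\<close>, and \<open>NF f\<close> has no coefficients at words of length \<open>d\<close>. By \<open>nf_top\<close> the
  coefficients of \<open>NF z\<close> at these words are those of the normal form of \<open>z\<close> in the quantum symmetric
  algebra, so this normal form vanishes and \<open>z\<close> lies in the quantum symmetric ideal.
\<close>
theorem ker_leading_le:
  assumes x: "x \<in> carrier B" and 0: "H.leading x = H.leading 0"
  shows "x g \<in> S"
proof -
  obtain c where c: "\<And>u. set u \<subseteq> X \<Longrightarrow> word u - c u \<odot>\<^bsub>T\<^esub> word (sort u) \<in> S"
    "\<And>u k v. set u \<subseteq> X \<Longrightarrow> k \<in> carrier G \<Longrightarrow> length v = length u \<Longrightarrow>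
       nf u k v = (if k = \<one> \<and> v = sort u then c u else 0)"
    using nf_top by metis
  have comp: "comp d x k \<in> S" if k: "k \<in> carrier G" for d k
  proof -
    let ?z = "comp d x"
    obtain f where f: "f \<in> B.below d" "?z - f \<in> H" using 0 leading_zero_iff[OF x] by blast
    have zc: "?z \<in> carrier B" by (rule comp_carrier[OF x])
    have fc: "f \<in> carrier B" using f(1) by (rule B.below_carr)
    let ?U = "words_of ?z"
    have U: "set u \<subseteq> X" "length u = d" if "u \<in> ?U" for u
      using that words_of_X[OF zc that] by (auto simp: words_of_def comp_def split: if_splits)
    have fU: "finite ?U" using zc by (rule words_of_finite)
    have NF0: "NF ?z k v = 0" if "length v = d" for v
    proof -
      have "f g u = 0" if "length u \<ge> d" for g u
        using f(1) that by (simp add: B.below_def comp_zero_iff)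
      then have "length u < d" if "f g u \<noteq> 0" for g u using that not_less by blast
      then have 0: "f g u * nf u (k \<otimes> inv g) v = 0" for g u
        using \<open>length v = d\<close> nf_long[of u v] by (cases "f g u = 0") auto
      have "NF f k v = 0" unfolding NF_def 0 by simp
      then show ?thesis using NF_ideal[OF f(2) k, of v] NF_diff[OF zc fc] by simp
    qed
    have top: "NF ?z k v = (\<Sum>u\<in>?U. ?z k u * (if v = sort u then c u else 0))" if "length v = d" for v
    proof -
      have "NF ?z k v = (\<Sum>g\<in>carrier G. \<Sum>u\<in>?U. ?z g u * nf u (k \<otimes> inv g) v)"
        using fU by (rule NF_superset) simp
      also have "\<dots> = (\<Sum>g\<in>carrier G. if g = k then (\<Sum>u\<in>?U. ?z k u * (if v = sort u then c u else 0)) else 0)"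
      proof (rule sum.cong[OF refl])
        fix g assume g: "g \<in> carrier G"
        have "k \<otimes> inv g = \<one> \<longleftrightarrow> g = k" using inv_solve_right[of \<one> k g] g k by auto
        then show "(\<Sum>u\<in>?U. ?z g u * nf u (k \<otimes> inv g) v) =
          (if g = k then (\<Sum>u\<in>?U. ?z k u * (if v = sort u then c u else 0)) else 0)"
          using g k U that by (auto simp: c(2) intro!: sum.cong)
      qed
      also have "\<dots> = (\<Sum>u\<in>?U. ?z k u * (if v = sort u then c u else 0))" using fin k by simp
      finally show ?thesis .
    qed
    \<comment> \<open>The normal form of \<open>?z k\<close> in the quantum symmetric algebra.\<close>
    let ?s = "\<Sum>u\<in>?U. ?z k u \<odot>\<^bsub>T\<^esub> (c u \<odot>\<^bsub>T\<^esub> word (sort u))"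
    have "?s v = 0" for v
    proof (cases "length v = d")
      case True
      have "?s v = (\<Sum>u\<in>?U. ?z k u * (if v = sort u then c u else 0))"
        by (auto simp: sum_fun_apply free_alg_sel word_def intro!: sum.cong)
      then show ?thesis using top[OF True] NF0[OF True] by simp
    next
      case False
      then have "v \<noteq> sort u" if "u \<in> ?U" for u using U[OF that] by auto
      then show ?thesis by (simp add: sum_fun_apply free_alg_sel word_def)
    qed
    then have "?s = 0" by auto
    moreover have "?z k = (\<Sum>u\<in>?U. ?z k u \<odot>\<^bsub>T\<^esub> word u)"
    proof
      fix w
      have "(\<Sum>u\<in>?U. ?z k u \<odot>\<^bsub>T\<^esub> word u) w = (\<Sum>u\<in>?U. if u = w then ?z k w else 0)"
        by (auto simp: sum_fun_apply free_alg_sel word_def intro!: sum.cong)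
      also have "\<dots> = ?z k w" using fU k by (auto simp: words_of_def)
      finally show "?z k w = (\<Sum>u\<in>?U. ?z k u \<odot>\<^bsub>T\<^esub> word u) w" by simp
    qed
    ultimately have "?z k = (\<Sum>u\<in>?U. ?z k u \<odot>\<^bsub>T\<^esub> word u) - ?s" by simp
    also have "\<dots> = (\<Sum>u\<in>?U. ?z k u \<odot>\<^bsub>T\<^esub> (word u - c u \<odot>\<^bsub>T\<^esub> word (sort u)))"
      by (auto simp: fun_eq_iff sum_fun_apply free_alg_sel sum_subtractf algebra_simps)
    finally have "?z k = (\<Sum>u\<in>?U. ?z k u \<odot>\<^bsub>T\<^esub> (word u - c u \<odot>\<^bsub>T\<^esub> word (sort u)))" .
    moreover have "(\<Sum>u\<in>?U. ?z k u \<odot>\<^bsub>T\<^esub> (word u - c u \<odot>\<^bsub>T\<^esub> word (sort u))) \<in> S"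
      using U c(1) by (intro T.I_sum T.I_smult) auto
    ultimately show ?thesis by simp
  qed
  show ?thesis
  proof (cases "g \<in> carrier G")
    case True
    have "x g = (\<Sum>d | comp d x \<noteq> 0. comp d x) g" using B.comp_sum[OF x] by simp
    also have "\<dots> = (\<Sum>d | comp d x \<noteq> 0. comp d x g)" by (rule sum_fun_apply)
    finally have "x g = (\<Sum>d | comp d x \<noteq> 0. comp d x g)" .
    then show ?thesis using comp[OF True] by (simp add: T.I_sum)
  next
    case False
    then show ?thesis using x by (simp add: skew_carrier)
  qed
qed

theorem pbw_property: "quantum_drinfeld_hecke G n lam q \<kappa>"
proof -
  have ker: "H.leading x = H.leading y \<longleftrightarrow> qproj x = qproj y" if "x \<in> carrier B" "y \<in> carrier B" for x y
  proof -
    have xy: "x - y \<in> carrier B" using that by (rule B.minus_carr)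
    have "H.leading x = H.leading y \<longleftrightarrow> H.leading (x - y) = H.leading 0"
      using that xy by (simp add: H.leading_eq_iff leading_zero_iff)
    also have "\<dots> \<longleftrightarrow> (\<forall>g. (x - y) g \<in> S)" using ker_leading_le[OF xy] ker_qproj_le[OF xy] by blast
    finally show ?thesis by (simp add: qproj_eq_iff)
  qed
  obtain \<phi> where iso: "\<phi> \<in> ring_iso H.gr QS" and \<phi>: "\<And>x. x \<in> carrier B \<Longrightarrow> \<phi> (H.leading x) = qproj x"
    using common_quotient_iso[OF H.leading_hom H.leading_surj qproj_hom qproj_surj ker B.ring_axioms] by metis
  have "\<phi> (c \<odot>\<^bsub>H.gr\<^esub> y) = c \<odot>\<^bsub>QS\<^esub> \<phi> y" if y: "y \<in> carrier H.gr" for c y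
  proof -
    obtain x where x: "x \<in> carrier B" "y = H.leading x" using y H.leading_surj by blast
    then show ?thesis
      using \<phi>[of "c \<bullet> x"] \<phi>[OF x(1)] by (simp add: H.leading_smult[symmetric] qproj_smult)
  qed
  moreover have "\<phi> ` gr_degree H.Q H.F d = qsym_skew_degree G n q d" for d
  proof -
    have "\<phi> ` H.leading ` B.homog d = qproj ` B.homog d"
      unfolding image_image by (rule image_cong) (auto simp: \<phi> B.homog_def)
    then show ?thesis by (simp add: H.leading_homog qproj_homog)
  qed
  ultimately show ?thesis
    using iso unfolding quantum_drinfeld_hecke_def Let_def graded_alg_iso_def hecke_alg_eq filtration_eq
    by blast
qed

end

section \<open>Necessity of the two conditions\<close>

text \<open>
  Only on \<open>V\<close> is \<open>f\<close> known to be linear.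
  If \<open>f x = 0\<close> with \<open>x \<noteq> 0\<close>, extend \<open>x\<close> to a basis \<open>C\<close>; then \<open>V\<close> is spanned by the images of \<open>C - {x}\<close>,
  which are too few.
\<close>
lemma (in vector_space) surj_on_finite_span_imp_inj:
  assumes fin: "finite E" and V: "span E = V"
    and add: "\<And>x y. x \<in> V \<Longrightarrow> y \<in> V \<Longrightarrow> f (x + y) = f x + f y"
    and scale: "\<And>c x. x \<in> V \<Longrightarrow> f (c *s x) = c *s f x"
    and surj: "V \<subseteq> f ` V"
    and x: "x \<in> V" "f x = 0"
  shows "x = 0"
proof (rule ccontr)
  assume "x \<noteq> 0"
  then have "independent {x}" by (simp add: dependent_single)
  then obtain C where C: "{x} \<subseteq> C" "C \<subseteq> V" "independent C" "V \<subseteq> span C"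
    using maximal_independent_subset_extend[of "{x}" V] x by blast
  have sub: "subspace V" using V by (metis subspace_span)
  have finC: "finite C" using independent_span_bound[OF fin C(3)] C(2) V by simp
  have "y \<in> V \<and> f y \<in> span (f ` (C - {x}))" if "y \<in> span C" for y
    using that
  proof (induction rule: span_induct_alt)
    case base
    have "f 0 = 0 *s f 0" using scale[of 0 0] sub by (simp add: subspace_0)
    then show ?case using sub by (simp add: subspace_0 span_zero)
  next
    case (step c b y)
    have b: "b \<in> V" using step(1) C(2) by auto
    have "f b \<in> span (f ` (C - {x}))"
      using step(1) x(2) by (cases "b = x") (auto simp: span_zero intro: span_base)
    then show ?case using step b sub
      by (simp add: add scale subspace_add subspace_scale span_add span_scale)
  qed
  then have "V \<subseteq> span (f ` (C - {x}))" using surj C(4) by blast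
  then have "card C \<le> card (f ` (C - {x}))"
    using independent_span_bound[of "f ` (C - {x})" C] C finC by auto
  also have "\<dots> \<le> card (C - {x})" using finC by (intro card_image_le) auto
  also have "\<dots> < card C" using finC C(1) by (intro psubset_card_mono) auto
  finally show False by simp
qed

lemma skew_vector_space: "vector_space (\<lambda>c x g w. c * x g w :: complex)"
  by unfold_locales (auto simp: fun_eq_iff algebra_simps)

context quantum_relations
begin

text \<open>
  The quantum symmetric relations are quadratic, so they impose nothing in degrees 0 and 1.
\<close>
lemma qsym_ideal_low:
  assumes "p \<in> S" "length w < 2" shows "p w = 0"
proof -
  let ?J = "{p \<in> carrier T. \<forall>w. length w < 2 \<longrightarrow> p w = 0}"
  have conv0: "conv a p w = 0" "conv p a w = 0" if "\<And>w. length w < 2 \<Longrightarrow> p w = 0" "length w < 2" for a p w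
    using that by (auto simp: conv_def intro!: sum.neutral)
  have "ideal ?J T"
  proof (rule idealI)
    show "ring T" by (rule T.ring_axioms)
    show "subgroup ?J (add_monoid T)"
    proof (rule subgroup.intro)
      fix p assume p: "p \<in> ?J"
      then have "inv\<^bsub>add_monoid T\<^esub> p = - p" using T.a_inv_eq[of p] by (simp add: a_inv_def)
      then show "inv\<^bsub>add_monoid T\<^esub> p \<in> ?J" using p T.uminus_carr[of p] by (simp del: T.uminus_carr)
    qed (auto simp: free_alg_sel(2,3) free_add_carrier)
  qed (auto simp: free_alg_sel(1) conv0 conv_carrier)
  moreover have "sgen i j \<in> ?J" if "i \<in> X" "j \<in> X" for i j
    using sgen_carrier[OF that] by (auto simp: sgen_def word_def)
  then have "{sgen i j | i j. i \<in> X \<and> j \<in> X} \<subseteq> ?J" by blast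
  ultimately have "S \<subseteq> ?J" unfolding qsym_ideal_eq by (rule T.genideal_minimal)
  then show ?thesis using assms by blast
qed

lemma qproj_inj_homog:
  assumes "x \<in> B.homog d" "y \<in> B.homog d" "d < 2" "qproj x = qproj y"
  shows "x = y"
proof (intro ext)
  fix g w
  have S: "x g - y g \<in> S" using assms(4) by (simp add: qproj_eq_iff)
  show "x g w = y g w"
  proof (cases "length w = d")
    case True
    then show ?thesis using qsym_ideal_low[OF S, of w] assms(3) by simp
  next
    case False
    then have "x g w = 0" "y g w = 0" using assms(1,2) by (auto simp: homog_iff)
    then show ?thesis by simp
  qed
qed

lemma bas_homog: "set u \<subseteq> X \<Longrightarrow> g \<in> carrier G \<Longrightarrow> bas u g \<in> B.homog (length u)"
  by (simp add: homog_iff bas_carrier) (simp add: bas_def word_def)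

lemma homog_span:
  "module.span (\<lambda>c x g w. c * x g w) {bas u g | u g. set u \<subseteq> X \<and> length u = d \<and> g \<in> carrier G} = B.homog d"
  "finite {bas u g | u g. set u \<subseteq> X \<and> length u = d \<and> g \<in> carrier G}"
proof -
  let ?E = "{bas u g | u g. set u \<subseteq> X \<and> length u = d \<and> g \<in> carrier G}"
  interpret V: vector_space "\<lambda>c (x :: 'g \<Rightarrow> nat list \<Rightarrow> complex) g w. c * x g w" by (rule skew_vector_space)
  have "?E = (\<lambda>(u, g). bas u g) ` ({u. set u \<subseteq> X \<and> length u = d} \<times> carrier G)" by auto
  then show "finite ?E" using fin finite_lists_length_eq[of X d] by simp
  have "V.subspace (B.homog d)"
  proof (rule V.subspaceI)
    show "0 \<in> B.homog d" by (simp add: homog_iff)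
    show "x + y \<in> B.homog d" if "x \<in> B.homog d" "y \<in> B.homog d" for x y
      using that by (auto simp: B.homog_def B.comp_add simp del: plus_fun_apply)
    show "(\<lambda>g w. c * x g w) \<in> B.homog d" if "x \<in> B.homog d" for c x
      using that B.smult_closed[of x c] by (auto simp: homog_iff skew_sel)
  qed
  moreover have "?E \<subseteq> B.homog d"
    using bas_homog by blast
  ultimately have 1: "V.span ?E \<subseteq> B.homog d" by (simp add: V.span_minimal)
  have "x \<in> V.span ?E" if x: "x \<in> B.homog d" for x
  proof -
    have xc: "x \<in> carrier B" using x by (simp add: homog_iff)
    have "(\<lambda>k w. x g u * bas u g k w) \<in> V.span ?E" if "g \<in> carrier G" "x g u \<noteq> 0" for g u
    proof (rule V.span_scale, rule V.span_base)
      have "length u = d" using x that by (simp add: homog_iff)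
      moreover have "set u \<subseteq> X" using xc that by (auto simp: skew_carrier free_carrier)
      ultimately show "bas u g \<in> ?E" using that(1) by blast
    qed
    then have "sum (\<lambda>(g, u). x g u \<bullet> bas u g) (SIGMA g:carrier G. {u. x g u \<noteq> 0}) \<in> V.span ?E"
      by (intro V.span_sum) (auto simp: skew_sel)
    then show ?thesis using expansion(2)[OF xc] by simp
  qed
  with 1 show "V.span ?E = B.homog d" by blast
qed

text \<open>
  Compose the natural surjection \<open>leading\<close> with the given isomorphism \<open>\<phi>\<close>, and identify degree \<open>d\<close> of
  the target with degree \<open>d\<close> of \<open>T(V) \<rtimes> G\<close> by means of \<open>qproj\<close>. The result is a surjective
  endomorphism of a finite-dimensional space, hence injective; its kernel contains that of \<open>leading\<close>.
\<close>
lemma leading_injective_low: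
  assumes qdh: "quantum_drinfeld_hecke G n lam q \<kappa>"
    and d: "d < 2" and x: "x \<in> B.homog d" and 0: "H.leading x = H.leading 0"
  shows "x = 0"
proof -
  obtain \<phi> where iso: "\<phi> \<in> ring_iso H.gr QS"
    and sc: "\<And>c x. x \<in> carrier H.gr \<Longrightarrow> \<phi> (c \<odot>\<^bsub>H.gr\<^esub> x) = c \<odot>\<^bsub>QS\<^esub> \<phi> x"
    and deg: "\<And>d. \<phi> ` gr_degree H.Q H.F d = qsym_skew_degree G n q d"
    using qdh unfolding quantum_drinfeld_hecke_def Let_def graded_alg_iso_def hecke_alg_eq filtration_eq by blast
  have hom: "\<phi> \<in> ring_hom H.gr QS" using iso by (simp add: ring_iso_def)
  let ?V = "B.homog d"
  have Vc: "?V \<subseteq> carrier B" by (auto simp: B.homog_def)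
  have img: "\<phi> ` H.leading ` ?V = qproj ` ?V"
    by (simp add: H.leading_homog deg qproj_homog)
  have inj: "inj_on qproj ?V" using qproj_inj_homog d by (auto intro: inj_onI)
  define f where "f z = inv_into ?V qproj (\<phi> (H.leading z))" for z
  have f: "f z \<in> ?V" "qproj (f z) = \<phi> (H.leading z)" if "z \<in> ?V" for z
  proof -
    have "\<phi> (H.leading z) \<in> qproj ` ?V" using img that by blast
    then show "f z \<in> ?V" "qproj (f z) = \<phi> (H.leading z)"
      unfolding f_def by (rule inv_into_into, rule f_inv_into_f)
  qed
  interpret V: vector_space "\<lambda>c (x :: 'g \<Rightarrow> nat list \<Rightarrow> complex) g w. c * x g w" by (rule skew_vector_space)
  have sub: "V.subspace ?V" unfolding homog_span(1)[of d, symmetric] by (rule V.subspace_span)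
  have add: "f (y + z) = f y + f z" if y: "y \<in> ?V" and z: "z \<in> ?V" for y z
  proof (rule inj_onD[OF inj])
    have yz: "y \<in> carrier B" "z \<in> carrier B" "f y \<in> carrier B" "f z \<in> carrier B" using y z f Vc by auto
    have s: "y + z \<in> ?V" using V.subspace_add[OF sub y z] .
    show "f (y + z) \<in> ?V" using f s by blast
    show "f y + f z \<in> ?V" using V.subspace_add[OF sub f(1)[OF y] f(1)[OF z]] .
    have "qproj (f y + f z) = qproj (f y) \<oplus>\<^bsub>QS\<^esub> qproj (f z)"
      using ring_hom_add[OF qproj_hom yz(3,4)] by (simp only: skew_sel)
    also have "\<dots> = \<phi> (H.leading y \<oplus>\<^bsub>H.gr\<^esub> H.leading z)"
      using ring_hom_add[OF hom] yz f y z H.leading_carrier by simp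
    also have "\<dots> = \<phi> (H.leading (y + z))" using yz by (simp only: H.leading_add)
    finally show "qproj (f (y + z)) = qproj (f y + f z)" using f(2)[OF s] by simp
  qed
  have scale: "f (c \<bullet> y) = c \<bullet> f y" if y: "y \<in> ?V" for c y
  proof (rule inj_onD[OF inj])
    have yc: "y \<in> carrier B" "f y \<in> carrier B" using y f Vc by auto
    have s: "c \<bullet> z \<in> ?V" if "z \<in> ?V" for z
      using V.subspace_scale[OF sub that] by (simp add: skew_sel)
    show "f (c \<bullet> y) \<in> ?V" using f s y by blast
    show "c \<bullet> f y \<in> ?V" using f s y by blast
    have "qproj (c \<bullet> f y) = c \<odot>\<^bsub>QS\<^esub> \<phi> (H.leading y)" using qproj_smult[OF yc(2)] f(2)[OF y] by simp
    also have "\<dots> = \<phi> (H.leading (c \<bullet> y))" using yc sc H.leading_carrier by (simp add: H.leading_smult)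
    finally show "qproj (f (c \<bullet> y)) = qproj (c \<bullet> f y)" using f(2)[OF s[OF y]] by simp
  qed
  have "y \<in> f ` ?V" if y: "y \<in> ?V" for y
  proof -
    obtain z where z: "z \<in> ?V" "qproj y = \<phi> (H.leading z)" using img y by blast
    then have "f z = y" unfolding f_def using inv_into_f_f[OF inj y] by simp
    then show ?thesis using z by blast
  qed
  then have surj: "?V \<subseteq> f ` ?V" by blast
  have "f x = f 0" by (simp add: f_def 0)
  moreover have "0 \<in> ?V" using V.subspace_0[OF sub] .
  then have "f 0 = 0" using add[of 0 0] by simp
  ultimately have "f x = 0" by simp
  then show "x = 0"
    using V.surj_on_finite_span_imp_inj[OF homog_span(2,1) add _ surj x] scale by (simp add: skew_sel)
qed

text \<open>
  If \<open>x = x\<^sub>0 + x\<^sub>1\<close> lies in the ideal, the symbol of \<open>x\<^sub>1\<close> vanishes because \<open>x\<^sub>1\<close> equals \<open>- x\<^sub>0\<close> in the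
  quotient; so \<open>x\<^sub>1 = 0\<close>, and then \<open>x\<^sub>0\<close> itself lies in the ideal.
\<close>
lemma ideal_low_trivial:
  assumes qdh: "quantum_drinfeld_hecke G n lam q \<kappa>" and x: "x \<in> H" "x \<in> B.below 2"
  shows "x = 0"
proof -
  have xc: "x \<in> carrier B" using x(1) by (rule H.Icarr)
  have "x g w = 0" if "length w \<ge> 2" for g w
    using x(2) that by (simp add: B.below_def comp_zero_iff)
  then have "x g w = (comp 0 x + comp 1 x) g w" for g w
    by (cases "length w \<ge> 2") (auto simp: comp_def not_le less_2_cases_iff)
  then have sum: "x = comp 0 x + comp 1 x" by blast
  have hom: "comp d x \<in> B.homog d" for d
    using comp_carrier[OF xc] by (simp add: B.homog_def B.comp_comp)
  have "comp 1 x = 0"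
  proof (rule leading_injective_low[OF qdh _ hom])
    have "\<exists>f\<in>B.below d. comp d (comp 1 x) - f \<in> H" for d
    proof (cases "d = 1")
      case True
      have "comp 0 x \<in> B.below 1" using B.comp_below[OF xc, of 0] by (simp add: One_nat_def)
      then have "- comp 0 x \<in> B.below 1" by (rule B.below_uminus)
      moreover have "comp 1 (comp 1 x) - (- comp 0 x) = x"
        using sum B.comp_comp[of 1 1 x] by (metis add.commute diff_minus_eq_add)
      ultimately show ?thesis using x(1) True by (intro bexI[of _ "- comp 0 x"]) simp_all
    next
      case False
      then show ?thesis by (intro bexI[of _ 0]) (auto simp: B.comp_comp)
    qed
    then show "H.leading (comp 1 x) = H.leading 0" by (simp add: leading_zero_iff comp_carrier xc)
  qed simp
  then have x0: "x = comp 0 x" using sum by simp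
  have "comp 0 x = 0"
  proof (rule leading_injective_low[OF qdh _ hom])
    have "\<exists>f\<in>B.below d. comp d (comp 0 x) - f \<in> H" for d
    proof (cases "d = 0")
      case True
      have "comp d (comp 0 x) - 0 = x" using True x0 B.comp_comp[of 0 0 x] by (metis diff_zero)
      then show ?thesis using x(1) by (intro bexI[of _ 0]) simp_all
    next
      case False
      then show ?thesis by (intro bexI[of _ 0]) (auto simp: B.comp_comp)
    qed
    then show "H.leading (comp 0 x) = H.leading 0" by (simp add: leading_zero_iff comp_carrier xc)
  qed simp
  then show ?thesis using x0 by simp
qed

text \<open>
  The element \<open>\<kappa>(v\<^sub>i, v\<^sub>j)\<close> of the group algebra.
\<close>
definition kappa_elem :: "nat \<Rightarrow> nat \<Rightarrow> 'g \<Rightarrow> nat list \<Rightarrow> complex" where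
  "kappa_elem i j = (\<Sum>t\<in>carrier G. \<kappa> i j t \<bullet> bas [] t)"

abbreviation gen where "gen i \<equiv> bas [i] \<one>"

lemma kappa_elem_carrier [simp]: "kappa_elem i j \<in> carrier B"
  unfolding kappa_elem_def by (intro B.sum_carr B.smult_closed bas_carrier) auto

lemma bas_below: "set u \<subseteq> X \<Longrightarrow> g \<in> carrier G \<Longrightarrow> bas u g \<in> B.below (Suc (length u))"
  by (simp add: B.below_def bas_carrier comp_zero_iff) (auto simp: bas_def word_def)

lemma kappa_elem_below: "kappa_elem i j \<in> B.below 1"
  unfolding kappa_elem_def using bas_below[of "[]"] by (intro B.below_sum B.below_smult) (auto simp: One_nat_def)

lemma sum_bas_apply:
  assumes "g \<in> carrier G"
  shows "(\<Sum>t\<in>carrier G. c t \<bullet> bas u t) g w = c g * word u w"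
proof -
  have "(\<Sum>t\<in>carrier G. c t \<bullet> bas u t) g w = (\<Sum>t\<in>carrier G. if t = g then c g * word u w else 0)"
    by (auto simp: sum_fun_apply skew_sel bas_def intro!: sum.cong)
  then show ?thesis using assms fin by simp
qed

lemma kappa_elem_gen_apply:
  assumes "g \<in> carrier G" "l \<in> X"
  shows "(kappa_elem i j \<star> gen l) g w = \<kappa> i j g * lam g l * word [l] w"
    and "(gen l \<star> kappa_elem i j) g w = \<kappa> i j g * word [l] w"
proof -
  have "kappa_elem i j \<star> gen l = (\<Sum>t\<in>carrier G. (\<kappa> i j t * lam t l) \<bullet> bas [l] t)"
    unfolding kappa_elem_def using assms
    by (simp add: mult_sum_left B.smult_mult mult_bas) (simp add: skew_sel mult.assoc cong: sum.cong)
  then show "(kappa_elem i j \<star> gen l) g w = \<kappa> i j g * lam g l * word [l] w"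
    by (simp only: sum_bas_apply[OF assms(1)])
  have "gen l \<star> kappa_elem i j = (\<Sum>t\<in>carrier G. \<kappa> i j t \<bullet> bas [l] t)"
    unfolding kappa_elem_def using assms
    by (simp add: mult_sum_right mult_smult_right mult_bas one_smult cong: sum.cong)
  then show "(gen l \<star> kappa_elem i j) g w = \<kappa> i j g * word [l] w"
    by (simp only: sum_bas_apply[OF assms(1)])
qed

lemma kappa_elem_gen_below:
  assumes "l \<in> X" shows "kappa_elem i j \<star> gen l \<in> B.below 2" "gen l \<star> kappa_elem i j \<in> B.below 2"
proof -
  have v: "gen l \<in> B.below (Suc 1)" using assms bas_below[of "[l]" \<one>] by (simp add: One_nat_def)
  have K: "kappa_elem i j \<in> B.below (Suc 0)" using kappa_elem_below by (simp add: One_nat_def)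
  show "kappa_elem i j \<star> gen l \<in> B.below 2" using B.below_mult_r[OF K v] by (simp add: numeral_2_eq_2 One_nat_def)
  show "gen l \<star> kappa_elem i j \<in> B.below 2" using B.below_mult_r[OF v kappa_elem_below] by (simp add: numeral_2_eq_2 One_nat_def)
qed

lemma minus_smult: "x - y = x + (-1) \<bullet> y"
  by (simp add: skew_sel fun_eq_iff)

lemma mult_diff_left: "x \<in> carrier B \<Longrightarrow> y \<in> carrier B \<Longrightarrow> z \<in> carrier B \<Longrightarrow>
   (x - y) \<star> z = x \<star> z - y \<star> z"
  by (simp only: minus_smult B.mult_add_left B.smult_mult B.smult_closed)

lemma mult_diff_right: "x \<in> carrier B \<Longrightarrow> y \<in> carrier B \<Longrightarrow> z \<in> carrier B \<Longrightarrow>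
   z \<star> (x - y) = z \<star> x - z \<star> y"
  by (simp only: minus_smult B.mult_add_right mult_smult_right B.smult_closed)

lemma hgen_kappa_elem: "hgen i j = bas [i, j] \<one> - q i j \<bullet> bas [j, i] \<one> - kappa_elem i j"
  by (simp only: hgen_def kappa_elem_def)

lemma hgen_mult_gen:
  assumes "i \<in> X" "j \<in> X" "l \<in> X"
  shows "hgen i j \<star> gen l = bas [i, j, l] \<one> - q i j \<bullet> bas [j, i, l] \<one> - kappa_elem i j \<star> gen l"
    and "gen l \<star> hgen i j = bas [l, i, j] \<one> - q i j \<bullet> bas [l, j, i] \<one> - gen l \<star> kappa_elem i j"
proof -
  have c: "bas [i, j] \<one> \<in> carrier B" "bas [j, i] \<one> \<in> carrier B" "gen l \<in> carrier B"
    using assms by (auto intro!: bas_carrier)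
  have b: "bas u \<one> \<star> bas v \<one> = bas (u @ v) \<one>" if "set u \<subseteq> X" "set v \<subseteq> X" for u v
    using that by (simp add: mult_bas lamw_one one_smult)
  show "hgen i j \<star> gen l = bas [i, j, l] \<one> - q i j \<bullet> bas [j, i, l] \<one> - kappa_elem i j \<star> gen l"
    unfolding hgen_kappa_elem using c assms b[of "[i, j]" "[l]"] b[of "[j, i]" "[l]"]
    by (simp only: mult_diff_left B.smult_mult B.smult_closed B.minus_carr kappa_elem_carrier) simp
  show "gen l \<star> hgen i j = bas [l, i, j] \<one> - q i j \<bullet> bas [l, j, i] \<one> - gen l \<star> kappa_elem i j"
    unfolding hgen_kappa_elem using c assms b[of "[l]" "[i, j]"] b[of "[l]" "[j, i]"]
    by (simp only: mult_diff_right mult_smult_right B.smult_closed B.minus_carr kappa_elem_carrier) simp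
qed

text \<open>
  The element \<open>?E\<close> of the ideal records the two ways of straightening \<open>v\<^sub>l v\<^sub>i v\<^sub>j\<close>: first its first pair, or
  first its second pair. All cubic terms cancel, and the remaining \<open>?D\<close> has filtration degree at most 1. Its
  coefficient at \<open>v\<^sub>l g\<close> is \<open>\<kappa> i j g * (1 - q l i * q l j * lam g l)\<close>, since the other terms have left-over letter
  \<open>i\<close> or \<open>j\<close>.
\<close>
lemma necessary_jacobi:
  assumes qdh: "quantum_drinfeld_hecke G n lam q \<kappa>"
    and X: "i \<in> X" "j \<in> X" "l \<in> X" and ne: "l \<noteq> i" "l \<noteq> j" and g: "g \<in> carrier G" and nz: "\<kappa> i j g \<noteq> 0"
  shows "lam g l = q i l * q j l"
proof -
  note sm = B.smult_closed
  let ?E = "hgen l i \<star> gen j + q l i \<bullet> (gen i \<star> hgen l j) + (q l i * q l j) \<bullet> (hgen i j \<star> gen l)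
    - gen l \<star> hgen i j - q i j \<bullet> (hgen l j \<star> gen i) - (q i j * q l j) \<bullet> (gen j \<star> hgen l i)"
  let ?D = "gen l \<star> kappa_elem i j - kappa_elem l i \<star> gen j - q l i \<bullet> (gen i \<star> kappa_elem l j) - (q l i * q l j) \<bullet> (kappa_elem i j \<star> gen l)
    + q i j \<bullet> (kappa_elem l j \<star> gen i) + (q i j * q l j) \<bullet> (gen j \<star> kappa_elem l i)"
  have v: "gen a \<in> carrier B" if "a \<in> X" for a using that by (intro bas_carrier) auto
  have "?E \<in> H"
    by (intro H.I_add H.I_minus H.I_smult H.I_l_closed H.I_r_closed hgen_in_ideal v X)
  moreover have "?E = ?D"
    unfolding hgen_mult_gen[OF X(3,1,2)] hgen_mult_gen[OF X(3,2,1)] hgen_mult_gen[OF X]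
    by (simp add: skew_sel fun_eq_iff algebra_simps)
  moreover have "?D \<in> B.below 2"
    by (intro B.below_add B.below_diff B.below_smult kappa_elem_gen_below X)
  ultimately have "?D = 0" using ideal_low_trivial[OF qdh, of ?D] by metis
  then have "?D g [l] = 0" by simp
  then have "\<kappa> i j g = q l i * q l j * (\<kappa> i j g * lam g l)"
    using ne by (simp add: skew_sel(3) kappa_elem_gen_apply[OF g X(1)] kappa_elem_gen_apply[OF g X(2)] kappa_elem_gen_apply[OF g X(3)]) (simp add: word_def)
  then have "1 = q l i * q l j * lam g l" using nz by (simp add: mult.assoc)
  then have "q i l * q j l = (q i l * q l i) * (q j l * q l j) * lam g l" by (simp add: algebra_simps)
  also have "\<dots> = lam g l" by (simp only: q_inv X mult_1_left)
  finally show ?thesis by (rule sym)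
qed

text \<open>
  Conjugating a relation by \<open>g\<close> rescales its quadratic part by \<open>lam g i * lam g j\<close>. Subtracting this multiple
  of the relation leaves an element of the group algebra that lies in the ideal.
\<close>
lemma necessary_equivariant:
  assumes qdh: "quantum_drinfeld_hecke G n lam q \<kappa>"
    and X: "i \<in> X" "j \<in> X" and g: "g \<in> carrier G" and h: "h \<in> carrier G"
  shows "\<kappa> i j (inv g \<otimes> h \<otimes> g) = lam g i * lam g j * \<kappa> i j h"
proof -
  let ?L = "lam g i * lam g j"
  let ?E = "bas [] g \<star> hgen i j \<star> bas [] (inv g) - ?L \<bullet> hgen i j"
  let ?D = "?L \<bullet> kappa_elem i j - bas [] g \<star> kappa_elem i j \<star> bas [] (inv g)"
  have c: "bas [i, j] \<one> \<in> carrier B" "bas [j, i] \<one> \<in> carrier B" "bas [] g \<in> carrier B" "bas [] (inv g) \<in> carrier B"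
    using X g by (auto intro!: bas_carrier)
  have b: "bas [] g \<star> bas u t \<star> bas [] (inv g) = lamw g u \<bullet> bas u (g \<otimes> t \<otimes> inv g)"
    if "set u \<subseteq> X" "t \<in> carrier G" for u t
    using that g by (simp add: mult_bas B.smult_mult one_smult)
  have "bas [] g \<star> hgen i j \<star> bas [] (inv g) =
    ?L \<bullet> bas [i, j] \<one> - q i j \<bullet> (?L \<bullet> bas [j, i] \<one>) - bas [] g \<star> kappa_elem i j \<star> bas [] (inv g)"
    unfolding hgen_kappa_elem using c X g b[of "[i, j]" \<one>] b[of "[j, i]" \<one>]
    by (simp only: mult_diff_left mult_diff_right mult_smult_right B.smult_mult B.smult_closed B.minus_carr kappa_elem_carrier B.m_closed)
       (simp add: mult.commute)
  then have ED: "?E = ?D"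
    unfolding hgen_kappa_elem by (simp add: skew_sel fun_eq_iff algebra_simps)
  have K: "bas [] g \<star> kappa_elem i j \<star> bas [] (inv g) = (\<Sum>t\<in>carrier G. \<kappa> i j (inv g \<otimes> t \<otimes> g) \<bullet> bas [] t)"
  proof -
    have "bas [] g \<star> kappa_elem i j \<star> bas [] (inv g) = (\<Sum>t\<in>carrier G. \<kappa> i j t \<bullet> bas [] (g \<otimes> t \<otimes> inv g))"
      unfolding kappa_elem_def using c b[of "[]"]
      by (simp add: mult_sum_right mult_sum_left mult_smult_right B.smult_mult one_smult cong: sum.cong)
    also have "\<dots> = (\<Sum>t\<in>carrier G. \<kappa> i j (inv g \<otimes> t \<otimes> g) \<bullet> bas [] t)"
    proof (rule sum.reindex_bij_witness[of _ "\<lambda>s. inv g \<otimes> s \<otimes> g" "\<lambda>t. g \<otimes> t \<otimes> inv g"])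
      fix t assume t: "t \<in> carrier G"
      show ts: "inv g \<otimes> (g \<otimes> t \<otimes> inv g) \<otimes> g = t"
        using g t by (simp add: m_assoc) (simp flip: m_assoc)
      show "\<kappa> i j (inv g \<otimes> (g \<otimes> t \<otimes> inv g) \<otimes> g) \<bullet> bas [] (g \<otimes> t \<otimes> inv g) = \<kappa> i j t \<bullet> bas [] (g \<otimes> t \<otimes> inv g)"
        by (simp only: ts)
    next
      fix s assume s: "s \<in> carrier G"
      show "g \<otimes> (inv g \<otimes> s \<otimes> g) \<otimes> inv g = s"
        using g s by (simp add: m_assoc) (simp flip: m_assoc)
    qed (use g in simp_all)
    finally show ?thesis .
  qed
  have "?E \<in> H"
    by (intro H.I_minus H.I_smult H.I_l_closed H.I_r_closed hgen_in_ideal X c)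
  moreover have "?D \<in> B.below 2"
  proof -
    have "(\<Sum>t\<in>carrier G. \<kappa> i j (inv g \<otimes> t \<otimes> g) \<bullet> bas [] t) \<in> B.below 1"
      using bas_below[of "[]"] by (intro B.below_sum B.below_smult) (auto simp: One_nat_def)
    then have "?D \<in> B.below 1" unfolding K by (intro B.below_diff B.below_smult kappa_elem_below)
    then show ?thesis using B.below_mono[of 1 2] by auto
  qed
  ultimately have "?D = 0" using ideal_low_trivial[OF qdh, of ?D] ED by metis
  then have "?D h [] = 0" by simp
  moreover have "kappa_elem i j h [] = \<kappa> i j h"
    unfolding kappa_elem_def sum_bas_apply[OF h] by (simp add: word_def)
  moreover have "(bas [] g \<star> kappa_elem i j \<star> bas [] (inv g)) h [] = \<kappa> i j (inv g \<otimes> h \<otimes> g)"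
    unfolding K sum_bas_apply[OF h] by (simp add: word_def)
  ultimately show ?thesis by (simp add: skew_sel(3))
qed

theorem quantum_drinfeld_hecke_iff:
  "quantum_drinfeld_hecke G n lam q \<kappa> \<longleftrightarrow> pbw_relations G n lam q \<kappa>"
proof
  assume "quantum_drinfeld_hecke G n lam q \<kappa>"
  then show "pbw_relations G n lam q \<kappa>"
    using necessary_jacobi necessary_equivariant by unfold_locales auto
next
  assume "pbw_relations G n lam q \<kappa>"
  then show "quantum_drinfeld_hecke G n lam q \<kappa>" by (rule pbw_relations.pbw_property)
qed

end

section \<open>The basis of the space of admissible maps\<close>

locale diagonal_hecke_setting = diagonal_action G n lam + V: finite_dimensional_vector_space scale "v ` {1..n}"
  for G :: "('g, 'm) monoid_scheme" (structure) and n lam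
    and scale :: "complex \<Rightarrow> 'v::ab_group_add \<Rightarrow> 'v" and v :: "nat \<Rightarrow> 'v" +
  fixes q :: "nat \<Rightarrow> nat \<Rightarrow> complex" and R :: "'g set" and reps :: "'g \<Rightarrow> 'g set"
  assumes v_inj: "inj_on v {1..n}"
    and q_inverse: "i \<in> {1..n} \<Longrightarrow> j \<in> {1..n} \<Longrightarrow> q i j * q j i = 1"
    and q_one: "i \<in> {1..n} \<Longrightarrow> q i i = 1"
    and R_reps: "conjugacy_class_reps G R"
    and reps_cosets: "a \<in> carrier G \<Longrightarrow> left_coset_reps G (centralizer G a) (reps a)"
begin

abbreviation K where "K \<equiv> hecke_maps G n scale v lam q"
abbreviation index where "index \<equiv> basis_index G n lam q R"

definition bmap :: "nat \<times> nat \<times> 'g \<Rightarrow> 'v \<Rightarrow> 'v \<Rightarrow> 'g \<Rightarrow> complex" where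
  "bmap = (\<lambda>(r, s, a). basis_map G n scale v lam q (reps a) r s a)"

lemma bilinear_map_iff:
  "bilinear_map G scale \<kappa> \<longleftrightarrow>
    (\<forall>u w g. g \<notin> carrier G \<longrightarrow> \<kappa> u w g = 0) \<and>
    (\<forall>u w w' g. \<kappa> u (w + w') g = \<kappa> u w g + \<kappa> u w' g) \<and>
    (\<forall>u u' w g. \<kappa> (u + u') w g = \<kappa> u w g + \<kappa> u' w g) \<and>
    (\<forall>c u w g. \<kappa> u (scale c w) g = c * \<kappa> u w g) \<and>
    (\<forall>c u w g. \<kappa> (scale c u) w g = c * \<kappa> u w g)"
proof -
  have "vector_space (\<lambda>c (x :: 'g \<Rightarrow> complex) g. c * x g)"
    by unfold_locales (auto simp: fun_eq_iff algebra_simps)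
  then show ?thesis
    using V.vector_space_axioms
    unfolding bilinear_map_def Vector_Spaces.linear_iff group_alg_def fun_eq_iff plus_fun_apply by auto
qed

lemma bilinear_eqI:
  assumes b: "bilinear_map G scale \<kappa>" "bilinear_map G scale \<kappa>'"
    and eq: "\<And>i j g. i \<in> X \<Longrightarrow> j \<in> X \<Longrightarrow> g \<in> carrier G \<Longrightarrow> \<kappa> (v i) (v j) g = \<kappa>' (v i) (v j) g"
  shows "\<kappa> = \<kappa>'"
proof (intro ext)
  fix u w g
  have zero: "\<theta> 0 w g = 0" "\<theta> u 0 g = 0" if "bilinear_map G scale \<theta>" for \<theta> :: "'v \<Rightarrow> 'v \<Rightarrow> 'g \<Rightarrow> complex" and u w g
    using that unfolding bilinear_map_iff by (metis add_cancel_right_left)+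
  have out: "\<kappa> u w g = \<kappa>' u w g" if "g \<notin> carrier G" for u w g
    using b that by (simp add: bilinear_map_iff)
  have 1: "\<kappa> (v i) w g = \<kappa>' (v i) w g" if i: "i \<in> X" for i w
  proof -
    have "w \<in> V.span (v ` X)" using V.span_Basis by simp
    then show ?thesis
    proof (induction rule: V.span_induct_alt)
      case base show ?case by (simp add: zero b)
    next
      case (step c x y)
      then obtain j where "j \<in> X" "x = v j" by auto
      then have "\<kappa> (v i) x g = \<kappa>' (v i) x g" using eq[of i j g] i out by (cases "g \<in> carrier G") auto
      with step show ?case using b unfolding bilinear_map_iff by simp
    qed
  qed
  have "u \<in> V.span (v ` X)" using V.span_Basis by simp
  then show "\<kappa> u w g = \<kappa>' u w g"
  proof (induction rule: V.span_induct_alt)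
    case base show ?case by (simp add: zero b)
  next
    case (step c x y)
    then obtain j where "j \<in> X" "x = v j" by auto
    then have "\<kappa> x w g = \<kappa>' x w g" using 1 by simp
    with step show ?case using b unfolding bilinear_map_iff by simp
  qed
qed

text \<open>
  Membership becomes a condition on the values at pairs of basis vectors. It is linear in \<open>\<kappa>\<close>, except
  for the shape of the last clause: at each \<open>g\<close> it says either nothing or that a value is zero.
\<close>
lemma mem_hecke_maps_iff:
  "\<kappa> \<in> K \<longleftrightarrow> bilinear_map G scale \<kappa> \<and>
    (\<forall>i\<in>X. \<forall>j\<in>X. \<forall>g. \<kappa> (v i) (v j) g = - q i j * \<kappa> (v j) (v i) g) \<and>
    (\<forall>i\<in>X. \<forall>j\<in>X. \<forall>g\<in>carrier G. \<forall>h\<in>carrier G.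
      \<kappa> (v i) (v j) (inv g \<otimes> h \<otimes> g) = lam g i * lam g j * \<kappa> (v i) (v j) h) \<and>
    (\<forall>i\<in>X. \<forall>j\<in>X. \<forall>l\<in>X. \<forall>g\<in>carrier G. i \<noteq> j \<longrightarrow> l \<noteq> i \<longrightarrow> l \<noteq> j \<longrightarrow>
      \<kappa> (v i) (v j) g \<noteq> 0 \<longrightarrow> lam g l = q i l * q j l)"
  (is "_ \<longleftrightarrow> ?bil \<and> ?skew \<and> ?equi \<and> ?jac")
proof -
  let ?k = "\<lambda>i j. \<kappa> (v i) (v j)"
  have "quantum_drinfeld_hecke G n lam q ?k \<longleftrightarrow> ?equi \<and> ?jac" if b: ?bil and s: ?skew
  proof -
    interpret Q: quantum_relations G n lam q ?k
    proof unfold_locales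
      fix i j g assume ij: "i \<in> X" "j \<in> X"
      show "q i j * q j i = 1" using ij by (rule q_inverse)
      show "\<kappa> (v i) (v j) g = - q i j * \<kappa> (v j) (v i) g" using s ij by blast
      show "\<kappa> (v i) (v j) g = 0" if "g \<notin> carrier G" using b that by (simp add: bilinear_map_iff)
    qed (rule q_one)
    show ?thesis
      unfolding Q.quantum_drinfeld_hecke_iff pbw_relations_def pbw_relations_axioms_def
      using Q.quantum_relations_axioms by blast
  qed
  then show ?thesis unfolding hecke_maps_def mem_Collect_eq by (intro conj_cong refl)
qed

sublocale M: vector_space "map_scale :: complex \<Rightarrow> ('v \<Rightarrow> 'v \<Rightarrow> 'g \<Rightarrow> complex) \<Rightarrow> _"
  by (rule vector_space_map_scale)

lemma hecke_mapsD:
  assumes "\<kappa> \<in> K"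
  shows "bilinear_map G scale \<kappa>"
    and "i \<in> X \<Longrightarrow> j \<in> X \<Longrightarrow> \<kappa> (v i) (v j) g = - q i j * \<kappa> (v j) (v i) g"
    and "i \<in> X \<Longrightarrow> j \<in> X \<Longrightarrow> g \<in> carrier G \<Longrightarrow> h \<in> carrier G \<Longrightarrow>
      \<kappa> (v i) (v j) (inv g \<otimes> h \<otimes> g) = lam g i * lam g j * \<kappa> (v i) (v j) h"
    and "i \<in> X \<Longrightarrow> j \<in> X \<Longrightarrow> l \<in> X \<Longrightarrow> g \<in> carrier G \<Longrightarrow> i \<noteq> j \<Longrightarrow> l \<noteq> i \<Longrightarrow> l \<noteq> j \<Longrightarrow>
      \<kappa> (v i) (v j) g \<noteq> 0 \<Longrightarrow> lam g l = q i l * q j l"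
  using assms unfolding mem_hecke_maps_iff by blast+

lemma hecke_maps_subspace: "M.subspace K"
proof (rule M.subspaceI)
  show "0 \<in> K" by (simp add: mem_hecke_maps_iff bilinear_map_iff)
next
  fix \<kappa> \<kappa>' assume k: "\<kappa> \<in> K" "\<kappa>' \<in> K"
  show "\<kappa> + \<kappa>' \<in> K"
    unfolding mem_hecke_maps_iff
  proof (intro conjI ballI allI impI)
    show "bilinear_map G scale (\<kappa> + \<kappa>')"
      using hecke_mapsD(1)[OF k(1)] hecke_mapsD(1)[OF k(2)] by (simp add: bilinear_map_iff algebra_simps)
  next
    fix i j g assume "i \<in> X" "j \<in> X"
    then show "(\<kappa> + \<kappa>') (v i) (v j) g = - q i j * (\<kappa> + \<kappa>') (v j) (v i) g"
      using hecke_mapsD(2)[OF k(1), of i j g] hecke_mapsD(2)[OF k(2), of i j g] by (simp add: distrib_left)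
  next
    fix i j g h assume "i \<in> X" "j \<in> X" "g \<in> carrier G" "h \<in> carrier G"
    then show "(\<kappa> + \<kappa>') (v i) (v j) (inv g \<otimes> h \<otimes> g) = lam g i * lam g j * (\<kappa> + \<kappa>') (v i) (v j) h"
      using hecke_mapsD(3)[OF k(1), of i j g h] hecke_mapsD(3)[OF k(2), of i j g h] by (simp add: distrib_left)
  next
    fix i j l g assume "i \<in> X" "j \<in> X" "l \<in> X" "g \<in> carrier G" "i \<noteq> j" "l \<noteq> i" "l \<noteq> j"
      and "(\<kappa> + \<kappa>') (v i) (v j) g \<noteq> 0"
    moreover from this have "\<kappa> (v i) (v j) g \<noteq> 0 \<or> \<kappa>' (v i) (v j) g \<noteq> 0" by auto
    ultimately show "lam g l = q i l * q j l"
      using hecke_mapsD(4)[OF k(1), of i j l g] hecke_mapsD(4)[OF k(2), of i j l g] by blast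
  qed
next
  fix c \<kappa> assume k: "\<kappa> \<in> K"
  show "map_scale c \<kappa> \<in> K"
    unfolding mem_hecke_maps_iff map_scale_def
  proof (intro conjI ballI allI impI)
    show "bilinear_map G scale (\<lambda>u w g. c * \<kappa> u w g)"
      using hecke_mapsD(1)[OF k] by (simp add: bilinear_map_iff algebra_simps)
  next
    fix i j g assume "i \<in> X" "j \<in> X"
    then show "c * \<kappa> (v i) (v j) g = - q i j * (c * \<kappa> (v j) (v i) g)"
      using hecke_mapsD(2)[OF k, of i j g] by simp
  next
    fix i j g h assume "i \<in> X" "j \<in> X" "g \<in> carrier G" "h \<in> carrier G"
    then show "c * \<kappa> (v i) (v j) (inv g \<otimes> h \<otimes> g) = lam g i * lam g j * (c * \<kappa> (v i) (v j) h)"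
      using hecke_mapsD(3)[OF k, of i j g h] by simp
  next
    fix i j l g assume "i \<in> X" "j \<in> X" "l \<in> X" "g \<in> carrier G" "i \<noteq> j" "l \<noteq> i" "l \<noteq> j"
      and "c * \<kappa> (v i) (v j) g \<noteq> 0"
    then show "lam g l = q i l * q j l" using hecke_mapsD(4)[OF k, of i j l g] by simp
  qed
qed

definition coeff :: "nat \<Rightarrow> nat \<Rightarrow> nat \<Rightarrow> nat \<Rightarrow> complex" where
  "coeff r s i j = of_bool (i = r) * of_bool (j = s) - q s r * of_bool (i = s) * of_bool (j = r)"

text \<open>
  The coefficients of \<open>\<Sum>\<^sub>g (lam g r)\<^sup>-\<^sup>1 (lam g s)\<^sup>-\<^sup>1 * g a g\<^sup>-\<^sup>1\<close>, a sum over the chosen coset representatives. Together with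
  \<open>coeff\<close> it separates \<open>f\<^bsub>r,s,a\<^esub>\<close> into its dependence on the vectors and on the group element.
\<close>
definition class_sum :: "nat \<Rightarrow> nat \<Rightarrow> 'g \<Rightarrow> 'g \<Rightarrow> complex" where
  "class_sum r s a k = (\<Sum>g\<in>reps a. inverse (lam g r) * inverse (lam g s) * of_bool (k = g \<otimes> a \<otimes> inv g))"

lemma bmap_apply: "bmap (r, s, a) = (\<lambda>u w k. \<Sum>i\<in>X. \<Sum>j\<in>X.
    V.representation (v ` X) u (v i) * V.representation (v ` X) w (v j) * (coeff r s i j * class_sum r s a k))"
  by (simp add: bmap_def basis_map_def coeff_def class_sum_def)

lemma bmap_basis:
  assumes "i \<in> X" "j \<in> X"
  shows "bmap (r, s, a) (v i) (v j) k = coeff r s i j * class_sum r s a k"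
proof -
  have rep: "V.representation (v ` X) (v i) (v i') = of_bool (i' = i)" if "i \<in> X" "i' \<in> X" for i i'
    using V.representation_basis[OF V.independent_Basis, of "v i"] that inj_on_eq_iff[OF v_inj that(2,1)]
    by simp
  have "bmap (r, s, a) (v i) (v j) k =
    (\<Sum>i'\<in>X. \<Sum>j'\<in>X. of_bool (i' = i) * of_bool (j' = j) * (coeff r s i' j' * class_sum r s a k))"
    unfolding bmap_apply using assms rep by (intro sum.cong refl) simp
  also have "\<dots> = (\<Sum>i'\<in>X. if i' = i then (\<Sum>j'\<in>X. if j' = j then coeff r s i' j' * class_sum r s a k else 0) else 0)"
    by (intro sum.cong refl) (auto intro!: sum.cong)
  also have "\<dots> = coeff r s i j * class_sum r s a k" using assms by simp
  finally show ?thesis .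
qed

lemma reps_carrier: "a \<in> carrier G \<Longrightarrow> reps a \<subseteq> carrier G"
  using reps_cosets[of a] by (simp add: left_coset_reps_def)

lemma reps_finite: "a \<in> carrier G \<Longrightarrow> finite (reps a)"
  using reps_carrier[of a] fin by (metis finite_subset)

lemma bmap_bilinear:
  assumes a: "a \<in> carrier G" shows "bilinear_map G scale (bmap (r, s, a))"
proof -
  have span: "u \<in> V.span (v ` X)" for u using V.span_Basis by simp
  have "class_sum r s a g = 0" if "g \<notin> carrier G" for g
    using that reps_carrier[OF a] a unfolding class_sum_def by (intro sum.neutral) auto
  then show ?thesis
    unfolding bilinear_map_iff bmap_apply
    by (auto simp: V.representation_add[OF V.independent_Basis span span] V.representation_scale[OF V.independent_Basis span]
        algebra_simps sum.distrib sum_distrib_left)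
qed

lemma conj_eq_iff:
  assumes "x \<in> carrier G" "g \<in> carrier G" "a \<in> carrier G"
  shows "x \<otimes> a \<otimes> inv x = g \<otimes> a \<otimes> inv g \<longleftrightarrow> g \<in> x <# centralizer G a"
proof -
  have "g \<in> x <# centralizer G a \<longleftrightarrow> inv x \<otimes> g \<in> centralizer G a"
  proof
    assume "g \<in> x <# centralizer G a"
    then obtain h where "h \<in> centralizer G a" "g = x \<otimes> h" by (auto simp: l_coset_def)
    then show "inv x \<otimes> g \<in> centralizer G a" using assms by (simp add: centralizer_def flip: m_assoc)
  next
    assume "inv x \<otimes> g \<in> centralizer G a"
    moreover have "g = x \<otimes> (inv x \<otimes> g)" using assms by (simp flip: m_assoc)
    ultimately show "g \<in> x <# centralizer G a" unfolding l_coset_def by blast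
  qed
  also have "\<dots> \<longleftrightarrow> inv x \<otimes> g \<otimes> a = a \<otimes> (inv x \<otimes> g)" using assms by (simp add: centralizer_def)
  also have "\<dots> \<longleftrightarrow> x \<otimes> a \<otimes> inv x = g \<otimes> a \<otimes> inv g"
  proof -
    have "inv x \<otimes> g \<otimes> a = a \<otimes> (inv x \<otimes> g) \<longleftrightarrow> g \<otimes> a = x \<otimes> (a \<otimes> (inv x \<otimes> g))"
      using assms inv_solve_left[of "a \<otimes> (inv x \<otimes> g)" x "g \<otimes> a"] by (auto simp: m_assoc)
    also have "\<dots> \<longleftrightarrow> x \<otimes> a \<otimes> inv x \<otimes> g = g \<otimes> a" using assms by (auto simp: m_assoc)
    also have "\<dots> \<longleftrightarrow> x \<otimes> a \<otimes> inv x = g \<otimes> a \<otimes> inv g"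
      using assms inv_solve_right[of "x \<otimes> a \<otimes> inv x" "g \<otimes> a" g] by auto
    finally show ?thesis .
  qed
  finally show ?thesis by simp
qed

text \<open>
  Among the chosen representatives exactly one, \<open>t\<close>, satisfies \<open>t a t\<^sup>-\<^sup>1 = x a x\<^sup>-\<^sup>1\<close>, namely the one in the
  coset of \<open>x\<close>. Since \<open>\<lambda>\<^sub>r \<lambda>\<^sub>s\<close> is trivial on the centralizer, \<open>t\<close> may be replaced by \<open>x\<close> in the
  coefficient.
\<close>
lemma class_sum_conj:
  assumes rs: "r \<in> X" "s \<in> X" and a: "a \<in> carrier G"
    and cent: "\<And>h. h \<in> centralizer G a \<Longrightarrow> lam h r = inverse (lam h s)" and x: "x \<in> carrier G"
  shows "class_sum r s a (x \<otimes> a \<otimes> inv x) = inverse (lam x r * lam x s)"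
proof -
  obtain t where t: "t \<in> reps a" "t \<in> x <# centralizer G a"
    and uniq: "\<And>t'. t' \<in> reps a \<Longrightarrow> t' \<in> x <# centralizer G a \<Longrightarrow> t' = t"
    using reps_cosets[OF a] x unfolding left_coset_reps_def by blast
  obtain h where h: "h \<in> centralizer G a" "t = x \<otimes> h" using t(2) by (auto simp: l_coset_def)
  then have hc: "h \<in> carrier G" by (simp add: centralizer_def)
  have "lam t r * lam t s = lam x r * lam x s * (lam h r * lam h s)"
    using h(2) x hc rs by (simp add: lam_mult)
  also have "lam h r * lam h s = 1" using cent[OF h(1)] lam_nonzero[OF hc rs(2)] by simp
  finally have lt: "lam t r * lam t s = lam x r * lam x s" by simp
  have "class_sum r s a (x \<otimes> a \<otimes> inv x) = (\<Sum>g\<in>reps a. if g = t then inverse (lam t r) * inverse (lam t s) else 0)"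
    unfolding class_sum_def
  proof (rule sum.cong[OF refl])
    fix g assume g: "g \<in> reps a"
    then have "g \<in> carrier G" using reps_carrier[OF a] by auto
    then have "x \<otimes> a \<otimes> inv x = g \<otimes> a \<otimes> inv g \<longleftrightarrow> g = t"
      using conj_eq_iff[OF x _ a] uniq[OF g] t(2) by auto
    then show "inverse (lam g r) * inverse (lam g s) * of_bool (x \<otimes> a \<otimes> inv x = g \<otimes> a \<otimes> inv g) =
        (if g = t then inverse (lam t r) * inverse (lam t s) else 0)" by simp
  qed
  also have "\<dots> = inverse (lam t r * lam t s)" using t(1) reps_finite[OF a] by simp
  finally show ?thesis by (simp add: lt)
qed

lemma class_sum_outside:
  assumes a: "a \<in> carrier G" and k: "k \<notin> conjugacy_class G a"
  shows "class_sum r s a k = 0"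
  unfolding class_sum_def using k reps_carrier[OF a]
  by (intro sum.neutral) (auto simp: conjugacy_class_def)

lemma index_iff: "(r, s, a) \<in> index \<longleftrightarrow> r \<in> X \<and> s \<in> X \<and> r < s \<and> a \<in> R \<and>
    (\<forall>l\<in>X. l \<noteq> r \<and> l \<noteq> s \<longrightarrow> q r l * q s l = lam a l) \<and>
    (\<forall>h\<in>centralizer G a. lam h r = inverse (lam h s))"
  by (auto simp: basis_index_def)

lemma R_carrier: "a \<in> R \<Longrightarrow> a \<in> carrier G"
  using R_reps by (auto simp: conjugacy_class_reps_def)

lemma self_conj: "a \<in> carrier G \<Longrightarrow> a \<in> conjugacy_class G a"
  unfolding conjugacy_class_def by (rule CollectI, rule exI[of _ \<one>]) simp

lemma R_unique:
  assumes "a \<in> R" "b \<in> R" "b \<in> conjugacy_class G a" shows "a = b"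
  using assms R_carrier[of a] self_conj[of a] R_reps unfolding conjugacy_class_reps_def by blast

lemma R_exists:
  assumes k: "k \<in> carrier G" obtains a x where "a \<in> R" "x \<in> carrier G" "k = x \<otimes> a \<otimes> inv x"
proof -
  obtain a where a: "a \<in> R" "a \<in> conjugacy_class G k" using R_reps k unfolding conjugacy_class_reps_def by blast
  then obtain g where g: "g \<in> carrier G" "a = g \<otimes> k \<otimes> inv g" by (auto simp: conjugacy_class_def)
  have "inv g \<otimes> (g \<otimes> k \<otimes> inv g) \<otimes> g = k" using g(1) k by (simp add: m_assoc) (simp flip: m_assoc)
  then have "k = inv g \<otimes> a \<otimes> inv (inv g)" using g(1) by (simp flip: g(2))
  with a(1) inv_closed[OF g(1)] show ?thesis by (rule that)
qed

text \<open>
  By \<open>class_sum_conj\<close> the coefficient at \<open>x a x\<^sup>-\<^sup>1\<close> is the inverse of the character \<open>\<lambda>\<^sub>r \<lambda>\<^sub>s\<close> at \<open>x\<close>, which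
  gives equivariance. The Jacobi condition holds on the whole class because it holds at \<open>a\<close> and
  characters are constant on conjugacy classes.
\<close>
lemma bmap_in_hecke_maps:
  assumes p: "(r, s, a) \<in> index" shows "bmap (r, s, a) \<in> K"
proof -
  have rs: "r \<in> X" "s \<in> X" "r < s" and a: "a \<in> R"
    and jac: "\<And>l. l \<in> X \<Longrightarrow> l \<noteq> r \<Longrightarrow> l \<noteq> s \<Longrightarrow> q r l * q s l = lam a l"
    and cent: "\<And>h. h \<in> centralizer G a \<Longrightarrow> lam h r = inverse (lam h s)"
    using p by (auto simp: index_iff)
  have ac: "a \<in> carrier G" using a by (rule R_carrier)
  let ?c = "class_sum r s a"
  have coeff: "coeff r s i j = (if i = r \<and> j = s then 1 else if i = s \<and> j = r then - q s r else 0)" for i j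
    using rs(3) by (auto simp: coeff_def)
  have skew: "coeff r s i j = - q i j * coeff r s j i" if "i \<in> X" "j \<in> X" for i j
    using q_inverse[OF rs(1,2)] rs(3) by (auto simp: coeff)
  have equi: "?c (inv g \<otimes> h \<otimes> g) = lam g r * lam g s * ?c h" if g: "g \<in> carrier G" and h: "h \<in> carrier G" for g h
  proof (cases "h \<in> conjugacy_class G a")
    case True
    then obtain x where x: "x \<in> carrier G" "h = x \<otimes> a \<otimes> inv x" by (auto simp: conjugacy_class_def)
    have "inv g \<otimes> h \<otimes> g = (inv g \<otimes> x) \<otimes> a \<otimes> inv (inv g \<otimes> x)"
      using g x ac by (simp add: inv_mult_group m_assoc)
    then have "?c (inv g \<otimes> h \<otimes> g) = inverse (lam (inv g \<otimes> x) r * lam (inv g \<otimes> x) s)"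
      using class_sum_conj[OF rs(1,2) ac cent, of "inv g \<otimes> x"] g x by simp
    also have "\<dots> = inverse (lam (inv g) r * lam (inv g) s) * inverse (lam x r * lam x s)"
      using g x rs by (simp add: lam_mult field_simps)
    also have "inverse (lam (inv g) r * lam (inv g) s) = lam g r * lam g s"
      using lam_inv[OF g rs(1)] lam_inv[OF g rs(2)] inverse_unique[of "lam (inv g) r" "lam g r"]
        inverse_unique[of "lam (inv g) s" "lam g s"] by (simp add: mult.commute)
    finally show ?thesis using class_sum_conj[OF rs(1,2) ac cent x(1)] x(2) by simp
  next
    case False
    have "inv g \<otimes> h \<otimes> g \<notin> conjugacy_class G a"
    proof
      assume "inv g \<otimes> h \<otimes> g \<in> conjugacy_class G a"
      then obtain x where x: "x \<in> carrier G" "inv g \<otimes> h \<otimes> g = x \<otimes> a \<otimes> inv x" by (auto simp: conjugacy_class_def)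
      have "h = g \<otimes> (inv g \<otimes> h \<otimes> g) \<otimes> inv g" using g h by (simp add: m_assoc) (simp flip: m_assoc)
      also have "\<dots> = (g \<otimes> x) \<otimes> a \<otimes> inv (g \<otimes> x)" unfolding x(2) using g x(1) ac by (simp add: inv_mult_group m_assoc)
      finally show False using False g x(1) unfolding conjugacy_class_def by blast
    qed
    then show ?thesis using False by (simp add: class_sum_outside[OF ac])
  qed
  have jac': "lam g l = q r l * q s l" if g: "g \<in> carrier G" "?c g \<noteq> 0" and l: "l \<in> X" "l \<noteq> r" "l \<noteq> s" for g l
  proof -
    have "g \<in> conjugacy_class G a" using class_sum_outside[OF ac] g(2) by blast
    then obtain x where "x \<in> carrier G" "g = x \<otimes> a \<otimes> inv x" by (auto simp: conjugacy_class_def)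
    then show ?thesis using jac[OF l] lam_conj[of x a l] ac l(1) by simp
  qed
  show ?thesis
    unfolding mem_hecke_maps_iff
  proof (intro conjI ballI allI impI)
    show "bilinear_map G scale (bmap (r, s, a))" by (rule bmap_bilinear[OF ac])
  next
    fix i j g assume "i \<in> X" "j \<in> X"
    then show "bmap (r, s, a) (v i) (v j) g = - q i j * bmap (r, s, a) (v j) (v i) g"
      by (simp add: bmap_basis skew[of i j])
  next
    fix i j g h assume "i \<in> X" "j \<in> X" "g \<in> carrier G" "h \<in> carrier G"
    then show "bmap (r, s, a) (v i) (v j) (inv g \<otimes> h \<otimes> g) = lam g i * lam g j * bmap (r, s, a) (v i) (v j) h"
      by (auto simp: bmap_basis equi coeff)
  next
    fix i j l g assume "i \<in> X" "j \<in> X" "l \<in> X" "g \<in> carrier G" "i \<noteq> j" "l \<noteq> i" "l \<noteq> j"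
      and "bmap (r, s, a) (v i) (v j) g \<noteq> 0"
    then show "lam g l = q i l * q j l"
      using jac'[of g l] by (auto simp: bmap_basis coeff mult.commute split: if_splits)
  qed
qed

text \<open>
  Because \<open>r < s\<close> and \<open>r' < s'\<close>, the second term of \<open>f\<^bsub>r',s',a'\<^esub>\<close> never contributes at \<open>(v\<^sub>r, v\<^sub>s)\<close>, and
  distinct representatives lie in distinct classes.
\<close>
lemma bmap_dual:
  assumes p: "(r, s, a) \<in> index" and p': "(r', s', a') \<in> index"
  shows "bmap (r', s', a') (v r) (v s) a = of_bool ((r, s, a) = (r', s', a'))"
proof -
  have "r \<in> X" "s \<in> X" "r < s" "r' < s'" "r' \<in> X" "s' \<in> X" "a \<in> R" "a' \<in> R"
    and cent: "\<And>h. h \<in> centralizer G a' \<Longrightarrow> lam h r' = inverse (lam h s')"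
    using p p' by (auto simp: index_iff)
  note h = this(1-8)
  have ac: "a \<in> carrier G" "a' \<in> carrier G" using h R_carrier by auto
  have "coeff r' s' r s = of_bool (r = r' \<and> s = s')" using h by (auto simp: coeff_def)
  moreover have "class_sum r' s' a' a = of_bool (a = a')"
  proof (cases "a = a'")
    case True
    then show ?thesis
      using class_sum_conj[OF h(5,6) ac(2) cent one_closed] ac h lam_one by simp
  next
    case False
    then have "a \<notin> conjugacy_class G a'" using R_unique h by blast
    then show ?thesis using False class_sum_outside[OF ac(2)] by simp
  qed
  ultimately show ?thesis using h by (simp add: bmap_basis)
qed

lemma finite_index: "finite index"
proof -
  have "R \<subseteq> carrier G" using R_carrier by blast
  then have "finite R" using fin by (rule finite_subset)
  moreover have "index \<subseteq> X \<times> X \<times> R" by (auto simp: index_iff)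
  moreover have "finite (X \<times> X \<times> R)" using \<open>finite R\<close> by simp
  ultimately show ?thesis by (metis finite_subset)
qed

lemma inj_bmap: "inj_on bmap index"
proof (rule inj_onI)
  fix p p' assume "p \<in> index" "p' \<in> index" "bmap p = bmap p'"
  moreover obtain r s a where "p = (r, s, a)" by (cases p)
  moreover obtain r' s' a' where "p' = (r', s', a')" by (cases p')
  ultimately show "p = p'"
    using bmap_dual[of r s a r s a] bmap_dual[of r s a r' s' a'] by (auto split: if_splits)
qed

lemma sum_map_apply: "(\<Sum>p\<in>I. map_scale (c p) (f p)) u w g = (\<Sum>p\<in>I. c p * f p u w g)"
  for f :: "'i \<Rightarrow> 'v \<Rightarrow> 'v \<Rightarrow> 'g \<Rightarrow> complex"
  by (induction I rule: infinite_finite_induct) (auto simp: map_scale_def)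

lemma dual_sum:
  assumes "(r, s, a) \<in> index"
  shows "(\<Sum>p\<in>index. map_scale (c p) (bmap p)) (v r) (v s) a = c (r, s, a)"
proof -
  have "(\<Sum>p\<in>index. map_scale (c p) (bmap p)) (v r) (v s) a = (\<Sum>p\<in>index. if p = (r, s, a) then c p else 0)"
    unfolding sum_map_apply using bmap_dual[OF assms] by (intro sum.cong) auto
  then show ?thesis using assms finite_index by simp
qed

lemma bmap_independent: "M.independent (bmap ` index)"
proof (rule M.independent_if_scalars_zero)
  show "finite (bmap ` index)" using finite_index by simp
  fix c x assume sum: "(\<Sum>x\<in>bmap ` index. map_scale (c x) x) = 0" and x: "x \<in> bmap ` index"
  obtain r s a where p: "(r, s, a) \<in> index" "x = bmap (r, s, a)" using x by auto
  have "(\<Sum>p\<in>index. map_scale (c (bmap p)) (bmap p)) = 0"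
    using sum by (simp add: sum.reindex[OF inj_bmap])
  then show "c x = 0" using dual_sum[OF p(1), of "\<lambda>p. c (bmap p)"] p(2) by simp
qed

text \<open>
  The coordinates of \<open>\<kappa>\<close> are its values \<open>\<kappa> r s a\<close>. The combination with these coordinates and \<open>\<kappa>\<close> agree at
  \<open>(v\<^sub>i, v\<^sub>j)\<close> and \<open>a\<close> if \<open>(i, j, a)\<close> is an index; otherwise both vanish there, since a nonzero value
  \<open>\<kappa> i j a\<close> would force the conditions of the index set. Equivariance extends the agreement from the
  representatives to \<open>G\<close>, and skewness from \<open>i < j\<close> to all pairs.
\<close>
lemma bmap_span: "M.span (bmap ` index) = K"
proof
  have "bmap ` index \<subseteq> K" using bmap_in_hecke_maps by auto
  then show "M.span (bmap ` index) \<subseteq> K" using hecke_maps_subspace by (rule M.span_minimal)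
  show "K \<subseteq> M.span (bmap ` index)"
  proof
    fix \<kappa> assume k: "\<kappa> \<in> K"
    let ?s = "\<Sum>p\<in>index. map_scale (case p of (r, s, a) \<Rightarrow> \<kappa> (v r) (v s) a) (bmap p)"
    have sK: "?s \<in> K"
      using bmap_in_hecke_maps by (intro M.subspace_sum[OF hecke_maps_subspace] M.subspace_scale[OF hecke_maps_subspace]) auto
    note bil = hecke_mapsD(1)[OF k] and skew = hecke_mapsD(2)[OF k] and equi = hecke_mapsD(3)[OF k] and jac = hecke_mapsD(4)[OF k]
    note sbil = hecke_mapsD(1)[OF sK] and sskew = hecke_mapsD(2)[OF sK] and sequi = hecke_mapsD(3)[OF sK]
    have at_reps: "?s (v i) (v j) a = \<kappa> (v i) (v j) a" if ij: "i \<in> X" "j \<in> X" "i < j" and a: "a \<in> R" for i j a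
    proof (cases "(i, j, a) \<in> index")
      case True
      then show ?thesis by (simp add: dual_sum)
    next
      case False
      have ac: "a \<in> carrier G" using a by (rule R_carrier)
      have "\<kappa> (v i) (v j) a = 0"
      proof (rule ccontr)
        assume nz: "\<kappa> (v i) (v j) a \<noteq> 0"
        have "lam h i = inverse (lam h j)" if h: "h \<in> centralizer G a" for h
        proof -
          have hc: "h \<in> carrier G" "h \<otimes> a = a \<otimes> h" using h by (auto simp: centralizer_def)
          have "inv h \<otimes> a \<otimes> h = a" using hc ac by (simp add: m_assoc flip: hc(2)) (simp flip: m_assoc)
          then have "\<kappa> (v i) (v j) a = lam h i * lam h j * \<kappa> (v i) (v j) a"
            using equi[OF ij(1,2) hc(1) ac] by simp
          then have "lam h j * lam h i = 1" using nz by (simp add: mult.commute)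
          then show ?thesis by (rule inverse_unique[symmetric])
        qed
        moreover have "q i l * q j l = lam a l" if "l \<in> X" "l \<noteq> i" "l \<noteq> j" for l
          using jac[of i j l a] ij ac nz that by simp
        ultimately have "(i, j, a) \<in> index" using ij a by (auto simp: index_iff)
        then show False using False by simp
      qed
      moreover have "bmap p (v i) (v j) a = 0" if p: "p \<in> index" for p
      proof -
        obtain r s b where p': "p = (r, s, b)" by (cases p)
        with p have rs: "r < s" "b \<in> R" by (auto simp: index_iff)
        have "coeff r s i j = 0 \<or> class_sum r s b a = 0"
        proof (cases "i = r \<and> j = s")
          case True
          then have "a \<noteq> b" using False p p' by auto
          then have "a \<notin> conjugacy_class G b" using R_unique a rs by blast
          then show ?thesis using class_sum_outside R_carrier rs by blast
        next
          case False
          then show ?thesis using ij rs by (auto simp: coeff_def)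
        qed
        then show ?thesis using bmap_basis[OF ij(1,2)] p' by auto
      qed
      ultimately show ?thesis unfolding sum_map_apply by simp
    qed
    have upper: "?s (v i) (v j) g = \<kappa> (v i) (v j) g" if ij: "i \<in> X" "j \<in> X" "i < j" and g: "g \<in> carrier G" for i j g
    proof -
      obtain a x where a: "a \<in> R" "x \<in> carrier G" "g = x \<otimes> a \<otimes> inv x" using R_exists[OF g] by blast
      have ac: "a \<in> carrier G" using a(1) by (rule R_carrier)
      have "?s (v i) (v j) (inv (inv x) \<otimes> a \<otimes> inv x) = \<kappa> (v i) (v j) (inv (inv x) \<otimes> a \<otimes> inv x)"
        unfolding sequi[OF ij(1,2) inv_closed[OF a(2)] ac] equi[OF ij(1,2) inv_closed[OF a(2)] ac]
        using at_reps[OF ij a(1)] by simp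
      then show ?thesis using a by simp
    qed
    have "?s = \<kappa>"
    proof (rule bilinear_eqI[OF sbil bil])
      fix i j g assume ij: "i \<in> X" "j \<in> X" and g: "g \<in> carrier G"
      consider "i < j" | "j < i" | "i = j" by linarith
      then show "?s (v i) (v j) g = \<kappa> (v i) (v j) g"
      proof cases
        case 1 then show ?thesis using upper ij g by blast
      next
        case 2
        show ?thesis unfolding sskew[OF ij] skew[OF ij] using upper[OF ij(2,1) 2 g] by simp
      next
        case 3
        have "?s (v i) (v i) g = - ?s (v i) (v i) g" using sskew[OF ij(1,1), of g] q_one[OF ij(1)] by simp
        moreover have "\<kappa> (v i) (v i) g = - \<kappa> (v i) (v i) g" using skew[OF ij(1,1), of g] q_one[OF ij(1)] by simp
        ultimately show ?thesis using 3 by simp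
      qed
    qed
    moreover have "?s \<in> M.span (bmap ` index)"
      by (intro M.span_sum M.span_scale M.span_base imageI)
    ultimately show "\<kappa> \<in> M.span (bmap ` index)" by simp
  qed
qed

end

theorem theorem5p4:
  fixes G :: "('g, 'm) monoid_scheme"
    and scale :: "complex \<Rightarrow> 'v::ab_group_add \<Rightarrow> 'v"
    and n :: nat
    and v :: "nat \<Rightarrow> 'v"
    and act :: "'g \<Rightarrow> 'v \<Rightarrow> 'v"
    and lam :: "'g \<Rightarrow> nat \<Rightarrow> complex"
    and q :: "nat \<Rightarrow> nat \<Rightarrow> complex"
    and R :: "'g set"
    and T :: "'g \<Rightarrow> 'g set"
  assumes "group G" and "finite (carrier G)"
    and "finite_dimensional_vector_space scale (v ` {1..n})" and "inj_on v {1..n}"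
    and "group_action G UNIV act"
    and "\<And>g. g \<in> carrier G \<Longrightarrow> Vector_Spaces.linear scale scale (act g)"
    and "\<And>g i. g \<in> carrier G \<Longrightarrow> i \<in> {1..n} \<Longrightarrow> act g (v i) = scale (lam g i) (v i)"
    and "\<And>i j. i \<in> {1..n} \<Longrightarrow> j \<in> {1..n} \<Longrightarrow> q i j \<noteq> 0"
    and "\<And>i. i \<in> {1..n} \<Longrightarrow> q i i = 1"
    and "\<And>i j. i \<in> {1..n} \<Longrightarrow> j \<in> {1..n} \<Longrightarrow> q j i = inverse (q i j)"
    and "conjugacy_class_reps G R"
    and "\<And>a. a \<in> carrier G \<Longrightarrow> left_coset_reps G (centralizer G a) (T a)"
  shows "let f = (\<lambda>(r, s, a). basis_map G n scale v lam q (T a) r s a);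
             I = basis_index G n lam q R;
             K = hecke_maps G n scale v lam q
         in module.subspace map_scale K \<and>
            inj_on f I \<and> \<not> module.dependent map_scale (f ` I) \<and>
            module.span map_scale (f ` I) = K"
proof -
  interpret G: group G by fact
  interpret V: finite_dimensional_vector_space scale "v ` {1..n}" by fact
  interpret A: group_action G UNIV act by fact
  have nz: "v i \<noteq> 0" if "i \<in> {1..n}" for i
    using that V.independent_Basis V.dependent_zero by (metis imageI)
  have cancel: "c = d" if "scale c (v i) = scale d (v i)" "i \<in> {1..n}" for c d i
    using that nz by (simp add: V.scale_right_imp_eq)
  \<comment> \<open>The factors \<open>lam g i\<close> are characters because they are eigenvalues on the nonzero vectors \<open>v i\<close>.\<close>
  interpret D: diagonal_action G n lam
  proof unfold_locales
    fix g h i assume g: "g \<in> carrier G" and h: "h \<in> carrier G" and i: "i \<in> {1..n}"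
    have "act (g \<otimes>\<^bsub>G\<^esub> h) (v i) = act g (act h (v i))" using A.composition_rule g h by simp
    also have "\<dots> = scale (lam h i) (act g (v i))"
      using assms(6)[OF g] assms(7)[OF h i] by (simp add: Vector_Spaces.linear_iff)
    finally show "lam (g \<otimes>\<^bsub>G\<^esub> h) i = lam g i * lam h i"
      using assms(7)[OF g i] assms(7)[OF G.m_closed[OF g h] i] cancel i by (simp add: mult.commute)
  next
    fix i assume i: "i \<in> {1..n}"
    have "act \<one>\<^bsub>G\<^esub> (v i) = v i" using A.id_eq_one by (metis UNIV_I restrict_apply')
    then show "lam \<one>\<^bsub>G\<^esub> i = 1" using assms(7)[OF G.one_closed i] cancel[of _ i 1] i by simp
  qed fact
  interpret diagonal_hecke_setting G n lam scale v q R T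
  proof unfold_locales
    fix i j assume ij: "i \<in> {1..n}" "j \<in> {1..n}"
    show "q i j * q j i = 1" unfolding assms(10)[OF ij] using assms(8)[OF ij] by simp
  qed (use assms(4,9,11,12) in blast)+
  show ?thesis
    using hecke_maps_subspace inj_bmap bmap_independent bmap_span unfolding Let_def bmap_def by blast
qed

end
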